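(* Let $U$ be a bounded open subset of $\mathbb{R}^d$ with $d \geq 3$, and let $c \in L^{1}(U)$ with $c \ge 0$. Then: (i) If $v \in H^{1,2}_0(U)$ with $cv \in L^1(U)$ satisfies $\int_{U} \langle \nabla v, \nabla \varphi \rangle \,dx + \int_{U} c v \varphi\,dx = 0$ for all $\varphi \in C_0^{\infty}(U)$, then $v=0$ a.e. in $U$. (ii) If $f \in L^{\frac{\hat{p}d}{d+\hat{p}}}(U)$ for some $\hat{p} \in (d, \infty)$, then there exists $u \in H^{1,2}_0(U) \cap L^{\infty}(U)$ with $\int_{U} \langle \nabla u, \nabla \varphi \rangle\,dx + \int_{U} c u \varphi\,dx = \int_{U} f \varphi \,dx$ for all $\varphi \in C_0^{\infty}(U)$, such that $$\| \nabla u \|_{L^2(U)} \le \frac{2(d-1)}{d-2} \, \|f\|_{L^{\frac{2d}{d+2}}(U)}, \qquad \|u \|_{L^{\infty}(U)} \leq C \|f \|_{L^{\frac{\hat pd}{d+\hat p}}(U)},$$ where $C>0$ depends only on $d$, $\hat p$ and $|U|$.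
   Context: $H^{1,2}_0(U)$ is the closure of $C_0^\infty(U)$ in $W^{1,2}(U)$; $|U|$ is the Lebesgue measure of $U$. *)

theory Defs
  imports "HOL-Analysis.Analysis"
begin

fun pderivs :: "(real^'n \<Rightarrow> real) \<Rightarrow> 'n list \<Rightarrow> (real^'n \<Rightarrow> real)" where
  "pderivs f [] = f"
| "pderivs f (i # is) = (\<lambda>x. frechet_derivative (pderivs f is) (at x) (axis i 1))"

definition smooth :: "(real^'n \<Rightarrow> real) \<Rightarrow> bool" where
  "smooth f \<longleftrightarrow> (\<forall>is x. pderivs f is differentiable (at x))"

definition tsupp :: "(real^'n \<Rightarrow> real) \<Rightarrow> (real^'n) set" where
  "tsupp f = closure {x. f x \<noteq> 0}"

definition test_fun :: "(real^'n) set \<Rightarrow> (real^'n \<Rightarrow> real) \<Rightarrow> bool" where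
  "test_fun U \<phi> \<longleftrightarrow> smooth \<phi> \<and> compact (tsupp \<phi>) \<and> tsupp \<phi> \<subseteq> U"

definition grad :: "(real^'n \<Rightarrow> real) \<Rightarrow> real^'n \<Rightarrow> real^'n" where
  "grad f x = (\<chi> i. frechet_derivative f (at x) (axis i 1))"

text \<open>Membership in H^{1,2}_0(U), the closure of C_0^infinity(U) in W^{1,2}(U):
  v (with gradient G) is the W^{1,2}(U)-limit of a sequence of test functions.
  G is then the weak gradient of v.\<close>
definition H0 :: "(real^'n) set \<Rightarrow> (real^'n \<Rightarrow> real) \<Rightarrow> (real^'n \<Rightarrow> real^'n) \<Rightarrow> bool" where
  "H0 U v G \<longleftrightarrow>
     v \<in> borel_measurable (lebesgue_on U) \<and> G \<in> borel_measurable (lebesgue_on U) \<and>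
     integrable (lebesgue_on U) (\<lambda>x. (v x)^2) \<and>
     integrable (lebesgue_on U) (\<lambda>x. (norm (G x))^2) \<and>
     (\<exists>\<phi> :: nat \<Rightarrow> real^'n \<Rightarrow> real. (\<forall>k. test_fun U (\<phi> k)) \<and>
        ((\<lambda>k. (\<integral>x. (\<phi> k x - v x)^2 + (norm (grad (\<phi> k) x - G x))^2 \<partial>lebesgue_on U))
           \<longlonglongrightarrow> 0))"

definition in_Lp :: "real \<Rightarrow> (real^'n) set \<Rightarrow> (real^'n \<Rightarrow> real) \<Rightarrow> bool" where
  "in_Lp p U f \<longleftrightarrow> f \<in> borel_measurable (lebesgue_on U) \<and>
     integrable (lebesgue_on U) (\<lambda>x. \<bar>f x\<bar> powr p)"

definition Lp_norm :: "real \<Rightarrow> (real^'n) set \<Rightarrow> (real^'n \<Rightarrow> real) \<Rightarrow> real" where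
  "Lp_norm p U f = (\<integral>x. \<bar>f x\<bar> powr p \<partial>lebesgue_on U) powr (1 / p)"

definition in_Linf :: "(real^'n) set \<Rightarrow> (real^'n \<Rightarrow> real) \<Rightarrow> bool" where
  "in_Linf U u \<longleftrightarrow> u \<in> borel_measurable (lebesgue_on U) \<and>
     (\<exists>M. AE x in lebesgue_on U. \<bar>u x\<bar> \<le> M)"

definition Linf_norm :: "(real^'n) set \<Rightarrow> (real^'n \<Rightarrow> real) \<Rightarrow> real" where
  "Linf_norm U u = Inf {M. 0 \<le> M \<and> (AE x in lebesgue_on U. \<bar>u x\<bar> \<le> M)}"

end

theory Submission
  imports Defs
begin

text \<open>Everything is reduced to test functions. A sequence of test functions that is Cauchy in the energy
  norm has a subsequence converging almost everywhere together with its gradients and dominated by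
  an \<open>L\<^sup>2\<close> function, so that all limits are instances of dominated convergence. The Sobolev inequality
  with constant \<open>2(d-1)/(d-2)\<close> comes from the Gagliardo--Nirenberg argument applied to
  \<open>|\<phi>|\<close> raised to the power \<open>2(d-1)/(d-2)\<close>.

  Since \<open>c\<close> is only integrable, a weak solution \<open>u\<close> is tested with \<open>\<Psi>(u)\<close> for bounded \<open>C\<^sup>1\<close> functions
  \<open>\<Psi>\<close> vanishing on \<open>[-k,k]\<close>; the zero order term then has a good sign and Stampacchia's iteration on the
  level sets of \<open>|u|\<close> bounds \<open>u\<close> by the \<open>L\<^sup>q\<close> norm of \<open>f\<close>. Uniqueness is the case \<open>f = 0\<close>.
  Existence is Riesz' theorem for the form \<open>\<integral> \<nabla>u \<cdot> \<nabla>\<phi> + \<integral> c u \<phi>\<close>.\<close>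

section \<open>Smooth functions and test functions\<close>

text \<open>The obstacle is that \<open>c\<close> is merely integrable: \<open>c v \<eta>\<close> is
  known to be integrable only for bounded \<open>\<eta>\<close>, so \<open>v\<close> itself is not
  admissible in the weak equation, and \<open>\<Psi>(u)\<close> has to be approximated by test
  functions with a uniform bound. Taking \<open>\<Psi>\<close> of class C^1 instead of piecewise
  linear avoids a chain rule for Lipschitz functions. The exponents fit because
  \<open>q = p d / (d + p)\<close> means \<open>1/q = 1/d + 1/p\<close>. The measures of the level
  sets then obey a recursion with exponent \<open>1/s + \<tau>\<close>, where
  \<open>\<tau> = 1/d - 1/p\<close>, and the iteration needs \<open>\<tau> > 0\<close>, which is
  \<open>p > d\<close>. The number 2(d-1)/(d-2) has two roles: it is the power for which both sides
  of the Gagliardo--Nirenberg inequality carry the same integral, and, brought down by the chain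
  rule, it becomes the Sobolev constant. By duality it is then the constant of the gradient
  estimate. The sup bound is proved with the norm of \<open>f\<close> enlarged by some
  \<open>e > 0\<close>, because the iteration needs a positive final level even for
  \<open>f = 0\<close>. Letting \<open>e\<close> tend to 0 gives both the estimate and
  uniqueness.\<close>

definition smooth_upto :: "nat \<Rightarrow> (real^'n \<Rightarrow> real) \<Rightarrow> bool" where
  "smooth_upto n f \<longleftrightarrow> (\<forall>is x. length is \<le> n \<longrightarrow> pderivs f is differentiable (at x))"

lemma smooth_iff_smooth_upto: "smooth f \<longleftrightarrow> (\<forall>n. smooth_upto n f)"
  unfolding smooth_def smooth_upto_def by blast

lemma smooth_upto_0: "smooth_upto 0 f \<longleftrightarrow> (\<forall>x. f differentiable (at x))"
  by (simp add: smooth_upto_def)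

lemma pderivs_snoc: "pderivs f (is @ [i]) = pderivs (pderivs f [i]) is"
  by (induction "is") auto

text \<open>\<open>pderivs\<close> puts the head of the list outermost, whereas sum and product
  rules rewrite the derivative that is taken first, the last entry. Splitting off that entry allows
  induction on the order with the function generalised.\<close>

lemma smooth_upto_Suc:
  "smooth_upto (Suc n) f \<longleftrightarrow> (\<forall>x. f differentiable (at x)) \<and> (\<forall>i. smooth_upto n (pderivs f [i]))"
proof
  assume a: "smooth_upto (Suc n) f"
  have "f differentiable at x" for x
    using a[unfolded smooth_upto_def, rule_format, of "[]" x] by simp
  moreover have "pderivs (pderivs f [i]) is differentiable at x" if "length is \<le> n" for i "is" x
    using a[unfolded smooth_upto_def, rule_format, of "is @ [i]" x] that
    by (simp only: pderivs_snoc) simp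
  ultimately show "(\<forall>x. f differentiable (at x)) \<and> (\<forall>i. smooth_upto n (pderivs f [i]))"
    by (simp add: smooth_upto_def)
next
  assume a: "(\<forall>x. f differentiable (at x)) \<and> (\<forall>i. smooth_upto n (pderivs f [i]))"
  show "smooth_upto (Suc n) f"
    unfolding smooth_upto_def
  proof (intro allI impI)
    fix "is" :: "'a list" and x
    assume l: "length is \<le> Suc n"
    show "pderivs f is differentiable at x"
    proof (cases "is" rule: rev_cases)
      case Nil
      then show ?thesis using a by simp
    next
      case (snoc ys i)
      then show ?thesis using a l unfolding smooth_upto_def by (simp only: pderivs_snoc) simp
    qed
  qed
qed

lemma smooth_upto_Suc_imp: "smooth_upto (Suc n) f \<Longrightarrow> smooth_upto n f"
  unfolding smooth_upto_def by simp

lemma smooth_upto_add: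
  "smooth_upto n f \<Longrightarrow> smooth_upto n g \<Longrightarrow> smooth_upto n (\<lambda>x. f x + g x)"
proof (induction n arbitrary: f g)
  case (Suc n)
  then have d: "f differentiable at x" "g differentiable at x" for x
    by (auto simp: smooth_upto_Suc)
  have "pderivs (\<lambda>x. f x + g x) [i] = (\<lambda>x. pderivs f [i] x + pderivs g [i] x)" for i
  proof
    fix x
    have "((\<lambda>x. f x + g x) has_derivative
        (\<lambda>h. frechet_derivative f (at x) h + frechet_derivative g (at x) h)) (at x)"
      using d frechet_derivative_works by (intro has_derivative_add) blast+
    then show "pderivs (\<lambda>x. f x + g x) [i] x = pderivs f [i] x + pderivs g [i] x"
      by (simp add: frechet_derivative_at[symmetric])
  qed
  then show ?case
    using Suc d by (simp add: smooth_upto_Suc)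
qed (auto simp: smooth_upto_0)

text \<open>The Leibniz rule produces products of a function with a derivative, so the induction
  must work with a finite order of smoothness: the undifferentiated factor is used at order
  \<open>n\<close>, one less than is available.\<close>

lemma smooth_upto_mult:
  "smooth_upto n f \<Longrightarrow> smooth_upto n g \<Longrightarrow> smooth_upto n (\<lambda>x. f x * g x)"
proof (induction n arbitrary: f g)
  case (Suc n)
  then have d: "f differentiable at x" "g differentiable at x" for x
    by (auto simp: smooth_upto_Suc)
  have "pderivs (\<lambda>x. f x * g x) [i] = (\<lambda>x. f x * pderivs g [i] x + pderivs f [i] x * g x)" for i
  proof
    fix x
    have "((\<lambda>x. f x * g x) has_derivative
        (\<lambda>h. f x * frechet_derivative g (at x) h + frechet_derivative f (at x) h * g x)) (at x)"
      using d frechet_derivative_works by (intro has_derivative_mult) blast+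
    then show "pderivs (\<lambda>x. f x * g x) [i] x = f x * pderivs g [i] x + pderivs f [i] x * g x"
      by (simp add: frechet_derivative_at[symmetric])
  qed
  then show ?case
    using Suc d smooth_upto_Suc_imp[OF Suc.prems(1)] smooth_upto_Suc_imp[OF Suc.prems(2)]
    by (auto simp add: smooth_upto_Suc intro!: smooth_upto_add)
qed (auto simp: smooth_upto_0)

lemma smooth_upto_const: "smooth_upto n (\<lambda>x. c)"
proof (induction n arbitrary: c)
  case (Suc n)
  have "pderivs (\<lambda>x. c) [i] = (\<lambda>x. 0)" for i by (simp add: frechet_derivative_const)
  then show ?case using Suc by (simp add: smooth_upto_Suc)
qed (auto simp: smooth_upto_0)

lemma smooth_const: "smooth (\<lambda>x. c)"
  by (simp add: smooth_iff_smooth_upto smooth_upto_const)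

lemma smooth_add: "smooth f \<Longrightarrow> smooth g \<Longrightarrow> smooth (\<lambda>x. f x + g x)"
  by (simp add: smooth_iff_smooth_upto smooth_upto_add)

lemma smooth_mult: "smooth f \<Longrightarrow> smooth g \<Longrightarrow> smooth (\<lambda>x. f x * g x)"
  by (simp add: smooth_iff_smooth_upto smooth_upto_mult)

lemma smooth_power: "smooth f \<Longrightarrow> smooth (\<lambda>x. f x ^ n)"
  by (induction n) (simp_all add: smooth_const smooth_mult)

lemma smooth_sum: "(\<And>i. i \<in> A \<Longrightarrow> smooth (f i)) \<Longrightarrow> smooth (\<lambda>x. \<Sum>i\<in>A. f i x)"
  by (induction A rule: infinite_finite_induct) (simp_all add: smooth_const smooth_add)

lemma smooth_differentiable: "smooth f \<Longrightarrow> f differentiable (at x)"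
  unfolding smooth_def by (drule spec[of _ "[]"]) simp

lemma smooth_has_derivative: "smooth f \<Longrightarrow> (f has_derivative (\<lambda>h. grad f x \<bullet> h)) (at x)"
proof -
  assume f: "smooth f"
  have D: "(f has_derivative frechet_derivative f (at x)) (at x)"
    using smooth_differentiable[OF f] by (simp add: frechet_derivative_works)
  have lin: "linear (frechet_derivative f (at x))"
    using D by (rule has_derivative_linear)
  have "frechet_derivative f (at x) h = grad f x \<bullet> h" for h
  proof -
    have "frechet_derivative f (at x) h = frechet_derivative f (at x) (\<Sum>i\<in>UNIV. h $ i *\<^sub>R axis i 1)"
      using basis_expansion[of h] by (simp add: scalar_mult_eq_scaleR)
    also have "\<dots> = (\<Sum>i\<in>UNIV. h $ i * frechet_derivative f (at x) (axis i 1))"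
      using lin by (simp add: linear_sum linear_cmul)
    finally show ?thesis by (simp add: grad_def inner_vec_def mult.commute)
  qed
  then show ?thesis using D by (metis (no_types, lifting) ext)
qed

lemma grad_eqI:
  assumes "(f has_derivative (\<lambda>h. g \<bullet> h)) (at x)"
  shows "grad f x = g"
  unfolding grad_def frechet_derivative_at[OF assms, symmetric]
  by (simp add: vec_eq_iff inner_axis)

lemma continuous_on_smooth: "smooth f \<Longrightarrow> continuous_on A f"
  by (meson continuous_at_imp_continuous_on differentiable_imp_continuous_within smooth_differentiable)

lemma continuous_on_grad:
  assumes "smooth f" shows "continuous_on A (grad f)"
proof -
  have "pderivs f [i] differentiable at x" for i x
    using assms unfolding smooth_def by blast
  then have "continuous_on A (pderivs f [i])" for i
    by (meson continuous_at_imp_continuous_on differentiable_imp_continuous_within)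
  then show ?thesis unfolding grad_def by (intro continuous_on_vec_lambda) simp
qed

lemma grad_lincomb:
  assumes "smooth f" "smooth g"
  shows "grad (\<lambda>x. f x + t * g x) x = grad f x + t *\<^sub>R grad g x"
proof (rule grad_eqI)
  show "((\<lambda>x. f x + t * g x) has_derivative (\<lambda>h. (grad f x + t *\<^sub>R grad g x) \<bullet> h)) (at x)"
    using smooth_has_derivative[OF assms(1)] smooth_has_derivative[OF assms(2)]
    by (auto intro!: derivative_eq_intros simp: inner_add_left)
qed

lemma grad_compose:
  assumes "smooth f" "(P has_real_derivative p) (at (f x))"
  shows "grad (\<lambda>x. P (f x)) x = p *\<^sub>R grad f x"
proof (rule grad_eqI)
  have "((\<lambda>x. P (f x)) has_derivative (\<lambda>h. p * (grad f x \<bullet> h))) (at x)"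
    using has_derivative_compose[OF smooth_has_derivative[OF assms(1)] assms(2)[unfolded has_field_derivative_def]]
    by simp
  then show "((\<lambda>x. P (f x)) has_derivative (\<lambda>h. (p *\<^sub>R grad f x) \<bullet> h)) (at x)" by simp
qed

lemma test_funI:
  assumes "smooth g" "compact K" "K \<subseteq> U" "\<And>x. x \<notin> K \<Longrightarrow> g x = 0"
  shows "test_fun U g"
proof -
  have "{x. g x \<noteq> 0} \<subseteq> K" using assms(4) by auto
  then have s: "tsupp g \<subseteq> K"
    unfolding tsupp_def using assms(2) by (simp add: closure_minimal compact_imp_closed)
  then have "compact (tsupp g)"
    using assms(2) by (metis tsupp_def closed_closure compact_Int_closed inf.absorb_iff2)
  then show ?thesis using s assms by (auto simp: test_fun_def)
qed

lemma tsupp_eq_0: "x \<notin> tsupp f \<Longrightarrow> f x = 0"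
  unfolding tsupp_def using closure_subset[of "{x. f x \<noteq> 0}"] by auto

lemma test_fun_smooth: "test_fun U f \<Longrightarrow> smooth f"
  by (simp add: test_fun_def)

lemma test_fun_eq_0: "test_fun U f \<Longrightarrow> x \<notin> U \<Longrightarrow> f x = 0"
  using tsupp_eq_0[of x f] by (auto simp: test_fun_def)

lemma grad_eq_0:
  assumes "x \<notin> tsupp f" shows "grad f x = 0"
proof (rule grad_eqI)
  have "((\<lambda>x. 0::real) has_derivative (\<lambda>h. 0 \<bullet> h)) (at x)" by simp
  then show "(f has_derivative (\<lambda>h. 0 \<bullet> h)) (at x)"
  proof (rule has_derivative_transform_within_open)
    show "open (- tsupp f)" by (simp add: tsupp_def open_Compl)
    show "0 = f y" if "y \<in> - tsupp f" for y
      using tsupp_eq_0[of y f] that by simp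
  qed (use assms in simp)
qed

lemma test_fun_lincomb:
  assumes "test_fun U f" "test_fun U g"
  shows "test_fun U (\<lambda>x. f x + t * g x)"
proof (rule test_funI)
  show "smooth (\<lambda>x. f x + t * g x)"
    using assms by (intro smooth_add[of f] smooth_mult[of _ g] smooth_const) (auto simp: test_fun_def)
  show "compact (tsupp f \<union> tsupp g)" "tsupp f \<union> tsupp g \<subseteq> U"
    using assms by (auto simp: test_fun_def)
  show "f x + t * g x = 0" if "x \<notin> tsupp f \<union> tsupp g" for x
    using that by (simp add: tsupp_eq_0)
qed

lemma test_fun_const_0: "test_fun U (\<lambda>x. 0)"
  by (rule test_funI[OF smooth_const compact_empty]) auto

text \<open>The powers start at one: without a constant term the polynomial vanishes wherever
  \<open>f\<close> does, which keeps the support compact in \<open>U\<close>.\<close>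

lemma test_fun_polynomial:
  assumes "test_fun U f"
  shows "test_fun U (\<lambda>x. \<Sum>i\<le>n. a i * f x ^ Suc i)"
proof (rule test_funI)
  have "smooth (\<lambda>x. f x ^ Suc i)" for i
    using assms by (intro smooth_power) (simp add: test_fun_def)
  then show "smooth (\<lambda>x. \<Sum>i\<le>n. a i * f x ^ Suc i)"
    by (intro smooth_sum smooth_mult[OF smooth_const])
  show "compact (tsupp f)" "tsupp f \<subseteq> U"
    using assms by (auto simp: test_fun_def)
  show "(\<Sum>i\<le>n. a i * f x ^ Suc i) = 0" if "x \<notin> tsupp f" for x
    using that by (simp add: tsupp_eq_0)
qed

lemma test_fun_bounded:
  assumes "test_fun U f"
  obtains M where "M > 0" "\<And>x. \<bar>f x\<bar> \<le> M" "\<And>x. norm (grad f x) \<le> M"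
proof -
  have K: "compact (tsupp f)" and s: "smooth f" using assms by (auto simp: test_fun_def)
  have "bounded (f ` tsupp f)"
    using K by (intro compact_imp_bounded compact_continuous_image continuous_on_smooth s)
  then obtain A where A: "A > 0" "\<And>x. x \<in> tsupp f \<Longrightarrow> \<bar>f x\<bar> \<le> A"
    by (auto simp: bounded_pos)
  have "bounded (grad f ` tsupp f)"
    using K by (intro compact_imp_bounded compact_continuous_image continuous_on_grad s)
  then obtain B where B: "B > 0" "\<And>x. x \<in> tsupp f \<Longrightarrow> norm (grad f x) \<le> B"
    by (auto simp: bounded_pos)
  show ?thesis
  proof
    show "max A B > 0" using A by simp
    show "\<bar>f x\<bar> \<le> max A B" for x
      using A by (cases "x \<in> tsupp f") (force simp: tsupp_eq_0)+
    show "norm (grad f x) \<le> max A B" for x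
      using B by (cases "x \<in> tsupp f") (force simp: grad_eq_0)+
  qed
qed

section \<open>Dominated subsequences in the space of square integrable functions\<close>

lemma integrable_norm_diff_power2:
  fixes f g :: "'a \<Rightarrow> 'b::{banach, second_countable_topology}"
  assumes [measurable]: "f \<in> borel_measurable M" "g \<in> borel_measurable M"
    and "integrable M (\<lambda>x. (norm (f x))\<^sup>2)" "integrable M (\<lambda>x. (norm (g x))\<^sup>2)"
  shows "integrable M (\<lambda>x. (norm (f x - g x))\<^sup>2)"
proof (rule Bochner_Integration.integrable_bound)
  show "integrable M (\<lambda>x. 2 * (norm (f x))\<^sup>2 + 2 * (norm (g x))\<^sup>2)"
    using assms by simp
  have "(norm (f x - g x))\<^sup>2 \<le> 2 * (norm (f x))\<^sup>2 + 2 * (norm (g x))\<^sup>2" for x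
  proof -
    have "(norm (f x - g x))\<^sup>2 \<le> (norm (f x) + norm (g x))\<^sup>2"
      by (intro power_mono norm_triangle_ineq4) simp
    also have "\<dots> \<le> 2 * (norm (f x))\<^sup>2 + 2 * (norm (g x))\<^sup>2"
      using sum_squares_bound[of "norm (f x)" "norm (g x)"] by (simp add: power2_sum)
    finally show ?thesis .
  qed
  then show "AE x in M. norm ((norm (f x - g x))\<^sup>2) \<le> norm (2 * (norm (f x))\<^sup>2 + 2 * (norm (g x))\<^sup>2)"
    by auto
qed measurable

text \<open>This is the Riesz--Fischer argument, with the majorant kept: along a fast subsequence
  the increments are summable almost everywhere, and the first term plus the sum of their norms
  dominates all terms at once. Values in a Banach space let a function and its gradient be treated
  as one tuple.\<close>

lemma L2_Cauchy_dominated_subseq: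
  fixes f :: "nat \<Rightarrow> 'a \<Rightarrow> 'b::{banach, second_countable_topology}"
  assumes fm [measurable]: "\<And>k. f k \<in> borel_measurable M"
    and fi: "\<And>k. integrable M (\<lambda>x. (norm (f k x))\<^sup>2)"
    and C: "\<And>e. e > 0 \<Longrightarrow> \<exists>N. \<forall>m\<ge>N. \<forall>n\<ge>N. (\<integral>x. (norm (f m x - f n x))\<^sup>2 \<partial>M) < e"
  obtains r g D where "strict_mono (r :: nat \<Rightarrow> nat)" "g \<in> borel_measurable M" "D \<in> borel_measurable M"
    "integrable M (\<lambda>x. (D x :: real)\<^sup>2)" "AE x in M. (\<lambda>k. f (r k) x) \<longlonglongrightarrow> g x"
    "AE x in M. \<forall>k. norm (f (r k) x) \<le> D x"
proof -
  have "\<forall>k. \<exists>N. \<forall>m\<ge>N. \<forall>n\<ge>N. (\<integral>x. (norm (f m x - f n x))\<^sup>2 \<partial>M) < (1/16)^k"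
    using C by simp
  then obtain N where N: "\<And>k m n. m \<ge> N k \<Longrightarrow> n \<ge> N k \<Longrightarrow> (\<integral>x. (norm (f m x - f n x))\<^sup>2 \<partial>M) < (1/16)^k"
    by metis
  \<comment> \<open>The sum makes \<open>r k\<close> exceed \<open>N k\<close>, and the summand
    \<open>k\<close> makes \<open>r\<close> strictly increasing. Both \<open>r k\<close> and
    \<open>r (Suc k)\<close> lie beyond \<open>N k\<close>, so the increment between them is
    controlled.\<close>
  define r where "r k = (\<Sum>i\<le>k. N i) + k" for k
  have rm: "strict_mono r" by (rule strict_monoI_Suc) (simp add: r_def)
  have rN: "r k \<ge> N k" "r (Suc k) \<ge> N k" for k
    using member_le_sum[of k "{..k}" N] by (auto simp: r_def)
  \<comment> \<open>The weights \<open>4\<^sup>k\<close> make the increments decay geometrically wherever the series converges.\<close>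
  define h where "h k x = 4^k * (norm (f (r (Suc k)) x - f (r k) x))\<^sup>2" for k x
  have hm [measurable]: "h k \<in> borel_measurable M" for k unfolding h_def by measurable
  have h0: "h k x \<ge> 0" for k x by (simp add: h_def)
  have hi: "integrable M (h k)" for k
    unfolding h_def using fi by (intro integrable_mult_right integrable_norm_diff_power2) auto
  have hle: "(\<integral>x. h k x \<partial>M) \<le> (1/4)^k" for k
  proof -
    have "(\<integral>x. h k x \<partial>M) = 4^k * (\<integral>x. (norm (f (r (Suc k)) x - f (r k) x))\<^sup>2 \<partial>M)"
      by (simp add: h_def)
    also have "\<dots> \<le> 4^k * (1/16)^k"
      using N[OF rN(2) rN(1), of k] by (intro mult_left_mono) auto
    also have "\<dots> = (1/4::real)^k" by (simp flip: power_mult_distrib)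
    finally show ?thesis .
  qed
  have sh: "summable (\<lambda>k. \<integral>x. norm (h k x) \<partial>M)"
  proof (rule summable_comparison_test')
    show "summable (\<lambda>k. (1/4::real)^k)" by (rule summable_geometric) simp
    show "norm (\<integral>x. norm (h k x) \<partial>M) \<le> (1/4)^k" for k
      using hle[of k] h0 by simp
  qed
  have AEs: "AE x in M. summable (\<lambda>k. h k x)"
  proof -
    have "(\<integral>\<^sup>+x. (\<Sum>k. ennreal (h k x)) \<partial>M) = (\<Sum>k. \<integral>\<^sup>+x. ennreal (h k x) \<partial>M)"
      by (rule nn_integral_suminf) simp
    also have "\<dots> = (\<Sum>k. ennreal (\<integral>x. h k x \<partial>M))"
      using hi h0 by (simp add: nn_integral_eq_integral)
    also have "\<dots> = ennreal (\<Sum>k. \<integral>x. h k x \<partial>M)"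
      using sh h0 by (intro suminf_ennreal_eq summable_sums) (auto intro: integral_nonneg)
    finally have "(\<integral>\<^sup>+x. (\<Sum>k. ennreal (h k x)) \<partial>M) \<noteq> \<infinity>" by simp
    then have "AE x in M. (\<Sum>k. ennreal (h k x)) \<noteq> \<infinity>"
      by (intro nn_integral_PInf_AE) auto
    then show ?thesis
      by eventually_elim (use h0 in \<open>auto intro!: summable_suminf_not_top\<close>)
  qed
  define W where "W x = (\<Sum>k. h k x)" for x
  have Wm [measurable]: "W \<in> borel_measurable M" unfolding W_def by measurable
  have Wi: "integrable M W"
    unfolding W_def using AEs h0 by (intro integrable_suminf hi sh) auto
  \<comment> \<open>Every single term satisfies \<open>h k x \<le> W x\<close>, so the
    \<open>k\<close>-th increment is at most \<open>sqrt (W x) * (1/2)^k\<close>; the factor 2 is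
    the sum of that geometric series.\<close>
  define D where "D x = norm (f (r 0) x) + 2 * sqrt \<bar>W x\<bar>" for x
  have Dm [measurable]: "D \<in> borel_measurable M" unfolding D_def by measurable
  define g where "g x = lim (\<lambda>k. f (r k) x)" for x
  have *: "(\<lambda>k. f (r k) x) \<longlonglongrightarrow> g x \<and> (\<forall>k. norm (f (r k) x) \<le> D x)" if s: "summable (\<lambda>k. h k x)" for x
  proof -
    have W0: "W x \<ge> 0" unfolding W_def by (rule suminf_nonneg[OF s h0])
    define \<Delta> where "\<Delta> k = f (r (Suc k)) x - f (r k) x" for k
    have \<Delta>: "norm (\<Delta> k) \<le> sqrt (W x) * (1/2)^k" for k
    proof (rule power2_le_imp_le)
      have "h k x \<le> W x"
        unfolding W_def using sum_le_suminf[OF s, of "{k}"] h0 by simp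
      then have "(norm (\<Delta> k))\<^sup>2 \<le> W x / 4^k"
        by (simp add: h_def \<Delta>_def field_simps)
      also have "\<dots> = (sqrt (W x) * (1/2)^k)\<^sup>2"
        using W0 by (simp add: power_mult_distrib power_divide flip: power_mult) (simp add: power_mult mult.commute[of k])
      finally show "(norm (\<Delta> k))\<^sup>2 \<le> (sqrt (W x) * (1/2)^k)\<^sup>2" .
    qed (use W0 in auto)
    have geo: "(\<lambda>k. sqrt (W x) * (1/2)^k) sums (sqrt (W x) * 2)"
      using geometric_sums[of "1/2::real"] by (intro sums_mult) simp
    have sn: "summable (\<lambda>k. norm (\<Delta> k))"
      using \<Delta> by (intro summable_comparison_test'[OF sums_summable[OF geo]]) auto
    have tel: "(\<Sum>k<n. \<Delta> k) = f (r n) x - f (r 0) x" for n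
      unfolding \<Delta>_def by (rule sum_lessThan_telescope)
    have "summable \<Delta>" using sn by (rule summable_norm_cancel)
    then have "(\<lambda>n. f (r n) x - f (r 0) x) \<longlonglongrightarrow> suminf \<Delta>"
      using summable_LIMSEQ[of \<Delta>] by (simp add: tel)
    then have "(\<lambda>n. f (r n) x - f (r 0) x + f (r 0) x) \<longlonglongrightarrow> suminf \<Delta> + f (r 0) x"
      by (intro tendsto_add tendsto_const)
    then have "convergent (\<lambda>n. f (r n) x)" by (auto simp: convergent_def)
    then have 1: "(\<lambda>k. f (r k) x) \<longlonglongrightarrow> g x" unfolding g_def by (simp add: convergent_LIMSEQ_iff)
    have "norm (f (r n) x) \<le> D x" for n
    proof -
      have "norm (f (r n) x) = norm (f (r 0) x + (\<Sum>k<n. \<Delta> k))" by (simp add: tel)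
      also have "\<dots> \<le> norm (f (r 0) x) + (\<Sum>k<n. norm (\<Delta> k))"
        by (intro norm_triangle_le add_left_mono norm_sum)
      also have "(\<Sum>k<n. norm (\<Delta> k)) \<le> (\<Sum>k<n. sqrt (W x) * (1/2)^k)"
        by (intro sum_mono \<Delta>)
      also have "\<dots> \<le> sqrt (W x) * 2"
        using sums_unique[OF geo] W0 by (subst sums_unique[OF geo]) (intro sum_le_suminf[OF sums_summable[OF geo]], auto)
      finally show ?thesis using W0 by (simp add: D_def)
    qed
    then show ?thesis using 1 by auto
  qed
  have Di: "integrable M (\<lambda>x. (D x)\<^sup>2)"
  proof (rule Bochner_Integration.integrable_bound)
    show "integrable M (\<lambda>x. 2 * (norm (f (r 0) x))\<^sup>2 + 8 * \<bar>W x\<bar>)"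
      using fi Wi by simp
    have "(D x)\<^sup>2 \<le> 2 * (norm (f (r 0) x))\<^sup>2 + 8 * \<bar>W x\<bar>" for x
      using sum_squares_bound[of "norm (f (r 0) x)" "2 * sqrt \<bar>W x\<bar>"]
      by (simp add: D_def power2_sum power_mult_distrib)
    then show "AE x in M. norm ((D x)\<^sup>2) \<le> norm (2 * (norm (f (r 0) x))\<^sup>2 + 8 * \<bar>W x\<bar>)"
      by auto
  qed measurable
  have gm: "g \<in> borel_measurable M"
    unfolding g_def by (rule borel_measurable_lim_metric) measurable
  show ?thesis
    by (rule that[OF rm gm Dm Di]) (use AEs * in \<open>auto elim!: eventually_mono\<close>)
qed

section \<open>The Sobolev inequality\<close>

text \<open>Line integrals may be infinite a priori. Roots taken in \<open>ennreal\<close> let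
  Tonelli and Hoelder be applied without integrability conditions; only positive exponents occur
  below.\<close>

definition ennreal_powr :: "ennreal \<Rightarrow> real \<Rightarrow> ennreal" where
  "ennreal_powr x a = (if x = top then top else ennreal (enn2real x powr a))"

lemma ennreal_powr_top [simp]: "ennreal_powr top a = top"
  by (simp add: ennreal_powr_def)

lemma ennreal_powr_ennreal: "0 \<le> x \<Longrightarrow> ennreal_powr (ennreal x) a = ennreal (x powr a)"
  by (simp add: ennreal_powr_def)

lemma ennreal_powr_eq_0_iff [simp]: "ennreal_powr x a = 0 \<longleftrightarrow> x = 0"
  by (cases x) (auto simp: ennreal_powr_def top_unique)

lemma ennreal_powr_mono: "x \<le> y \<Longrightarrow> 0 \<le> a \<Longrightarrow> ennreal_powr x a \<le> ennreal_powr y a"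
  by (cases x; cases y)
     (auto simp: ennreal_powr_def top_unique intro!: ennreal_leI powr_mono2)

lemma measurable_ennreal_powr [measurable]:
  assumes [measurable]: "f \<in> borel_measurable M"
  shows "(\<lambda>x. ennreal_powr (f x) a) \<in> borel_measurable M"
proof -
  have "{x \<in> space M. f x = top} = f -` {top} \<inter> space M" by auto
  also have "\<dots> \<in> sets M" by measurable
  finally have "{x \<in> space M. f x = top} \<in> sets M" .
  then show ?thesis
    unfolding ennreal_powr_def by (intro measurable_If) auto
qed

text \<open>The arithmetic-geometric mean inequality for the normalised numbers
  \<open>y i / A i\<close>. With \<open>A i\<close> the integral of the \<open>i\<close>-th factor,
  the sum on the right integrates to one.\<close>

lemma prod_ennreal_powr_le:
  fixes y :: "'i \<Rightarrow> ennreal"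
  assumes S: "finite S" "S \<noteq> {}" and A: "\<And>i. i \<in> S \<Longrightarrow> A i \<noteq> 0 \<and> A i \<noteq> top"
  shows "(\<Prod>i\<in>S. ennreal_powr (y i) (1 / card S))
    \<le> (\<Prod>i\<in>S. ennreal_powr (A i) (1 / card S)) * (\<Sum>i\<in>S. y i / (A i * of_nat (card S)))"
proof (cases "\<exists>i\<in>S. y i = top")
  case True
  then obtain j where j: "j \<in> S" "y j = top" by blast
  have "A j * of_nat (card S) \<noteq> top" using A[OF j(1)] by (simp add: ennreal_mult_eq_top_iff)
  then have "y j / (A j * of_nat (card S)) = top"
    using j by (simp add: ennreal_top_divide)
  then have "(\<Sum>i\<in>S. y i / (A i * of_nat (card S))) = top"
    using S j by (subst sum.remove[of S j]) auto
  moreover have "(\<Prod>i\<in>S. ennreal_powr (A i) (1 / card S)) \<noteq> 0"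
    using A S by auto
  ultimately have "(\<Prod>i\<in>S. ennreal_powr (A i) (1 / card S)) * (\<Sum>i\<in>S. y i / (A i * of_nat (card S))) = top"
    by (metis ennreal_mult_eq_top_iff)
  then show ?thesis by (metis top_greatest)
next
  case False
  define n where "n = card S"
  have n: "n > 0" using S by (simp add: n_def card_gt_0_iff)
  define z where "z i = enn2real (y i)" for i
  define B where "B i = enn2real (A i)" for i
  have y: "y i = ennreal (z i)" if "i \<in> S" for i
    using False that by (simp add: z_def less_top)
  have B: "A i = ennreal (B i)" "B i > 0" if "i \<in> S" for i
    using A[OF that] by (auto simp: B_def less_top enn2real_positive_iff zero_less_iff_neq_zero)
  have z0: "z i \<ge> 0" for i by (simp add: z_def)
  have "(\<Prod>i\<in>S. ennreal_powr (y i) (1 / n)) = ennreal (\<Prod>i\<in>S. z i powr (1/n))"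
    using z0 by (simp add: y ennreal_powr_ennreal prod_ennreal)
  also have "(\<Prod>i\<in>S. z i powr (1/n)) = (\<Prod>i\<in>S. B i powr (1/n) * (z i / B i) powr (1/n))"
    using B z0 by (intro prod.cong) (simp_all add: less_imp_le less_imp_neq[symmetric] flip: powr_mult)
  also have "\<dots> = (\<Prod>i\<in>S. B i powr (1/n)) * (\<Prod>i\<in>S. z i / B i) powr (1/n)"
    using B z0 by (simp add: prod.distrib prod_powr_distrib)
  also have "\<dots> \<le> (\<Prod>i\<in>S. B i powr (1/n)) * (\<Sum>i\<in>S. z i / B i / n)"
    unfolding n_def using S B z0
    by (intro mult_left_mono arith_geom_mean prod_nonneg) (auto simp: less_imp_le)
  also have "ennreal \<dots> = (\<Prod>i\<in>S. ennreal_powr (A i) (1 / n)) * (\<Sum>i\<in>S. y i / (A i * of_nat n))"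
  proof -
    have "(\<Prod>i\<in>S. ennreal_powr (A i) (1 / n)) = ennreal (\<Prod>i\<in>S. B i powr (1/n))"
      using B by (simp add: ennreal_powr_ennreal prod_ennreal less_imp_le)
    moreover have "y i / (A i * of_nat n) = ennreal (z i / B i / n)" if "i \<in> S" for i
      using B[OF that] n z0 by (simp add: y[OF that] ennreal_of_nat_eq_real_of_nat divide_ennreal flip: ennreal_mult)
    ultimately show ?thesis
      using B z0 by (simp add: ennreal_mult' prod_nonneg sum_ennreal less_imp_le)
  qed
  finally show ?thesis by (simp add: n_def ennreal_leI)
qed

lemma nn_integral_prod_powr_le:
  fixes f :: "'i \<Rightarrow> 'a \<Rightarrow> ennreal"
  assumes S: "finite S" "S \<noteq> {}" and f [measurable]: "\<And>i. i \<in> S \<Longrightarrow> f i \<in> borel_measurable M"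
  shows "(\<integral>\<^sup>+x. (\<Prod>i\<in>S. ennreal_powr (f i x) (1 / card S)) \<partial>M)
    \<le> (\<Prod>i\<in>S. ennreal_powr (\<integral>\<^sup>+x. f i x \<partial>M) (1 / card S))"
proof -
  define A where "A i = (\<integral>\<^sup>+x. f i x \<partial>M)" for i
  have "(\<integral>\<^sup>+x. (\<Prod>i\<in>S. ennreal_powr (f i x) (1 / card S)) \<partial>M) \<le> (\<Prod>i\<in>S. ennreal_powr (A i) (1 / card S))"
  proof (cases "\<exists>i\<in>S. A i = 0")
    case True
    then obtain j where j: "j \<in> S" "A j = 0" by blast
    then have "AE x in M. f j x = 0"
      by (simp add: A_def nn_integral_0_iff_AE)
    then have "AE x in M. (\<Prod>i\<in>S. ennreal_powr (f i x) (1 / card S)) = 0"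
      using j S by (auto elim!: eventually_mono)
    then have "(\<integral>\<^sup>+x. (\<Prod>i\<in>S. ennreal_powr (f i x) (1 / card S)) \<partial>M) = 0"
      by (subst nn_integral_0_iff_AE) auto
    then show ?thesis by simp
  next
    \<comment> \<open>Vanishing integrals have to be excluded before infinite ones: since
      \<open>0 * top = 0\<close> in \<open>ennreal\<close>, a factor \<open>top\<close> makes the
      product \<open>top\<close> only if no factor is zero.\<close>
    case nz: False
    show ?thesis
    proof (cases "\<exists>i\<in>S. A i = top")
      case True
      then obtain j where j: "j \<in> S" "A j = top" by blast
      then have "(\<Prod>i\<in>S. ennreal_powr (A i) (1 / card S)) = top"
        using nz S by (auto simp: ennreal_prod_eq_top intro!: bexI[of _ j])
      then show ?thesis by simp
    next
      case False
      have "(\<integral>\<^sup>+x. (\<Prod>i\<in>S. ennreal_powr (f i x) (1 / card S)) \<partial>M)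
        \<le> (\<integral>\<^sup>+x. (\<Prod>i\<in>S. ennreal_powr (A i) (1 / card S)) * (\<Sum>i\<in>S. f i x / (A i * of_nat (card S))) \<partial>M)"
        by (intro nn_integral_mono prod_ennreal_powr_le) (use False nz S in auto)
      also have "\<dots> = (\<Prod>i\<in>S. ennreal_powr (A i) (1 / card S)) * (\<Sum>i\<in>S. A i / (A i * of_nat (card S)))"
        by (simp add: nn_integral_cmult nn_integral_sum nn_integral_divide A_def)
      also have "(\<Sum>i\<in>S. A i / (A i * of_nat (card S))) = (\<Sum>i\<in>S. ennreal (1 / card S))"
      proof (rule sum.cong)
        fix i assume i: "i \<in> S"
        obtain r where r: "A i = ennreal r" "r > 0"
          using False nz i by (cases "A i") (auto simp: le_less)
        have "card S > 0" using S by (simp add: card_gt_0_iff)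
        then show "A i / (A i * of_nat (card S)) = ennreal (1 / card S)"
          using r by (simp add: ennreal_of_nat_eq_real_of_nat divide_ennreal flip: ennreal_mult)
      qed simp
      also have "\<dots> = 1"
        using S by (simp add: ennreal_of_nat_eq_real_of_nat card_gt_0_iff flip: ennreal_mult)
      finally show ?thesis by simp
    qed
  qed
  then show ?thesis by (simp add: A_def)
qed

text \<open>The Loomis--Whitney inequality is the case \<open>J = I\<close>. Treating the coordinates outside \<open>J\<close> without
  integration lets an induction on \<open>J\<close> go through with the one-dimensional Hoelder inequality only.\<close>

lemma nn_integral_Loomis_Whitney:
  fixes g :: "'i \<Rightarrow> ('i \<Rightarrow> real) \<Rightarrow> ennreal"
  assumes I: "finite I" "card I = Suc m" "m > 0" and J: "J \<subseteq> I"
    and g: "\<And>i. i \<in> I \<Longrightarrow> g i \<in> borel_measurable (PiM J (\<lambda>_. lborel))"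
  shows "(\<integral>\<^sup>+x. (\<Prod>i\<in>J. ennreal_powr (\<integral>\<^sup>+t. g i (x(i:=t)) \<partial>lborel) (1/m))
             * (\<Prod>i\<in>I-J. ennreal_powr (g i x) (1/m)) \<partial>PiM J (\<lambda>_. lborel))
    \<le> (\<Prod>i\<in>I. ennreal_powr (\<integral>\<^sup>+x. g i x \<partial>PiM J (\<lambda>_. lborel)) (1/m))"
  using finite_subset[OF J I(1)] J g
proof (induction J arbitrary: g rule: finite_induct)
  case empty
  interpret product_sigma_finite "\<lambda>_::'i. lborel :: real measure" ..
  show ?case by (simp add: nn_integral_empty)
next
  case (insert j J)
  interpret product_sigma_finite "\<lambda>_::'i. lborel :: real measure" ..
  let ?P = "\<lambda>y. ennreal_powr y (1/m)"
  let ?M = "\<lambda>J. PiM J (\<lambda>_::'i. lborel :: real measure)"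
  have gm [measurable]: "g i \<in> borel_measurable (?M (insert j J))" if "i \<in> I" for i
    using insert that by auto
  have jI: "j \<in> I" using insert by auto
  have JI: "J \<subseteq> I" using insert by auto
  \<comment> \<open>The induction hypothesis is applied to the functions with the new coordinate
    \<open>j\<close> integrated out.\<close>
  define g' where "g' i x = (\<integral>\<^sup>+t. g i (x(j:=t)) \<partial>lborel)" for i x
  have upd [measurable]: "(\<lambda>p. (fst p)(j := snd p)) \<in> measurable (?M J \<Otimes>\<^sub>M lborel) (?M (insert j J))"
    by (rule measurable_fun_upd[where J = J]) auto
  have upd2: "(\<lambda>p. (fst p)(i := snd p)) \<in> measurable (?M (insert j J) \<Otimes>\<^sub>M lborel) (?M (insert j J))"
    if "i \<in> insert j J" for i
    by (rule measurable_fun_upd[where J = "insert j J"]) (use that in auto)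
  have Tm: "(\<lambda>x. \<integral>\<^sup>+t. g i (x(i:=t)) \<partial>lborel) \<in> borel_measurable (?M (insert j J))"
    if "i \<in> insert j J" for i
  proof -
    have "(\<lambda>p. g i ((fst p)(i := snd p))) \<in> borel_measurable (?M (insert j J) \<Otimes>\<^sub>M lborel)"
      using measurable_compose[OF upd2[OF that] gm[of i]] that jI JI by auto
    then show ?thesis
      by (intro lborel.borel_measurable_nn_integral) (simp add: split_beta')
  qed
  have g'm: "g' i \<in> borel_measurable (?M J)" if "i \<in> I" for i
  proof -
    have "(\<lambda>p. g i ((fst p)(j := snd p))) \<in> borel_measurable (?M J \<Otimes>\<^sub>M lborel)"
      using measurable_compose[OF upd gm[OF that]] by simp
    then show ?thesis unfolding g'_def
      by (intro lborel.borel_measurable_nn_integral) (simp add: split_beta')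
  qed
  let ?F = "\<lambda>x. (\<Prod>i\<in>insert j J. ?P (\<integral>\<^sup>+t. g i (x(i:=t)) \<partial>lborel)) * (\<Prod>i\<in>I-insert j J. ?P (g i x))"
  have Fm: "?F \<in> borel_measurable (?M (insert j J))"
    using Tm by (intro borel_measurable_times_ennreal borel_measurable_prod_ennreal measurable_ennreal_powr) auto
  have "(\<integral>\<^sup>+x. ?F x \<partial>?M (insert j J)) = (\<integral>\<^sup>+x. (\<integral>\<^sup>+t. ?F (x(j:=t)) \<partial>lborel) \<partial>?M J)"
    using insert Fm by (intro product_nn_integral_insert) auto
  also have "\<dots> \<le> (\<integral>\<^sup>+x. (\<Prod>i\<in>J. ?P (\<integral>\<^sup>+t. g' i (x(i:=t)) \<partial>lborel)) * (\<Prod>i\<in>I-J. ?P (g' i x)) \<partial>?M J)"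
  proof (rule nn_integral_mono)
    fix x assume x: "x \<in> space (?M J)"
    \<comment> \<open>For fixed \<open>x\<close> the factor with index \<open>j\<close> is already
      integrated over coordinate \<open>j\<close>, hence constant in \<open>t\<close>. The
      \<open>m\<close> remaining factors are collected in \<open>h\<close>, and their exponents
      \<open>1/m\<close> add up to one, as Hoelder's inequality in the variable \<open>t\<close>
      alone requires.\<close>
    define h where "h i t = (if i \<in> J then \<integral>\<^sup>+s. g i (x(j:=t, i:=s)) \<partial>lborel else g i (x(j:=t)))" for i t
    have xj: "(\<lambda>t. x(j:=t)) \<in> measurable lborel (?M (insert j J))"
      by (rule measurable_fun_upd[where J = J]) (use x in auto)
    have hm: "h i \<in> borel_measurable lborel" if "i \<in> I - {j}" for i
      using measurable_compose[OF xj Tm[of i]] measurable_compose[OF xj gm[of i]] that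
      by (cases "i \<in> J") (auto simp: h_def[abs_def])
    have eq: "?F (x(j:=t)) = ?P (g' j x) * (\<Prod>i\<in>I-{j}. ?P (h i t))" for t
    proof -
      have dec: "I - {j} = J \<union> (I - insert j J)" using insert by auto
      have "(\<Prod>i\<in>I-{j}. ?P (h i t)) = (\<Prod>i\<in>J. ?P (h i t)) * (\<Prod>i\<in>I-insert j J. ?P (h i t))"
        unfolding dec using insert.hyps I by (intro prod.union_disjoint) auto
      also have "(\<Prod>i\<in>I-insert j J. ?P (h i t)) = (\<Prod>i\<in>I-insert j J. ?P (g i (x(j:=t))))"
        by (intro prod.cong) (auto simp: h_def)
      also have "(\<Prod>i\<in>J. ?P (h i t)) = (\<Prod>i\<in>J. ?P (\<integral>\<^sup>+s. g i (x(j:=t, i:=s)) \<partial>lborel))"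
        by (intro prod.cong) (auto simp: h_def)
      finally have 1: "(\<Prod>i\<in>I-{j}. ?P (h i t)) = (\<Prod>i\<in>J. ?P (\<integral>\<^sup>+s. g i (x(j:=t, i:=s)) \<partial>lborel))
          * (\<Prod>i\<in>I-insert j J. ?P (g i (x(j:=t))))" .
      have "(\<Prod>i\<in>insert j J. ?P (\<integral>\<^sup>+s. g i (x(j:=t, i:=s)) \<partial>lborel))
          = ?P (g' j x) * (\<Prod>i\<in>J. ?P (\<integral>\<^sup>+s. g i (x(j:=t, i:=s)) \<partial>lborel))"
        using insert.hyps by (simp add: g'_def)
      then show ?thesis
        by (simp only: 1 mult.assoc)
    qed
    have c: "card (I - {j}) = m" using I jI by simp
    have "(\<integral>\<^sup>+t. ?F (x(j:=t)) \<partial>lborel) = ?P (g' j x) * (\<integral>\<^sup>+t. (\<Prod>i\<in>I-{j}. ?P (h i t)) \<partial>lborel)"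
      unfolding eq using hm
      by (intro nn_integral_cmult borel_measurable_prod_ennreal measurable_ennreal_powr) auto
    also have "\<dots> \<le> ?P (g' j x) * (\<Prod>i\<in>I-{j}. ?P (\<integral>\<^sup>+t. h i t \<partial>lborel))"
      using nn_integral_prod_powr_le[of "I - {j}" h lborel] hm c I
      by (intro mult_left_mono) (auto simp: card_gt_0_iff)
    also have "(\<Prod>i\<in>I-{j}. ?P (\<integral>\<^sup>+t. h i t \<partial>lborel))
       = (\<Prod>i\<in>J. ?P (\<integral>\<^sup>+t. g' i (x(i:=t)) \<partial>lborel)) * (\<Prod>i\<in>I-insert j J. ?P (g' i x))"
    proof -
      \<comment> \<open>Tonelli: a factor with index in \<open>J\<close> is already integrated along
        its own coordinate, and that integral is exchanged with the one over
        \<open>t\<close>.\<close>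
      have fub: "(\<integral>\<^sup>+t. h i t \<partial>lborel) = (\<integral>\<^sup>+t. g' i (x(i:=t)) \<partial>lborel)" if i: "i \<in> J" for i
      proof -
        have ij: "i \<noteq> j" using i insert by auto
        have "(\<lambda>p. x(j := snd p)) \<in> measurable (lborel \<Otimes>\<^sub>M lborel) (?M (insert j J))"
          using measurable_compose[OF measurable_snd xj] .
        then have "(\<lambda>p. (x(j := snd p))(i := fst p)) \<in> measurable (lborel \<Otimes>\<^sub>M lborel) (?M (insert j J))"
          by (rule measurable_fun_upd[where J = "insert j J", rotated]) (use i in auto)
        then have m: "(\<lambda>p. g i (x(j := snd p, i := fst p))) \<in> borel_measurable (lborel \<Otimes>\<^sub>M lborel)"
          by (rule measurable_compose) (use gm i JI in auto)
        have "(\<integral>\<^sup>+t. \<integral>\<^sup>+s. g i (x(j:=t, i:=s)) \<partial>lborel \<partial>lborel) = (\<integral>\<^sup>+s. \<integral>\<^sup>+t. g i (x(j:=t, i:=s)) \<partial>lborel \<partial>lborel)"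
          using m by (intro lborel_pair.Fubini') (simp add: split_beta')
        then show ?thesis
          using i ij by (simp add: h_def g'_def fun_upd_twist[of j i])
      qed
      have dec: "I - {j} = J \<union> (I - insert j J)" using insert by auto
      have "(\<Prod>i\<in>I-{j}. ?P (\<integral>\<^sup>+t. h i t \<partial>lborel)) = (\<Prod>i\<in>J. ?P (\<integral>\<^sup>+t. h i t \<partial>lborel)) * (\<Prod>i\<in>I-insert j J. ?P (\<integral>\<^sup>+t. h i t \<partial>lborel))"
        unfolding dec using insert.hyps I by (intro prod.union_disjoint) auto
      also have "(\<Prod>i\<in>I-insert j J. ?P (\<integral>\<^sup>+t. h i t \<partial>lborel)) = (\<Prod>i\<in>I-insert j J. ?P (g' i x))"
        by (intro prod.cong) (auto simp: h_def g'_def)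
      also have "(\<Prod>i\<in>J. ?P (\<integral>\<^sup>+t. h i t \<partial>lborel)) = (\<Prod>i\<in>J. ?P (\<integral>\<^sup>+t. g' i (x(i:=t)) \<partial>lborel))"
        by (intro prod.cong) (auto simp: fub)
      finally show ?thesis .
    qed
    \<comment> \<open>Index \<open>j\<close> lies outside \<open>J\<close>, so the constant factor
      joins the group of those not yet integrated along their own coordinate.\<close>
    also have "?P (g' j x) * ((\<Prod>i\<in>J. ?P (\<integral>\<^sup>+t. g' i (x(i:=t)) \<partial>lborel)) * (\<Prod>i\<in>I-insert j J. ?P (g' i x)))
      = (\<Prod>i\<in>J. ?P (\<integral>\<^sup>+t. g' i (x(i:=t)) \<partial>lborel)) * (\<Prod>i\<in>I-J. ?P (g' i x))"
    proof -
      have dec: "I - J = insert j (I - insert j J)" using insert jI by auto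
      have "(\<Prod>i\<in>I-J. ?P (g' i x)) = ?P (g' j x) * (\<Prod>i\<in>I-insert j J. ?P (g' i x))"
        unfolding dec using I by simp
      then show ?thesis by (simp only: mult_ac)
    qed
    finally show "(\<integral>\<^sup>+t. ?F (x(j:=t)) \<partial>lborel)
      \<le> (\<Prod>i\<in>J. ?P (\<integral>\<^sup>+t. g' i (x(i:=t)) \<partial>lborel)) * (\<Prod>i\<in>I-J. ?P (g' i x))" .
  qed
  also have "\<dots> \<le> (\<Prod>i\<in>I. ?P (\<integral>\<^sup>+x. g' i x \<partial>?M J))"
    using JI g'm by (rule insert.IH)
  also have "\<dots> = (\<Prod>i\<in>I. ?P (\<integral>\<^sup>+x. g i x \<partial>?M (insert j J)))"
    using insert.hyps gm by (intro prod.cong) (simp_all add: g'_def product_nn_integral_insert)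
  finally show ?case .
qed

section \<open>From integrals along lines to the Gagliardo--Nirenberg inequality\<close>

lemma abs_le_nn_integral_deriv:
  fixes F :: "real \<Rightarrow> real"
  assumes F: "\<And>t. (F has_real_derivative f t) (at t)" and f: "continuous_on UNIV f"
    and a: "a \<le> b" "F a = 0"
  shows "ennreal \<bar>F b\<bar> \<le> (\<integral>\<^sup>+t. ennreal \<bar>f t\<bar> \<partial>lborel)"
proof -
  have FTC: "has_bochner_integral lborel (\<lambda>x. indicator {a .. b} x *\<^sub>R f x) (F b - F a)"
    using a F f
    by (intro has_bochner_integral_FTC_Icc)
       (auto simp: has_real_derivative_iff_has_vector_derivative[symmetric] intro: DERIV_subset continuous_on_subset)
  then have "ennreal \<bar>F b\<bar> = ennreal (norm (\<integral>x. indicator {a .. b} x *\<^sub>R f x \<partial>lborel))"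
    using a by (simp add: has_bochner_integral_integral_eq)
  also have "\<dots> \<le> (\<integral>\<^sup>+x. norm (indicator {a .. b} x *\<^sub>R f x) \<partial>lborel)"
    using FTC by (intro integral_norm_bound_ennreal) (auto simp: has_bochner_integral_iff)
  also have "\<dots> \<le> (\<integral>\<^sup>+t. ennreal \<bar>f t\<bar> \<partial>lborel)"
    by (intro nn_integral_mono) (auto simp: indicator_def)
  finally show ?thesis .
qed

text \<open>At every point \<open>|w|\<close> is bounded by the integral of \<open>|w' b|\<close>
  along the line in direction \<open>b\<close>. Multiplying the \<open>m\<close>-th roots of these
  bounds over all directions gives \<open>|w|\<close> to the power \<open>DIM('a) / m\<close>, and
  Loomis--Whitney integrates the product.\<close>

lemma Gagliardo_Nirenberg_W11:
  fixes w :: "'a::euclidean_space \<Rightarrow> real"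
  assumes m: "DIM('a) = Suc m" "m > 0"
    and w': "\<And>x. (w has_derivative w' x) (at x)"
    and cont: "\<And>b. b \<in> Basis \<Longrightarrow> continuous_on UNIV (\<lambda>x. w' x b)"
    and K: "bounded K" "\<And>x. x \<notin> K \<Longrightarrow> w x = 0"
  shows "(\<integral>\<^sup>+x. ennreal (\<bar>w x\<bar> powr (DIM('a) / m)) \<partial>lborel)
    \<le> (\<Prod>b\<in>Basis. ennreal_powr (\<integral>\<^sup>+x. ennreal \<bar>w' x b\<bar> \<partial>lborel) (1/m))"
proof -
  interpret product_sigma_finite "\<lambda>_::'a. lborel :: real measure" ..
  let ?M = "PiM Basis (\<lambda>_::'a. lborel :: real measure)"
  \<comment> \<open>Loomis--Whitney is stated on a product of copies of the real line;
    \<open>E\<close> carries it to the Euclidean space, whose Lebesgue measure is the image measure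
    under \<open>E\<close>.\<close>
  define E where "E y = (\<Sum>b\<in>Basis. y b *\<^sub>R b)" for y :: "'a \<Rightarrow> real"
  have Em: "E \<in> measurable ?M borel" unfolding E_def by measurable
  have lb: "(lborel :: 'a measure) = distr ?M borel E"
    unfolding E_def by (rule lborel_eq)
  have E_inner: "E y \<bullet> b = y b" if "b \<in> Basis" for y b
    using that by (simp add: E_def)
  have E_upd: "E (y(b := t)) = E y + (t - y b) *\<^sub>R b" if "b \<in> Basis" for y b t
    using that by (subst euclidean_eq_iff) (auto simp: E_inner inner_add_left inner_Basis)
  obtain R where R: "R > 0" "\<And>x. x \<in> K \<Longrightarrow> norm x \<le> R"
    using K(1) by (auto simp: bounded_pos)
  define g where "g b y = ennreal \<bar>w' (E y) b\<bar>" for b y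
  have w'm: "(\<lambda>x. w' x b) \<in> borel_measurable borel" if "b \<in> Basis" for b
    using cont[OF that] by (rule borel_measurable_continuous_onI)
  have gm: "g b \<in> borel_measurable ?M" if "b \<in> Basis" for b
    unfolding g_def using measurable_compose[OF Em w'm[OF that]] by measurable
  have wc: "continuous_on UNIV w"
    by (simp add: continuous_on_eq_continuous_at has_derivative_continuous[OF w'])
  have wm: "w \<in> borel_measurable borel" using wc by (rule borel_measurable_continuous_onI)
  have line: "ennreal \<bar>w (E y)\<bar> \<le> (\<integral>\<^sup>+t. g b (y(b:=t)) \<partial>lborel)" if b: "b \<in> Basis" for y b
  proof (cases "w (E y) = 0")
    case False
    then have "norm (E y) \<le> R" using K(2) R(2) by metis
    then have yb: "\<bar>y b\<bar> \<le> R" using Basis_le_norm[OF b, of "E y"] by (simp add: E_inner b)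
    define F where "F t = w (E (y(b:=t)))" for t
    have "F (y b) = w (E y)" by (simp add: F_def)
    moreover have "ennreal \<bar>F (y b)\<bar> \<le> (\<integral>\<^sup>+t. ennreal \<bar>w' (E (y(b:=t))) b\<bar> \<partial>lborel)"
    \<comment> \<open>At parameter \<open>-R-1\<close> the coordinate in direction \<open>b\<close>
      has modulus \<open>R + 1\<close>, so the point lies outside \<open>K\<close> and
      \<open>w\<close> vanishes there.\<close>
    proof (rule abs_le_nn_integral_deriv[where F = F and a = "-R-1" and b = "y b"])
      show "(F has_real_derivative w' (E (y(b := t))) b) (at t)" for t
      proof -
        have "((\<lambda>t. E y + (t - y b) *\<^sub>R b) has_derivative (\<lambda>h. h *\<^sub>R b)) (at t)"
          by (rule derivative_eq_intros | simp)+
        then have "((\<lambda>t. w (E y + (t - y b) *\<^sub>R b)) has_derivative (\<lambda>h. w' (E y + (t - y b) *\<^sub>R b) (h *\<^sub>R b))) (at t)"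
          using w' by (rule has_derivative_compose)
        moreover have "linear (w' x)" for x using w' by (rule has_derivative_linear)
        ultimately show ?thesis
          unfolding F_def has_field_derivative_def by (simp add: E_upd b linear_cmul mult_commute_abs)
      qed
      have "continuous_on UNIV (\<lambda>t. w' (E y + (t - y b) *\<^sub>R b) b)"
        by (rule continuous_on_compose2[OF cont[OF b]]) (auto intro!: continuous_intros)
      then show "continuous_on UNIV (\<lambda>t. w' (E (y(b := t))) b)" by (simp add: E_upd b)
      show "- R - 1 \<le> y b" using yb by simp
      have "norm (E (y(b := - R - 1))) \<ge> R + 1"
        using Basis_le_norm[OF b, of "E (y(b := - R - 1))"] R by (simp add: E_inner b)
      then have "E (y(b := - R - 1)) \<notin> K" using R(2)[of "E (y(b := - R - 1))"] by force
      then show "F (- R - 1) = 0" using K by (simp add: F_def)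
    qed
    ultimately show ?thesis by (simp add: g_def)
  qed simp
  have wE: "(\<lambda>x. ennreal (\<bar>w x\<bar> powr (DIM('a) / m))) \<in> borel_measurable borel"
    using wm by measurable
  have gE: "(\<lambda>x. ennreal \<bar>w' x b\<bar>) \<in> borel_measurable borel" if "b \<in> Basis" for b
    using w'm[OF that] by measurable
  have nn: "(\<integral>\<^sup>+x. h x \<partial>lborel) = (\<integral>\<^sup>+y. h (E y) \<partial>?M)" if "h \<in> borel_measurable borel" for h :: "'a \<Rightarrow> ennreal"
    unfolding lb using Em that by (simp add: nn_integral_distr)
  have "(\<integral>\<^sup>+x. ennreal (\<bar>w x\<bar> powr (DIM('a) / m)) \<partial>lborel) = (\<integral>\<^sup>+y. ennreal (\<bar>w (E y)\<bar> powr (DIM('a) / m)) \<partial>?M)"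
    by (rule nn[OF wE])
  also have "\<dots> \<le> (\<integral>\<^sup>+y. (\<Prod>b\<in>Basis. ennreal_powr (\<integral>\<^sup>+t. g b (y(b:=t)) \<partial>lborel) (1/m))
             * (\<Prod>b\<in>Basis-Basis. ennreal_powr (g b y) (1/m)) \<partial>?M)"
  proof (rule nn_integral_mono)
    fix y
    have "ennreal (\<bar>w (E y)\<bar> powr (DIM('a) / m)) = ennreal (\<Prod>b\<in>(Basis::'a set). \<bar>w (E y)\<bar> powr (1 / m))"
      by (cases "w (E y) = 0") (auto simp: powr_power)
    also have "\<dots> = (\<Prod>b\<in>(Basis::'a set). ennreal_powr (ennreal \<bar>w (E y)\<bar>) (1/m))"
      by (simp add: ennreal_powr_ennreal prod_ennreal ennreal_power)
    also have "\<dots> \<le> (\<Prod>b\<in>Basis. ennreal_powr (\<integral>\<^sup>+t. g b (y(b:=t)) \<partial>lborel) (1/m))"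
      by (intro prod_mono_ennreal ennreal_powr_mono line) auto
    finally show "ennreal (\<bar>w (E y)\<bar> powr (DIM('a) / m)) \<le> (\<Prod>b\<in>Basis. ennreal_powr (\<integral>\<^sup>+t. g b (y(b:=t)) \<partial>lborel) (1/m))
             * (\<Prod>b\<in>Basis-Basis. ennreal_powr (g b y) (1/m))" by simp
  qed
  also have "\<dots> \<le> (\<Prod>b\<in>Basis. ennreal_powr (\<integral>\<^sup>+y. g b y \<partial>?M) (1/m))"
    using m gm by (intro nn_integral_Loomis_Whitney) auto
  also have "\<dots> = (\<Prod>b\<in>Basis. ennreal_powr (\<integral>\<^sup>+x. ennreal \<bar>w' x b\<bar> \<partial>lborel) (1/m))"
  proof (rule prod.cong)
    fix b :: 'a assume "b \<in> Basis"
    then show "ennreal_powr (\<integral>\<^sup>+y. g b y \<partial>?M) (1/m) = ennreal_powr (\<integral>\<^sup>+x. ennreal \<bar>w' x b\<bar> \<partial>lborel) (1/m)"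
      by (simp add: nn[OF gE] g_def)
  qed simp
  finally show ?thesis .
qed

section \<open>Hoelder and Cauchy--Schwarz inequalities for real integrals\<close>

lemma Holder_integral:
  fixes f g :: "'a \<Rightarrow> real"
  assumes pq: "p > 1" "q > 1" "1/p + 1/q = 1"
    and [measurable]: "f \<in> borel_measurable M" "g \<in> borel_measurable M"
    and f: "integrable M (\<lambda>x. \<bar>f x\<bar> powr p)" and g: "integrable M (\<lambda>x. \<bar>g x\<bar> powr q)"
  shows "integrable M (\<lambda>x. f x * g x)"
    and "(\<integral>x. \<bar>f x * g x\<bar> \<partial>M) \<le> (\<integral>x. \<bar>f x\<bar> powr p \<partial>M) powr (1/p) * (\<integral>x. \<bar>g x\<bar> powr q \<partial>M) powr (1/q)"
proof -
  show fg: "integrable M (\<lambda>x. f x * g x)"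
  proof (rule Bochner_Integration.integrable_bound)
    show "integrable M (\<lambda>x. \<bar>f x\<bar> powr p / p + \<bar>g x\<bar> powr q / q)"
      using f g by simp
    have "\<bar>f x * g x\<bar> \<le> \<bar>\<bar>f x\<bar> powr p / p + \<bar>g x\<bar> powr q / q\<bar>" for x
      using Youngs_inequality[OF pq, of "\<bar>f x\<bar>" "\<bar>g x\<bar>"] by (simp add: abs_mult)
    then show "AE x in M. norm (f x * g x) \<le> norm (\<bar>f x\<bar> powr p / p + \<bar>g x\<bar> powr q / q)"
      by simp
  qed measurable
  define A where "A = (\<integral>x. \<bar>f x\<bar> powr p \<partial>M)"
  define B where "B = (\<integral>x. \<bar>g x\<bar> powr q \<partial>M)"
  have nn: "A \<ge> 0" "B \<ge> 0" unfolding A_def B_def by auto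
  show "(\<integral>x. \<bar>f x * g x\<bar> \<partial>M) \<le> A powr (1/p) * B powr (1/q)"
  proof (cases "A = 0 \<or> B = 0")
    case True
    then have "(AE x in M. \<bar>f x\<bar> powr p = 0) \<or> (AE x in M. \<bar>g x\<bar> powr q = 0)"
      using f g by (auto simp: A_def B_def integral_nonneg_eq_0_iff_AE)
    then have "AE x in M. \<bar>f x * g x\<bar> = 0"
      by (auto elim!: eventually_mono)
    then have "(\<integral>x. \<bar>f x * g x\<bar> \<partial>M) = 0"
      using integral_cong_AE[of "\<lambda>x. \<bar>f x * g x\<bar>" M "\<lambda>x. 0"] by simp
    then show ?thesis by simp
  next
    case False
    then have pos: "A > 0" "B > 0" using nn by auto
    define a where "a = A powr (1/p)"
    define b where "b = B powr (1/q)"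
    have ab: "a > 0" "b > 0" using pos by (auto simp: a_def b_def)
    have apq: "a powr p = A" "b powr q = B" using pos pq by (auto simp: a_def b_def powr_powr)
    have pt: "\<bar>f x * g x\<bar> / (a * b) \<le> \<bar>f x\<bar> powr p / (A * p) + \<bar>g x\<bar> powr q / (B * q)" for x
      using Youngs_inequality[OF pq, of "\<bar>f x\<bar> / a" "\<bar>g x\<bar> / b"] ab
      by (simp add: abs_mult powr_divide apq)
    have "(\<integral>x. \<bar>f x * g x\<bar> / (a * b) \<partial>M) \<le> (\<integral>x. \<bar>f x\<bar> powr p / (A * p) + \<bar>g x\<bar> powr q / (B * q) \<partial>M)"
      using fg f g pt by (intro integral_mono) auto
    also have "\<dots> = A / (A * p) + B / (B * q)"
      using f g by (simp add: A_def B_def)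
    also have "\<dots> = 1" using pos pq by simp
    finally show ?thesis using ab by (simp add: a_def b_def field_simps)
  qed
qed

lemma Cauchy_Schwarz_integral:
  fixes f g :: "'a \<Rightarrow> real"
  assumes [measurable]: "f \<in> borel_measurable M" "g \<in> borel_measurable M"
    and f: "integrable M (\<lambda>x. (f x)\<^sup>2)" and g: "integrable M (\<lambda>x. (g x)\<^sup>2)"
  shows "integrable M (\<lambda>x. f x * g x)"
    and "(\<integral>x. \<bar>f x * g x\<bar> \<partial>M) \<le> sqrt (\<integral>x. (f x)\<^sup>2 \<partial>M) * sqrt (\<integral>x. (g x)\<^sup>2 \<partial>M)"
proof -
  have eq: "\<bar>y\<bar> powr 2 = y\<^sup>2" for y :: real by (simp add: powr_numeral)
  have i: "integrable M (\<lambda>x. \<bar>f x\<bar> powr 2)" "integrable M (\<lambda>x. \<bar>g x\<bar> powr 2)"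
    unfolding eq by (rule f g)+
  show "integrable M (\<lambda>x. f x * g x)"
    by (rule Holder_integral(1)[OF _ _ _ _ _ i]) auto
  have "(\<integral>x. \<bar>f x * g x\<bar> \<partial>M) \<le> (\<integral>x. \<bar>f x\<bar> powr 2 \<partial>M) powr (1/2) * (\<integral>x. \<bar>g x\<bar> powr 2 \<partial>M) powr (1/2)"
    by (rule Holder_integral(2)[OF _ _ _ _ _ i]) auto
  also have "\<dots> = sqrt (\<integral>x. (f x)\<^sup>2 \<partial>M) * sqrt (\<integral>x. (g x)\<^sup>2 \<partial>M)"
    unfolding eq by (simp add: powr_half_sqrt)
  finally show "(\<integral>x. \<bar>f x * g x\<bar> \<partial>M) \<le> sqrt (\<integral>x. (f x)\<^sup>2 \<partial>M) * sqrt (\<integral>x. (g x)\<^sup>2 \<partial>M)" .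
qed

section \<open>The Sobolev inequality for test functions\<close>

lemma has_derivative_pos_part_powr:
  fixes a :: real
  assumes a: "a > 1"
  shows "((\<lambda>t. (max t 0) powr a) has_real_derivative a * (max t 0) powr (a - 1)) (at t)"
proof -
  consider "t > 0" | "t < 0" | "t = 0" by linarith
  then show ?thesis
  proof cases
    case 1
    have "((\<lambda>t. t powr a) has_real_derivative a * t powr (a - 1)) (at t)"
      using has_real_derivative_powr[OF 1, of a] .
    then have "((\<lambda>t. max t 0 powr a) has_real_derivative a * t powr (a - 1)) (at t)"
      by (rule has_field_derivative_transform_within_open[where S = "{0<..}"]) (use 1 in auto)
    then show ?thesis using 1 by simp
  next
    case 2
    have "((\<lambda>t. 0) has_real_derivative 0) (at t)" by simp
    then have "((\<lambda>t. max t 0 powr a) has_real_derivative 0) (at t)"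
      by (rule has_field_derivative_transform_within_open[where S = "{..<0}"]) (use 2 in auto)
    then show ?thesis using 2 by simp
  next
    case 3
    have lim: "((\<lambda>h::real. \<bar>h\<bar> powr (a - 1)) \<longlongrightarrow> 0) (at 0)"
      using a by (intro tendsto_zero_powrI tendsto_const tendsto_rabs_zero tendsto_ident_at) auto
    have "((\<lambda>h. (max (0 + h) 0 powr a - max 0 0 powr a) / h) \<longlongrightarrow> 0) (at 0)"
    proof (rule Lim_null_comparison[OF always_eventually lim], rule allI)
      fix h :: real
      show "norm ((max (0 + h) 0 powr a - max 0 0 powr a) / h) \<le> \<bar>h\<bar> powr (a - 1)"
      proof (cases "h > 0")
        case True
        then show ?thesis using a by (simp add: powr_diff)
      next
        case False
        then have "max (0 + h) 0 = 0" by simp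
        then show ?thesis by simp
      qed
    qed
    then show ?thesis using 3 a by (simp add: DERIV_def)
  qed
qed

text \<open>Splitting into powers of the positive and the negative part yields a derivative without
  a sign function, whose continuity is immediate.\<close>

lemma has_derivative_abs_powr:
  fixes a :: real
  assumes a: "a > 1"
  shows "((\<lambda>t. \<bar>t\<bar> powr a) has_real_derivative a * ((max t 0) powr (a - 1) - (max (-t) 0) powr (a - 1))) (at t)"
proof -
  have eq: "(\<lambda>t::real. \<bar>t\<bar> powr a) = (\<lambda>t. (max t 0) powr a + (max (-t) 0) powr a)"
    by (rule ext) (auto simp: max_def abs_if)
  have "((\<lambda>t. (max (-t) 0) powr a) has_real_derivative (a * (max (-t) 0) powr (a - 1)) * (-1)) (at t)"
    by (rule DERIV_chain2[OF has_derivative_pos_part_powr[OF a]]) (auto intro!: derivative_eq_intros)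
  from DERIV_add[OF has_derivative_pos_part_powr[OF a] this]
  show ?thesis unfolding eq by (simp add: algebra_simps)
qed

text \<open>Integrals over \<open>U\<close> of functions vanishing outside \<open>U\<close> become
  integrals over the whole space, where the product structure of Lebesgue measure is
  available.\<close>

lemma integral_lebesgue_on_eq_lborel:
  fixes f :: "'a::euclidean_space \<Rightarrow> 'b::{banach, second_countable_topology}"
  assumes U: "open U" and f: "f \<in> borel_measurable borel" and 0: "\<And>x. x \<notin> U \<Longrightarrow> f x = 0"
  shows "integral\<^sup>L (lebesgue_on U) f = integral\<^sup>L lborel f"
proof -
  have eq: "(\<lambda>x. indicator U x *\<^sub>R f x) = f"
    using 0 by (auto simp: indicator_def)
  have "U \<inter> space lebesgue \<in> sets lebesgue" using U by simp
  then show ?thesis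
    using f by (simp add: integral_restrict_space eq integral_completion)
qed

lemma integrable_continuous_compact_support:
  fixes f :: "'a::euclidean_space \<Rightarrow> 'b::{banach, second_countable_topology}"
  assumes "continuous_on UNIV f" "compact K" "\<And>x. x \<notin> K \<Longrightarrow> f x = 0"
  shows "integrable lborel f"
proof -
  have "(\<lambda>x. indicator K x *\<^sub>R f x) = f"
    using assms(3) by (auto simp: indicator_def)
  then show ?thesis
    using borel_integrable_compact[OF assms(2) continuous_on_subset[OF assms(1)]] by simp
qed

text \<open>The condition on \<open>n\<close> is there for the base zero, where
  \<open>0 powr 0 = 0\<close> but \<open>0 ^ 0 = 1\<close>.\<close>

lemma powr_power_nonzero_exponent: "n \<noteq> 0 \<Longrightarrow> (x powr u) ^ n = x powr (real n * u)" for x :: real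
  by (cases "x = 0") (simp_all add: powr_power)

text \<open>The exponent \<open>c\<close> satisfies both \<open>c * d / (d - 1) = s\<close> and
  \<open>2 * (c - 1) = s\<close>. Gagliardo--Nirenberg for \<open>|\<phi>| powr c\<close>, followed
  by Cauchy--Schwarz on its gradient, thus has the integral \<open>S\<close> of
  \<open>|\<phi>| powr s\<close> on both sides:
  \<open>S powr ((d-1)/d) \<le> c * sqrt S * sqrt g\<close>. Dividing by \<open>sqrt S\<close>
  leaves the power \<open>(d-1)/d - 1/2 = 1/s\<close>.\<close>

lemma Sobolev_test_fun:
  fixes \<phi> :: "real^'n \<Rightarrow> real"
  assumes d: "d = real CARD('n)" "CARD('n) \<ge> 3" and s: "s = 2 * d / (d - 2)" and c: "c = 2 * (d - 1) / (d - 2)"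
    and U: "open U" and \<phi>: "test_fun U \<phi>"
  shows "(\<integral>x. \<bar>\<phi> x\<bar> powr s \<partial>lebesgue_on U) powr (1/s) \<le> c * sqrt (\<integral>x. (norm (grad \<phi> x))\<^sup>2 \<partial>lebesgue_on U)"
proof -
  have d3: "d \<ge> 3" using d by simp
  have c1: "c > 1" "c > 0" using d3 by (simp_all add: c field_simps)
  have s2: "s > 2" using d3 by (simp add: s field_simps)
  have sc: "2 * (c - 1) = s" using d3 by (simp add: s c field_simps)
  have sc': "c * (d / (d - 1)) = s"
    using d3 unfolding s c times_divide_times_eq by (subst frac_eq_eq) auto
  define m where "m = CARD('n) - 1"
  have m: "DIM(real^'n) = Suc m" "m > 0" "real m = d - 1" using d by (auto simp: m_def)
  have sm: "smooth \<phi>" and K: "compact (tsupp \<phi>)" "tsupp \<phi> \<subseteq> U" using \<phi> by (auto simp: test_fun_def)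
  have c\<phi>: "continuous_on UNIV \<phi>" by (rule continuous_on_smooth[OF sm])
  have cg: "continuous_on UNIV (grad \<phi>)" by (rule continuous_on_grad[OF sm])
  \<comment> \<open>The derivative of \<open>|t| powr c\<close>; its leading factor \<open>c\<close>
    is the source of the Sobolev constant.\<close>
  define k where "k t = c * ((max t 0) powr (c - 1) - (max (-t) 0) powr (c - 1))" for t
  have abs_k: "\<bar>k t\<bar> = c * \<bar>t\<bar> powr (c - 1)" for t
    using c1 by (cases "t \<ge> 0") (auto simp: k_def abs_mult max_def)
  have ck: "continuous_on UNIV k" unfolding k_def using c1
    by (intro continuous_on_mult continuous_on_diff continuous_on_powr' continuous_on_const continuous_on_max continuous_on_id continuous_on_minus) auto
  have ck\<phi>: "continuous_on UNIV (\<lambda>x. k (\<phi> x))"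
    by (rule continuous_on_compose2[OF ck c\<phi>]) simp
  define y where "y = (\<integral>x. \<bar>k (\<phi> x)\<bar> * norm (grad \<phi> x) \<partial>lborel)"
  define S where "S = (\<integral>x. \<bar>\<phi> x\<bar> powr s \<partial>lborel)"
  define g where "g = (\<integral>x. (norm (grad \<phi> x))\<^sup>2 \<partial>lborel)"
  have nn: "y \<ge> 0" "S \<ge> 0" "g \<ge> 0" by (auto simp: y_def S_def g_def)
  have cS: "continuous_on UNIV (\<lambda>x. \<bar>\<phi> x\<bar> powr s)"
    using c\<phi> s2 by (intro continuous_on_powr' continuous_on_const continuous_on_rabs) auto
  have iS: "integrable lborel (\<lambda>x. \<bar>\<phi> x\<bar> powr s)"
    by (rule integrable_continuous_compact_support[OF cS K(1)]) (simp add: tsupp_eq_0)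
  have ig: "integrable lborel (\<lambda>x. (norm (grad \<phi> x))\<^sup>2)"
    using cg by (intro integrable_continuous_compact_support[OF _ K(1)] continuous_intros) (simp_all add: grad_eq_0)
  have iy: "integrable lborel (\<lambda>x. \<bar>k (\<phi> x)\<bar> * norm (grad \<phi> x))"
    using cg ck\<phi> by (intro integrable_continuous_compact_support[OF _ K(1)] continuous_intros) (simp_all add: grad_eq_0)
  have "ennreal S = (\<integral>\<^sup>+x. ennreal (\<bar>\<phi> x\<bar> powr s) \<partial>lborel)"
    unfolding S_def using iS by (simp add: nn_integral_eq_integral)
  also have "\<dots> = (\<integral>\<^sup>+x. ennreal (\<bar>\<bar>\<phi> x\<bar> powr c\<bar> powr (DIM(real^'n) / m)) \<partial>lborel)"
    using sc' m d by (simp add: powr_powr)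
  also have "\<dots> \<le> (\<Prod>b\<in>Basis. ennreal_powr (\<integral>\<^sup>+x. ennreal \<bar>k (\<phi> x) * (grad \<phi> x \<bullet> b)\<bar> \<partial>lborel) (1/m))"
  proof (rule Gagliardo_Nirenberg_W11[OF m(1,2)])
    show "((\<lambda>x. \<bar>\<phi> x\<bar> powr c) has_derivative (\<lambda>h. k (\<phi> x) * (grad \<phi> x \<bullet> h))) (at x)" for x
      using has_derivative_compose[OF smooth_has_derivative[OF sm]
          has_derivative_abs_powr[OF c1(1), unfolded has_field_derivative_def]]
      by (simp add: k_def)
    show "continuous_on UNIV (\<lambda>x. k (\<phi> x) * (grad \<phi> x \<bullet> b))" for b
      using ck\<phi> cg by (intro continuous_intros)
    show "bounded (tsupp \<phi>)" using K(1) by (rule compact_imp_bounded)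
    show "\<bar>\<phi> x\<bar> powr c = 0" if "x \<notin> tsupp \<phi>" for x
      using tsupp_eq_0[OF that] by simp
  qed
  \<comment> \<open>Each directional derivative is bounded by the full gradient, so that all
    \<open>CARD('n)\<close> factors equal \<open>y powr (1/m)\<close>.\<close>
  also have "\<dots> \<le> (\<Prod>b\<in>(Basis::(real^'n) set). ennreal_powr (ennreal y) (1/m))"
  proof (intro prod_mono_ennreal ennreal_powr_mono)
    fix b :: "real^'n" assume b: "b \<in> Basis"
    have "(\<integral>\<^sup>+x. ennreal \<bar>k (\<phi> x) * (grad \<phi> x \<bullet> b)\<bar> \<partial>lborel) \<le> (\<integral>\<^sup>+x. ennreal (\<bar>k (\<phi> x)\<bar> * norm (grad \<phi> x)) \<partial>lborel)"
      using Basis_le_norm[OF b] by (intro nn_integral_mono ennreal_leI) (auto simp: abs_mult intro!: mult_left_mono)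
    also have "\<dots> = ennreal y"
      unfolding y_def using iy by (simp add: nn_integral_eq_integral)
    finally show "(\<integral>\<^sup>+x. ennreal \<bar>k (\<phi> x) * (grad \<phi> x \<bullet> b)\<bar> \<partial>lborel) \<le> ennreal y" .
  qed simp
  also have "\<dots> = ennreal ((y powr (1/m)) ^ CARD('n))"
    using nn by (simp add: ennreal_powr_ennreal ennreal_power)
  also have "(y powr (1/m)) ^ CARD('n) = y powr (d / (d - 1))"
    using m d by (simp add: powr_power_nonzero_exponent)
  finally have S_le: "S \<le> y powr (d / (d - 1))"
    using nn by simp
  have "y = c * (\<integral>x. \<bar>\<bar>\<phi> x\<bar> powr (c - 1) * norm (grad \<phi> x)\<bar> \<partial>lborel)"
    unfolding y_def abs_k by (simp add: mult.assoc abs_mult)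
  also have "\<dots> \<le> c * (sqrt (\<integral>x. (\<bar>\<phi> x\<bar> powr (c - 1))\<^sup>2 \<partial>lborel) * sqrt (\<integral>x. (norm (grad \<phi> x))\<^sup>2 \<partial>lborel))"
  proof (intro mult_left_mono Cauchy_Schwarz_integral)
    have [measurable]: "\<phi> \<in> borel_measurable borel" "grad \<phi> \<in> borel_measurable borel"
      using c\<phi> cg by (auto intro: borel_measurable_continuous_onI)
    show "(\<lambda>x. \<bar>\<phi> x\<bar> powr (c - 1)) \<in> borel_measurable lborel" "(\<lambda>x. norm (grad \<phi> x)) \<in> borel_measurable lborel"
      by measurable
    show "integrable lborel (\<lambda>x. (\<bar>\<phi> x\<bar> powr (c - 1))\<^sup>2)"
      using iS sc by (simp add: powr_power_nonzero_exponent)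
  qed (use ig c1 in auto)
  also have "\<dots> = c * (sqrt S * sqrt g)"
    using sc by (simp add: S_def g_def powr_power_nonzero_exponent)
  finally have y_le: "y \<le> c * (sqrt S * sqrt g)" .
  have "S powr (1/s) \<le> c * sqrt g"
  proof (cases "S = 0")
    case False
    then have S0: "S > 0" using nn by simp
    have "S powr ((d-1)/d) \<le> (y powr (d / (d - 1))) powr ((d-1)/d)"
      using S_le S0 d3 by (intro powr_mono2) auto
    also have "\<dots> = y" using nn d3 by (simp add: powr_powr)
    also have "\<dots> \<le> S powr (1/2) * (c * sqrt g)" using y_le nn by (simp add: powr_half_sqrt mult_ac)
    finally have "S powr ((d-1)/d) / S powr (1/2) \<le> c * sqrt g"
      using S0 by (simp add: field_simps)
    moreover have "(d-1)/d - 1/2 = 1/s" using d3 unfolding s by (simp add: field_simps)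
    then have "S powr ((d-1)/d) / S powr (1/2) = S powr (1/s)"
      by (metis powr_diff)
    ultimately show ?thesis by simp
  qed (use c1 nn in auto)
  moreover have "S = (\<integral>x. \<bar>\<phi> x\<bar> powr s \<partial>lebesgue_on U)" unfolding S_def
    using \<phi> U cS by (intro integral_lebesgue_on_eq_lborel[symmetric] borel_measurable_continuous_onI) (auto dest: test_fun_eq_0)
  moreover have "g = (\<integral>x. (norm (grad \<phi> x))\<^sup>2 \<partial>lebesgue_on U)" unfolding g_def
    using cg K U grad_eq_0 by (intro integral_lebesgue_on_eq_lborel[symmetric] borel_measurable_continuous_onI continuous_intros) auto
  ultimately show ?thesis by simp
qed

section \<open>Dominated approximation by test functions\<close>

text \<open>Composition with a merely \<open>C\<^sup>1\<close> function leaves the class of test functions; a Weierstrass polynomial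
  for the derivative on the range of \<open>\<phi>\<close> repairs this.\<close>

lemma test_fun_C1_compose_approx:
  assumes \<phi>: "test_fun U \<phi>" and \<Psi>: "\<And>t. (\<Psi> has_real_derivative \<psi> t) (at t)" "\<Psi> 0 = 0"
    and \<psi>: "continuous_on UNIV \<psi>" and e: "e > 0"
  obtains \<eta> where "test_fun U \<eta>" "\<And>x. \<bar>\<eta> x - \<Psi> (\<phi> x)\<bar> \<le> e" "\<And>x. \<bar>\<eta> x - \<Psi> (\<phi> x)\<bar> \<le> e * \<bar>\<phi> x\<bar>"
    "\<And>x. norm (grad \<eta> x - \<psi> (\<phi> x) *\<^sub>R grad \<phi> x) \<le> e * norm (grad \<phi> x)"
proof -
  obtain M where M: "M > 0" "\<And>x. \<bar>\<phi> x\<bar> \<le> M" using test_fun_bounded[OF \<phi>] by metis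
  \<comment> \<open>One tolerance serves two purposes: \<open>\<delta> \<le> e\<close> gives the
    errors relative to \<open>\<phi>\<close> and its gradient, and
    \<open>\<delta> * M \<le> e\<close> the absolute one.\<close>
  define \<delta> where "\<delta> = min e (e / M)"
  have \<delta>: "\<delta> > 0" "\<delta> \<le> e" "\<delta> * M \<le> e"
    using e M by (auto simp: \<delta>_def min_def field_simps)
  obtain g where g: "real_polynomial_function g" "\<And>t. t \<in> {-M..M} \<Longrightarrow> \<bar>\<psi> t - g t\<bar> < \<delta>"
    using Stone_Weierstrass_real_polynomial_function[of "{-M..M}" \<psi> \<delta>] \<psi> \<delta>
    by (metis compact_Icc continuous_on_subset subset_UNIV)
  obtain a n where an: "g = (\<lambda>x. \<Sum>i\<le>n. a i * x^i)"
    using g(1) real_polynomial_function_iff_sum by blast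
  \<comment> \<open>The primitive vanishing at 0 of the Weierstrass polynomial. The mean value
    estimate from 0 turns the error of the derivative into an error proportional to
    \<open>|t|\<close>.\<close>
  define P where "P t = (\<Sum>i\<le>n. (a i / Suc i) * t ^ Suc i)" for t
  have P: "(P has_real_derivative g t) (at t)" for t
  proof -
    have "((\<lambda>t. (a i / Suc i) * t ^ Suc i) has_real_derivative a i * t ^ i) (at t)" for i
      by (rule derivative_eq_intros refl | simp)+
    then show ?thesis unfolding P_def an by (intro DERIV_sum)
  qed
  have P0: "P 0 = 0" by (simp add: P_def)
  have err: "\<bar>P t - \<Psi> t\<bar> \<le> \<delta> * \<bar>t\<bar>" if "t \<in> {-M..M}" for t
  proof -
    have "norm ((P t - \<Psi> t) - (P 0 - \<Psi> 0)) \<le> \<delta> * norm (t - 0)"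
    proof (rule field_differentiable_bound[where S = "{-M..M}" and f' = "\<lambda>t. g t - \<psi> t"])
      show "((\<lambda>t. P t - \<Psi> t) has_real_derivative g z - \<psi> z) (at z within {-M..M})" for z
        by (intro DERIV_diff DERIV_subset[OF P] DERIV_subset[OF \<Psi>(1)]) auto
      show "norm (g z - \<psi> z) \<le> \<delta>" if "z \<in> {-M..M}" for z
        using g(2)[OF that] by (simp add: abs_minus_commute)
    qed (use that M in auto)
    then show ?thesis by (simp add: P0 \<Psi>)
  qed
  have \<phi>M: "\<phi> x \<in> {-M..M}" for x using M(2)[of x] by auto
  show ?thesis
  proof
    show "test_fun U (\<lambda>x. P (\<phi> x))"
      unfolding P_def by (rule test_fun_polynomial[OF \<phi>])
    show le: "\<bar>P (\<phi> x) - \<Psi> (\<phi> x)\<bar> \<le> e * \<bar>\<phi> x\<bar>" for x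
      using err[OF \<phi>M[of x]] \<delta> by (meson abs_ge_zero mult_right_mono order_trans)
    show "\<bar>P (\<phi> x) - \<Psi> (\<phi> x)\<bar> \<le> e" for x
    proof -
      have "\<delta> * \<bar>\<phi> x\<bar> \<le> \<delta> * M" using M \<delta> by (intro mult_left_mono) auto
      then show ?thesis using err[OF \<phi>M[of x]] \<delta> by linarith
    qed
    show "norm (grad (\<lambda>x. P (\<phi> x)) x - \<psi> (\<phi> x) *\<^sub>R grad \<phi> x) \<le> e * norm (grad \<phi> x)" for x
    proof -
      have "grad (\<lambda>x. P (\<phi> x)) x - \<psi> (\<phi> x) *\<^sub>R grad \<phi> x = (g (\<phi> x) - \<psi> (\<phi> x)) *\<^sub>R grad \<phi> x"
        using grad_compose[OF test_fun_smooth[OF \<phi>] P] by (simp add: scaleR_diff_left)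
      moreover have "\<bar>g (\<phi> x) - \<psi> (\<phi> x)\<bar> \<le> e"
        using g(2)[OF \<phi>M[of x]] \<delta> by linarith
      ultimately show ?thesis by (simp add: mult_right_mono)
    qed
  qed
qed

text \<open>The working form of \<open>H0\<close>: convergence in norm is replaced by convergence
  almost everywhere with a single square integrable majorant for values and gradients. On bounded
  open \<open>U\<close> the two are interchangeable, by \<open>dominated_approx_imp_H0\<close> and
  \<open>H0_imp_dominated_approx\<close>.\<close>

definition dominated_approx ::
    "(real^'n) set \<Rightarrow> (nat \<Rightarrow> real^'n \<Rightarrow> real) \<Rightarrow> (real^'n \<Rightarrow> real) \<Rightarrow> (real^'n \<Rightarrow> real^'n) \<Rightarrow> (real^'n \<Rightarrow> real) \<Rightarrow> bool" where
  "dominated_approx U \<phi> u G D \<longleftrightarrow> (\<forall>k. test_fun U (\<phi> k)) \<and>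
     u \<in> borel_measurable (lebesgue_on U) \<and> G \<in> borel_measurable (lebesgue_on U) \<and>
     D \<in> borel_measurable (lebesgue_on U) \<and> integrable (lebesgue_on U) (\<lambda>x. (D x)\<^sup>2) \<and>
     (AE x in lebesgue_on U. (\<lambda>k. \<phi> k x) \<longlonglongrightarrow> u x \<and> (\<lambda>k. grad (\<phi> k) x) \<longlonglongrightarrow> G x \<and>
        (\<forall>k. \<bar>\<phi> k x\<bar> \<le> D x \<and> norm (grad (\<phi> k) x) \<le> D x))"

lemma borel_measurable_test_fun:
  assumes "test_fun U \<phi>"
  shows "\<phi> \<in> borel_measurable (lebesgue_on V)" "grad \<phi> \<in> borel_measurable (lebesgue_on V)"
proof -
  have "\<phi> \<in> borel_measurable borel" "grad \<phi> \<in> borel_measurable borel"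
    using assms by (auto simp: test_fun_def intro!: borel_measurable_continuous_onI continuous_on_smooth continuous_on_grad)
  then show "\<phi> \<in> borel_measurable (lebesgue_on V)" "grad \<phi> \<in> borel_measurable (lebesgue_on V)"
    by (auto intro!: measurable_restrict_space1 measurable_completion)
qed

lemma dominated_approxD:
  assumes "dominated_approx U \<phi> u G D"
  shows "test_fun U (\<phi> k)" "u \<in> borel_measurable (lebesgue_on U)" "G \<in> borel_measurable (lebesgue_on U)"
    "D \<in> borel_measurable (lebesgue_on U)" "integrable (lebesgue_on U) (\<lambda>x. (D x)\<^sup>2)"
    "AE x in lebesgue_on U. (\<lambda>k. \<phi> k x) \<longlonglongrightarrow> u x"
    "AE x in lebesgue_on U. (\<lambda>k. grad (\<phi> k) x) \<longlonglongrightarrow> G x"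
    "AE x in lebesgue_on U. \<bar>\<phi> k x\<bar> \<le> D x" "AE x in lebesgue_on U. norm (grad (\<phi> k) x) \<le> D x"
    "AE x in lebesgue_on U. \<bar>u x\<bar> \<le> D x" "AE x in lebesgue_on U. norm (G x) \<le> D x"
proof -
  have a: "AE x in lebesgue_on U. (\<lambda>k. \<phi> k x) \<longlonglongrightarrow> u x \<and> (\<lambda>k. grad (\<phi> k) x) \<longlonglongrightarrow> G x \<and>
        (\<forall>k. \<bar>\<phi> k x\<bar> \<le> D x \<and> norm (grad (\<phi> k) x) \<le> D x)"
    using assms by (simp add: dominated_approx_def)
  show "test_fun U (\<phi> k)" "u \<in> borel_measurable (lebesgue_on U)" "G \<in> borel_measurable (lebesgue_on U)"
    "D \<in> borel_measurable (lebesgue_on U)" "integrable (lebesgue_on U) (\<lambda>x. (D x)\<^sup>2)"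
    using assms by (auto simp: dominated_approx_def)
  show "AE x in lebesgue_on U. (\<lambda>k. \<phi> k x) \<longlonglongrightarrow> u x" using a by eventually_elim simp
  show "AE x in lebesgue_on U. (\<lambda>k. grad (\<phi> k) x) \<longlonglongrightarrow> G x" using a by eventually_elim simp
  show "AE x in lebesgue_on U. \<bar>\<phi> k x\<bar> \<le> D x" using a by eventually_elim simp
  show "AE x in lebesgue_on U. norm (grad (\<phi> k) x) \<le> D x" using a by eventually_elim simp
  show "AE x in lebesgue_on U. \<bar>u x\<bar> \<le> D x" using a
    by eventually_elim (rule LIMSEQ_le_const2[OF tendsto_rabs], auto)
  show "AE x in lebesgue_on U. norm (G x) \<le> D x" using a
    by eventually_elim (rule LIMSEQ_le_const2[OF tendsto_norm], auto)
qed

lemma dominated_approx_integral_grad: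
  assumes A: "dominated_approx U \<phi> u G D"
  shows "integrable (lebesgue_on U) (\<lambda>x. (norm (G x))\<^sup>2)"
    and "(\<lambda>k. \<integral>x. (norm (grad (\<phi> k) x))\<^sup>2 \<partial>lebesgue_on U) \<longlonglongrightarrow> (\<integral>x. (norm (G x))\<^sup>2 \<partial>lebesgue_on U)"
proof -
  note [measurable] = dominated_approxD(2-4)[OF A] borel_measurable_test_fun[OF dominated_approxD(1)[OF A]]
  have 1: "AE x in lebesgue_on U. (\<lambda>k. (norm (grad (\<phi> k) x))\<^sup>2) \<longlonglongrightarrow> (norm (G x))\<^sup>2"
    using dominated_approxD(7)[OF A] by eventually_elim (intro tendsto_intros)
  have 2: "AE x in lebesgue_on U. norm ((norm (grad (\<phi> k) x))\<^sup>2) \<le> (D x)\<^sup>2" for k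
    using dominated_approxD(9)[OF A, of k] by eventually_elim (auto intro: power_mono)
  show "integrable (lebesgue_on U) (\<lambda>x. (norm (G x))\<^sup>2)"
    by (rule integrable_dominated_convergence[OF _ _ dominated_approxD(5)[OF A] 1 2]) measurable
  show "(\<lambda>k. \<integral>x. (norm (grad (\<phi> k) x))\<^sup>2 \<partial>lebesgue_on U) \<longlonglongrightarrow> (\<integral>x. (norm (G x))\<^sup>2 \<partial>lebesgue_on U)"
    by (rule integral_dominated_convergence[OF _ _ dominated_approxD(5)[OF A] 1 2]) measurable
qed

lemma dominated_approx_imp_H0:
  assumes A: "dominated_approx U \<phi> u G D"
  shows "H0 U u G"
proof -
  note [measurable] = dominated_approxD(2-4)[OF A] borel_measurable_test_fun[OF dominated_approxD(1)[OF A]]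
  have "integrable (lebesgue_on U) (\<lambda>x. (u x)\<^sup>2)"
  proof (rule Bochner_Integration.integrable_bound[OF dominated_approxD(5)[OF A]])
    show "AE x in lebesgue_on U. norm ((u x)\<^sup>2) \<le> norm ((D x)\<^sup>2)"
      using dominated_approxD(10)[OF A] by eventually_elim (auto simp: abs_le_square_iff[symmetric])
  qed measurable
  moreover have "(\<lambda>k. \<integral>x. (\<phi> k x - u x)\<^sup>2 + (norm (grad (\<phi> k) x - G x))\<^sup>2 \<partial>lebesgue_on U)
      \<longlonglongrightarrow> (\<integral>x. 0 \<partial>lebesgue_on U)"
  \<comment> \<open>Both differences are at most \<open>2 * D x\<close>, and
    \<open>8 = 2 * 2^2\<close>.\<close>
  proof (rule integral_dominated_convergence[where w = "\<lambda>x. 8 * (D x)\<^sup>2"])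
    show "integrable (lebesgue_on U) (\<lambda>x. 8 * (D x)\<^sup>2)" using dominated_approxD(5)[OF A] by simp
    show "AE x in lebesgue_on U. (\<lambda>k. (\<phi> k x - u x)\<^sup>2 + (norm (grad (\<phi> k) x - G x))\<^sup>2) \<longlonglongrightarrow> 0"
      using dominated_approxD(6,7)[OF A]
    proof eventually_elim
      case (elim x)
      have "(\<lambda>k. (\<phi> k x - u x)\<^sup>2 + (norm (grad (\<phi> k) x - G x))\<^sup>2) \<longlonglongrightarrow> (u x - u x)\<^sup>2 + (norm (G x - G x))\<^sup>2"
        using elim by (intro tendsto_intros)
      then show ?case by simp
    qed
    show "AE x in lebesgue_on U. norm ((\<phi> k x - u x)\<^sup>2 + (norm (grad (\<phi> k) x - G x))\<^sup>2) \<le> 8 * (D x)\<^sup>2" for k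
      using dominated_approxD(8,9)[OF A, of k] dominated_approxD(10,11)[OF A]
    proof eventually_elim
      case (elim x)
      have "\<bar>\<phi> k x - u x\<bar> \<le> 2 * D x" using elim by linarith
      then have 1: "(\<phi> k x - u x)\<^sup>2 \<le> (2 * D x)\<^sup>2" using power_mono[of "\<bar>\<phi> k x - u x\<bar>" "2 * D x" 2] by simp
      have "norm (grad (\<phi> k) x - G x) \<le> 2 * D x"
        using elim norm_triangle_ineq4[of "grad (\<phi> k) x" "G x"] by linarith
      then have 2: "(norm (grad (\<phi> k) x - G x))\<^sup>2 \<le> (2 * D x)\<^sup>2" by (intro power_mono) auto
      show ?case using 1 2 by (simp add: power_mult_distrib)
    qed
  qed measurable
  ultimately show ?thesis
    unfolding H0_def using A dominated_approx_integral_grad(1)[OF A]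
    by (auto simp: dominated_approx_def intro!: exI[of _ \<phi>])
qed

lemma integrable_test_fun_power2:
  assumes U: "open U" "bounded U" and \<phi>: "test_fun U \<phi>"
  shows "integrable (lebesgue_on U) (\<lambda>x. (\<phi> x)\<^sup>2)" "integrable (lebesgue_on U) (\<lambda>x. (norm (grad \<phi> x))\<^sup>2)"
proof -
  note [measurable] = borel_measurable_test_fun[OF \<phi>]
  interpret finite_measure "lebesgue_on U"
    using U by (intro finite_measure_lebesgue_on) (simp add: bounded_set_imp_lmeasurable)
  obtain M where M: "M > 0" "\<And>x. \<bar>\<phi> x\<bar> \<le> M" "\<And>x. norm (grad \<phi> x) \<le> M" using test_fun_bounded[OF \<phi>] by metis
  have "(\<phi> x)\<^sup>2 \<le> M\<^sup>2" "(norm (grad \<phi> x))\<^sup>2 \<le> M\<^sup>2" for x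
    using M by (auto intro: power_mono simp: abs_le_square_iff[symmetric])
  then show "integrable (lebesgue_on U) (\<lambda>x. (\<phi> x)\<^sup>2)" "integrable (lebesgue_on U) (\<lambda>x. (norm (grad \<phi> x))\<^sup>2)"
    by (auto intro!: integrable_const_bound[where B = "M\<^sup>2"])
qed

text \<open>A sequence converging in W^{1,2} is Cauchy, so a dominated subsequence converges almost
  everywhere to some \<open>g\<close>. Dominated convergence then shows that the distance from
  \<open>g\<close> to \<open>(u, G)\<close> is the limit of the given distances, which is
  zero.\<close>

lemma H0_imp_dominated_approx:
  assumes U: "open U" "bounded U" and H: "H0 U u G"
  obtains \<phi> D where "dominated_approx U \<phi> u G D"
proof -
  let ?M = "lebesgue_on U"
  have [measurable]: "u \<in> borel_measurable ?M" "G \<in> borel_measurable ?M"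
    and iu: "integrable ?M (\<lambda>x. (u x)\<^sup>2)" and iG: "integrable ?M (\<lambda>x. (norm (G x))\<^sup>2)"
    using H by (auto simp: H0_def)
  obtain \<phi> where \<phi>: "\<And>k. test_fun U (\<phi> k)"
    and lim: "(\<lambda>k. \<integral>x. (\<phi> k x - u x)\<^sup>2 + (norm (grad (\<phi> k) x - G x))\<^sup>2 \<partial>?M) \<longlonglongrightarrow> 0"
    using H by (auto simp: H0_def)
  note [measurable] = borel_measurable_test_fun[OF \<phi>]
  \<comment> \<open>Pairing values with gradients yields one subsequence and one majorant for
    both.\<close>
  define f where "f k x = (\<phi> k x, grad (\<phi> k) x)" for k x
  define F where "F x = (u x, G x)" for x
  have fm [measurable]: "f k \<in> borel_measurable ?M" for k unfolding f_def by measurable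
  have Fm [measurable]: "F \<in> borel_measurable ?M" unfolding F_def by measurable
  have nf: "(norm (f k x))\<^sup>2 = (\<phi> k x)\<^sup>2 + (norm (grad (\<phi> k) x))\<^sup>2" for k x
    by (simp add: f_def norm_Pair)
  have nF: "(norm (F x))\<^sup>2 = (u x)\<^sup>2 + (norm (G x))\<^sup>2" for x
    by (simp add: F_def norm_Pair)
  have nd: "(norm (f k x - F x))\<^sup>2 = (\<phi> k x - u x)\<^sup>2 + (norm (grad (\<phi> k) x - G x))\<^sup>2" for k x
    by (simp add: f_def F_def norm_Pair)
  have fi: "integrable ?M (\<lambda>x. (norm (f k x))\<^sup>2)" for k
    unfolding nf using integrable_test_fun_power2[OF U \<phi>] by simp
  have Fi: "integrable ?M (\<lambda>x. (norm (F x))\<^sup>2)" unfolding nF using iu iG by simp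
  \<comment> \<open>The integral of a non-integrable function is 0 by default, so the limit in
    \<open>H0\<close> carries information only together with this integrability.\<close>
  have di: "integrable ?M (\<lambda>x. (norm (f k x - F x))\<^sup>2)" for k
    by (rule integrable_norm_diff_power2[OF fm Fm fi Fi])
  have lim': "(\<lambda>k. \<integral>x. (norm (f k x - F x))\<^sup>2 \<partial>?M) \<longlonglongrightarrow> 0" unfolding nd by (rule lim)
  have Cau: "\<exists>N. \<forall>m\<ge>N. \<forall>n\<ge>N. (\<integral>x. (norm (f m x - f n x))\<^sup>2 \<partial>?M) < e" if "e > 0" for e
  proof -
    have "\<exists>N. \<forall>k\<ge>N. norm ((\<integral>x. (norm (f k x - F x))\<^sup>2 \<partial>?M) - 0) < e/4"
      using lim' that by (intro LIMSEQ_D) auto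
    then obtain N where N: "\<And>k. k \<ge> N \<Longrightarrow> (\<integral>x. (norm (f k x - F x))\<^sup>2 \<partial>?M) < e/4" by auto
    have "(\<integral>x. (norm (f m x - f n x))\<^sup>2 \<partial>?M) < e" if mn: "m \<ge> N" "n \<ge> N" for m n
    proof -
      have pt: "(norm (f m x - f n x))\<^sup>2 \<le> 2 * (norm (f m x - F x))\<^sup>2 + 2 * (norm (f n x - F x))\<^sup>2" for x
      proof -
        have "(norm (f m x - f n x))\<^sup>2 \<le> (norm (f m x - F x) + norm (f n x - F x))\<^sup>2"
          using norm_triangle_ineq4[of "f m x - F x" "f n x - F x"] by (intro power_mono) auto
        then show ?thesis
          using sum_squares_bound[of "norm (f m x - F x)" "norm (f n x - F x)"] by (simp add: power2_sum)
      qed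
      have "(\<integral>x. (norm (f m x - f n x))\<^sup>2 \<partial>?M) \<le> (\<integral>x. 2 * (norm (f m x - F x))\<^sup>2 + 2 * (norm (f n x - F x))\<^sup>2 \<partial>?M)"
        using di pt integrable_norm_diff_power2[OF fm fm fi fi] by (intro integral_mono) auto
      also have "\<dots> = 2 * (\<integral>x. (norm (f m x - F x))\<^sup>2 \<partial>?M) + 2 * (\<integral>x. (norm (f n x - F x))\<^sup>2 \<partial>?M)"
        using di by simp
      finally show ?thesis using N[OF mn(1)] N[OF mn(2)] by linarith
    qed
    then show ?thesis by blast
  qed
  obtain r g D where r: "strict_mono r" and [measurable]: "g \<in> borel_measurable ?M" "D \<in> borel_measurable ?M"
    and Di: "integrable ?M (\<lambda>x. (D x)\<^sup>2)" and g: "AE x in ?M. (\<lambda>k. f (r k) x) \<longlonglongrightarrow> g x"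
    and D: "AE x in ?M. \<forall>k. norm (f (r k) x) \<le> D x"
    by (rule L2_Cauchy_dominated_subseq[OF fm fi Cau]) auto
  have limg: "(\<lambda>k. \<integral>x. (norm (f (r k) x - F x))\<^sup>2 \<partial>?M) \<longlonglongrightarrow> (\<integral>x. (norm (g x - F x))\<^sup>2 \<partial>?M)"
    and gi: "integrable ?M (\<lambda>x. (norm (g x - F x))\<^sup>2)"
  proof -
    have 1: "integrable ?M (\<lambda>x. 2 * (D x)\<^sup>2 + 2 * (norm (F x))\<^sup>2)" using Di Fi by simp
    have 2: "AE x in ?M. (\<lambda>k. (norm (f (r k) x - F x))\<^sup>2) \<longlonglongrightarrow> (norm (g x - F x))\<^sup>2"
      using g by eventually_elim (intro tendsto_intros)
    have 3: "AE x in ?M. norm ((norm (f (r k) x - F x))\<^sup>2) \<le> 2 * (D x)\<^sup>2 + 2 * (norm (F x))\<^sup>2" for k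
      using D
    proof eventually_elim
      case (elim x)
      have "norm (f (r k) x - F x) \<le> D x + norm (F x)"
        using norm_triangle_ineq4[of "f (r k) x" "F x"] elim by (meson add_right_mono order_trans)
      then have "(norm (f (r k) x - F x))\<^sup>2 \<le> (D x + norm (F x))\<^sup>2" by (intro power_mono) auto
      then show ?case using sum_squares_bound[of "D x" "norm (F x)"] by (simp add: power2_sum)
    qed
    show "(\<lambda>k. \<integral>x. (norm (f (r k) x - F x))\<^sup>2 \<partial>?M) \<longlonglongrightarrow> (\<integral>x. (norm (g x - F x))\<^sup>2 \<partial>?M)"
      by (rule integral_dominated_convergence[OF _ _ 1 2 3]) measurable
    show "integrable ?M (\<lambda>x. (norm (g x - F x))\<^sup>2)"
      by (rule integrable_dominated_convergence[OF _ _ 1 2 3]) measurable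
  qed
  have "(\<lambda>k. \<integral>x. (norm (f (r k) x - F x))\<^sup>2 \<partial>?M) \<longlonglongrightarrow> 0"
    using LIMSEQ_subseq_LIMSEQ[OF lim' r] by (simp add: o_def)
  then have "(\<integral>x. (norm (g x - F x))\<^sup>2 \<partial>?M) = 0" by (rule LIMSEQ_unique[OF limg])
  then have gF: "AE x in ?M. g x = F x"
    using gi by (simp add: integral_nonneg_eq_0_iff_AE)
  have "dominated_approx U (\<lambda>k. \<phi> (r k)) u G D"
    unfolding dominated_approx_def
  proof (intro conjI allI)
    show "AE x in ?M. (\<lambda>k. \<phi> (r k) x) \<longlonglongrightarrow> u x \<and> (\<lambda>k. grad (\<phi> (r k)) x) \<longlonglongrightarrow> G x \<and>
        (\<forall>k. \<bar>\<phi> (r k) x\<bar> \<le> D x \<and> norm (grad (\<phi> (r k)) x) \<le> D x)"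
      using g D gF
    proof eventually_elim
      case (elim x)
      have "(\<lambda>k. f (r k) x) \<longlonglongrightarrow> (u x, G x)" using elim by (simp add: F_def)
      then have "(\<lambda>k. \<phi> (r k) x) \<longlonglongrightarrow> u x" "(\<lambda>k. grad (\<phi> (r k)) x) \<longlonglongrightarrow> G x"
        using tendsto_fst tendsto_snd by (fastforce simp: f_def)+
      moreover have "\<bar>\<phi> (r k) x\<bar> \<le> D x" "norm (grad (\<phi> (r k)) x) \<le> D x" for k
        using elim(2) norm_fst_le[of "\<phi> (r k) x" "grad (\<phi> (r k)) x"]
          norm_snd_le[of "grad (\<phi> (r k)) x" "\<phi> (r k) x"]
        by (auto simp: f_def intro: order_trans)
      ultimately show ?case by blast
    qed
  qed (use \<phi> Di in auto)
  then show ?thesis by (rule that)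
qed

text \<open>The chain rule for \<open>H0\<close>, with \<open>\<Psi> (\<phi> k)\<close> replaced by
  a test function at tolerance \<open>1 / Suc k\<close>. The absolute error gives convergence and
  the bound \<open>B + 1\<close>; the relative errors, together with
  \<open>|\<Psi> t| \<le> |t|\<close>, give the majorant \<open>2 * D\<close>. The uniform bound is
  what allows passing to the limit against functions that are only integrable.\<close>

lemma dominated_approx_compose:
  assumes A: "dominated_approx U \<phi> u G D"
    and \<Psi>: "\<And>t. (\<Psi> has_real_derivative \<psi> t) (at t)" "\<Psi> 0 = 0"
    and \<psi>: "continuous_on UNIV \<psi>" "\<And>t. \<bar>\<psi> t\<bar> \<le> 1" and B: "\<And>t. \<bar>\<Psi> t\<bar> \<le> B"
  obtains \<eta> where "dominated_approx U \<eta> (\<lambda>x. \<Psi> (u x)) (\<lambda>x. \<psi> (u x) *\<^sub>R G x) (\<lambda>x. 2 * D x)"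
    "\<And>k x. \<bar>\<eta> k x\<bar> \<le> B + 1"
proof -
  let ?e = "\<lambda>k. 1 / real (Suc k)"
  have "\<forall>k. \<exists>\<eta>. test_fun U \<eta> \<and> (\<forall>x. \<bar>\<eta> x - \<Psi> (\<phi> k x)\<bar> \<le> ?e k) \<and> (\<forall>x. \<bar>\<eta> x - \<Psi> (\<phi> k x)\<bar> \<le> ?e k * \<bar>\<phi> k x\<bar>)
      \<and> (\<forall>x. norm (grad \<eta> x - \<psi> (\<phi> k x) *\<^sub>R grad (\<phi> k) x) \<le> ?e k * norm (grad (\<phi> k) x))"
  proof
    fix k
    show "\<exists>\<eta>. test_fun U \<eta> \<and> (\<forall>x. \<bar>\<eta> x - \<Psi> (\<phi> k x)\<bar> \<le> ?e k) \<and> (\<forall>x. \<bar>\<eta> x - \<Psi> (\<phi> k x)\<bar> \<le> ?e k * \<bar>\<phi> k x\<bar>)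
      \<and> (\<forall>x. norm (grad \<eta> x - \<psi> (\<phi> k x) *\<^sub>R grad (\<phi> k) x) \<le> ?e k * norm (grad (\<phi> k) x))"
      by (rule test_fun_C1_compose_approx[OF dominated_approxD(1)[OF A, of k] \<Psi> \<psi>(1), of "?e k"]) auto
  qed
  then obtain \<eta> where \<eta>: "\<And>k. test_fun U (\<eta> k)" "\<And>k x. \<bar>\<eta> k x - \<Psi> (\<phi> k x)\<bar> \<le> ?e k"
    "\<And>k x. \<bar>\<eta> k x - \<Psi> (\<phi> k x)\<bar> \<le> ?e k * \<bar>\<phi> k x\<bar>"
    "\<And>k x. norm (grad (\<eta> k) x - \<psi> (\<phi> k x) *\<^sub>R grad (\<phi> k) x) \<le> ?e k * norm (grad (\<phi> k) x)"
    by metis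
  have e1: "?e k \<le> 1" for k by simp
  have \<Psi>_le: "\<bar>\<Psi> t\<bar> \<le> \<bar>t\<bar>" for t
    using field_differentiable_bound[of UNIV \<Psi> \<psi> 1 t 0] \<Psi> \<psi> by simp
  have \<Psi>c: "isCont \<Psi> t" for t using \<Psi>(1) DERIV_isCont by blast
  have \<psi>c: "isCont \<psi> t" for t using \<psi>(1) by (simp add: continuous_on_eq_continuous_at)
  have \<Psi>m: "\<Psi> \<in> borel_measurable borel" using \<Psi>c by (intro borel_measurable_continuous_onI continuous_at_imp_continuous_on) auto
  have \<psi>m: "\<psi> \<in> borel_measurable borel" using \<psi>(1) by (rule borel_measurable_continuous_onI)
  note [measurable] = dominated_approxD(2-4)[OF A]
  have elim0: "(\<lambda>k. ?e k) \<longlonglongrightarrow> 0" using LIMSEQ_Suc[OF lim_1_over_n, where 'a1 = real] by simp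
  show ?thesis
  proof
    show "\<bar>\<eta> k x\<bar> \<le> B + 1" for k x
      using \<eta>(2)[of k x] B[of "\<phi> k x"] e1[of k] by linarith
    show "dominated_approx U \<eta> (\<lambda>x. \<Psi> (u x)) (\<lambda>x. \<psi> (u x) *\<^sub>R G x) (\<lambda>x. 2 * D x)"
      unfolding dominated_approx_def
    proof (intro conjI allI)
      show "test_fun U (\<eta> k)" for k by (rule \<eta>)
      show "(\<lambda>x. \<Psi> (u x)) \<in> borel_measurable (lebesgue_on U)"
        by (rule measurable_compose[OF _ \<Psi>m]) measurable
      show "(\<lambda>x. \<psi> (u x) *\<^sub>R G x) \<in> borel_measurable (lebesgue_on U)"
        by (intro borel_measurable_scaleR measurable_compose[OF _ \<psi>m]) measurable
      show "(\<lambda>x. 2 * D x) \<in> borel_measurable (lebesgue_on U)" by measurable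
      show "integrable (lebesgue_on U) (\<lambda>x. (2 * D x)\<^sup>2)"
        using dominated_approxD(5)[OF A] by (simp add: power_mult_distrib)
      have "AE x in lebesgue_on U. (\<lambda>k. \<phi> k x) \<longlonglongrightarrow> u x \<and> (\<lambda>k. grad (\<phi> k) x) \<longlonglongrightarrow> G x \<and>
        (\<forall>k. \<bar>\<phi> k x\<bar> \<le> D x \<and> norm (grad (\<phi> k) x) \<le> D x)"
        using A by (simp add: dominated_approx_def)
      then show "AE x in lebesgue_on U. (\<lambda>k. \<eta> k x) \<longlonglongrightarrow> \<Psi> (u x) \<and> (\<lambda>k. grad (\<eta> k) x) \<longlonglongrightarrow> \<psi> (u x) *\<^sub>R G x \<and>
        (\<forall>k. \<bar>\<eta> k x\<bar> \<le> 2 * D x \<and> norm (grad (\<eta> k) x) \<le> 2 * D x)"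
      proof eventually_elim
        case (elim x)
        then have lim: "(\<lambda>k. \<phi> k x) \<longlonglongrightarrow> u x" "(\<lambda>k. grad (\<phi> k) x) \<longlonglongrightarrow> G x"
          and le: "\<And>k. \<bar>\<phi> k x\<bar> \<le> D x" "\<And>k. norm (grad (\<phi> k) x) \<le> D x" by auto
        have "(\<lambda>k. \<eta> k x - \<Psi> (\<phi> k x)) \<longlonglongrightarrow> 0"
          by (rule Lim_null_comparison[OF always_eventually elim0]) (use \<eta>(2) in auto)
        from tendsto_add[OF this isCont_tendsto_compose[OF \<Psi>c lim(1)]]
        have 1: "(\<lambda>k. \<eta> k x) \<longlonglongrightarrow> \<Psi> (u x)" by simp
        have gle: "norm (grad (\<eta> k) x - \<psi> (\<phi> k x) *\<^sub>R grad (\<phi> k) x) \<le> ?e k * D x" for k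
          using \<eta>(4)[of k x] le(2)[of k] by (meson mult_left_mono order_trans of_nat_0_le_iff zero_le_divide_1_iff)
        have "(\<lambda>k. ?e k * D x) \<longlonglongrightarrow> 0 * D x" by (intro tendsto_mult elim0 tendsto_const)
        then have "(\<lambda>k. grad (\<eta> k) x - \<psi> (\<phi> k x) *\<^sub>R grad (\<phi> k) x) \<longlonglongrightarrow> 0"
          by (intro Lim_null_comparison[OF always_eventually[OF allI[OF gle]]]) simp
        from tendsto_add[OF this tendsto_scaleR[OF isCont_tendsto_compose[OF \<psi>c lim(1)] lim(2)]]
        have 2: "(\<lambda>k. grad (\<eta> k) x) \<longlonglongrightarrow> \<psi> (u x) *\<^sub>R G x" by simp
        have 3: "\<bar>\<eta> k x\<bar> \<le> 2 * D x" for k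
        proof -
          have "?e k * \<bar>\<phi> k x\<bar> \<le> 1 * \<bar>\<phi> k x\<bar>" by (intro mult_right_mono e1) auto
          then show ?thesis using \<eta>(3)[of k x] \<Psi>_le[of "\<phi> k x"] le(1)[of k] by linarith
        qed
        have 4: "norm (grad (\<eta> k) x) \<le> 2 * D x" for k
        proof -
          have D0: "D x \<ge> 0" using le(1)[of 0] by linarith
          have "?e k * D x \<le> 1 * D x" by (intro mult_right_mono e1 D0)
          moreover have "norm (\<psi> (\<phi> k x) *\<^sub>R grad (\<phi> k) x) \<le> 1 * D x"
            unfolding norm_scaleR by (intro mult_mono) (use \<psi> le in auto)
          ultimately show ?thesis
            using gle[of k] norm_triangle_sub[of "grad (\<eta> k) x" "\<psi> (\<phi> k x) *\<^sub>R grad (\<phi> k) x"] by linarith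
        qed
        show ?case using 1 2 3 4 by blast
      qed
    qed
  qed
qed

section \<open>Limits in the Sobolev inequality and in the weak equation\<close>

text \<open>The majorant is only known to be square integrable while \<open>s > 2\<close>, so the
  left side passes to the limit by Fatou's lemma; the gradient side converges by domination.\<close>

lemma Sobolev_dominated_approx:
  fixes u :: "real^'n \<Rightarrow> real"
  assumes d: "d = real CARD('n)" "CARD('n) \<ge> 3" and s: "s = 2 * d / (d - 2)" and c: "c = 2 * (d - 1) / (d - 2)"
    and U: "open U" "bounded U" and A: "dominated_approx U \<phi> u G D"
  shows "integrable (lebesgue_on U) (\<lambda>x. \<bar>u x\<bar> powr s)"
    and "(\<integral>x. \<bar>u x\<bar> powr s \<partial>lebesgue_on U) powr (1/s) \<le> c * sqrt (\<integral>x. (norm (G x))\<^sup>2 \<partial>lebesgue_on U)"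
proof -
  let ?M = "lebesgue_on U"
  have d3: "d \<ge> 3" using d by simp
  have s2: "s > 2" using d3 by (simp add: s field_simps)
  have c0: "c > 0" using d3 by (simp add: c)
  interpret finite_measure ?M
    using U by (intro finite_measure_lebesgue_on) (simp add: bounded_set_imp_lmeasurable)
  note [measurable] = dominated_approxD(2-4)[OF A] borel_measurable_test_fun[OF dominated_approxD(1)[OF A]]
  define g where "g k = (c * sqrt (\<integral>x. (norm (grad (\<phi> k) x))\<^sup>2 \<partial>?M)) powr s" for k
  define g' where "g' = (c * sqrt (\<integral>x. (norm (G x))\<^sup>2 \<partial>?M)) powr s"
  have gl: "g \<longlonglongrightarrow> g'"
    unfolding g_def g'_def using c0 s2
    by (intro tendsto_powr' tendsto_mult tendsto_real_sqrt dominated_approx_integral_grad(2)[OF A] tendsto_const) auto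
  have le: "(\<integral>\<^sup>+x. ennreal (\<bar>\<phi> k x\<bar> powr s) \<partial>?M) \<le> ennreal (g k)" for k
  proof -
    obtain M where M: "M > 0" "\<And>x. \<bar>\<phi> k x\<bar> \<le> M"
      using test_fun_bounded[OF dominated_approxD(1)[OF A]] by metis
    have i: "integrable ?M (\<lambda>x. \<bar>\<phi> k x\<bar> powr s)"
      by (rule integrable_const_bound[where B = "M powr s"]) (use M s2 in \<open>auto intro!: powr_mono2\<close>)
    let ?S = "\<integral>x. \<bar>\<phi> k x\<bar> powr s \<partial>?M"
    have "?S = (?S powr (1/s)) powr s" using s2 by (simp add: powr_powr)
    also have "\<dots> \<le> g k" unfolding g_def
      using Sobolev_test_fun[OF d s c U(1) dominated_approxD(1)[OF A]] s2 by (intro powr_mono2) auto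
    finally show ?thesis using i by (simp add: nn_integral_eq_integral ennreal_leI)
  qed
  have "(\<integral>\<^sup>+x. ennreal (\<bar>u x\<bar> powr s) \<partial>?M) = (\<integral>\<^sup>+x. liminf (\<lambda>k. ennreal (\<bar>\<phi> k x\<bar> powr s)) \<partial>?M)"
  proof (rule nn_integral_cong_AE)
    show "AE x in ?M. ennreal (\<bar>u x\<bar> powr s) = liminf (\<lambda>k. ennreal (\<bar>\<phi> k x\<bar> powr s))"
      using dominated_approxD(6)[OF A]
    proof eventually_elim
      case (elim x)
      then have "(\<lambda>k. ennreal (\<bar>\<phi> k x\<bar> powr s)) \<longlonglongrightarrow> ennreal (\<bar>u x\<bar> powr s)"
        using s2 by (intro tendsto_ennrealI tendsto_powr' tendsto_rabs tendsto_const) auto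
      then show ?case using lim_imp_Liminf by (metis trivial_limit_sequentially)
    qed
  qed
  also have "\<dots> \<le> liminf (\<lambda>k. \<integral>\<^sup>+x. ennreal (\<bar>\<phi> k x\<bar> powr s) \<partial>?M)"
    by (rule nn_integral_liminf) measurable
  also have "\<dots> \<le> liminf (\<lambda>k. ennreal (g k))"
    using le by (intro Liminf_mono) auto
  also have "\<dots> = ennreal g'"
    using gl by (intro lim_imp_Liminf tendsto_ennrealI) auto
  finally have fin: "(\<integral>\<^sup>+x. ennreal (\<bar>u x\<bar> powr s) \<partial>?M) \<le> ennreal g'" .
  show i: "integrable ?M (\<lambda>x. \<bar>u x\<bar> powr s)"
    using fin by (intro integrableI_bounded) (auto simp: less_top top_unique intro: order_le_less_trans)
  let ?S = "\<integral>x. \<bar>u x\<bar> powr s \<partial>?M"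
  have "?S \<le> g'" using fin i by (simp add: nn_integral_eq_integral g'_def)
  then have "?S powr (1/s) \<le> g' powr (1/s)" using s2 by (intro powr_mono2) auto
  also have "\<dots> = c * sqrt (\<integral>x. (norm (G x))\<^sup>2 \<partial>?M)"
    using s2 c0 by (simp add: g'_def powr_powr)
  finally show "?S powr (1/s) \<le> c * sqrt (\<integral>x. (norm (G x))\<^sup>2 \<partial>?M)" .
qed

text \<open>The equation is used for the bounded approximants of \<open>\<Psi> (u x)\<close>. The
  terms with \<open>c u\<close> and \<open>f\<close> are dominated through the bound
  \<open>B + 1\<close>, the gradient term through \<open>2 * (D x)\<^sup>2\<close>.\<close>

lemma weak_equation_compose:
  assumes A: "dominated_approx U \<phi> u G D"
    and \<Psi>: "\<And>t. (\<Psi> has_real_derivative \<psi> t) (at t)" "\<Psi> 0 = 0"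
    and \<psi>: "continuous_on UNIV \<psi>" "\<And>t. \<bar>\<psi> t\<bar> \<le> 1" and B: "\<And>t. \<bar>\<Psi> t\<bar> \<le> B"
    and cu: "integrable (lebesgue_on U) (\<lambda>x. c x * u x)" and f: "integrable (lebesgue_on U) f"
    and eq: "\<And>\<eta>. test_fun U \<eta> \<Longrightarrow>
      (\<integral>x. G x \<bullet> grad \<eta> x \<partial>lebesgue_on U) + (\<integral>x. c x * u x * \<eta> x \<partial>lebesgue_on U) = (\<integral>x. f x * \<eta> x \<partial>lebesgue_on U)"
  shows "(\<integral>x. \<psi> (u x) * (norm (G x))\<^sup>2 \<partial>lebesgue_on U) + (\<integral>x. c x * u x * \<Psi> (u x) \<partial>lebesgue_on U)
    = (\<integral>x. f x * \<Psi> (u x) \<partial>lebesgue_on U)"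
proof -
  let ?M = "lebesgue_on U"
  obtain \<eta> where E: "dominated_approx U \<eta> (\<lambda>x. \<Psi> (u x)) (\<lambda>x. \<psi> (u x) *\<^sub>R G x) (\<lambda>x. 2 * D x)"
    and \<eta>B: "\<And>k x. \<bar>\<eta> k x\<bar> \<le> B + 1"
    by (rule dominated_approx_compose[OF A \<Psi> \<psi> B]) blast
  note [measurable] = dominated_approxD(2-4)[OF A] dominated_approxD(2-3)[OF E] borel_measurable_test_fun[OF dominated_approxD(1)[OF E]]
    borel_measurable_integrable[OF cu] borel_measurable_integrable[OF f]
  have low: "(\<lambda>k. \<integral>x. h x * \<eta> k x \<partial>?M) \<longlonglongrightarrow> (\<integral>x. h x * \<Psi> (u x) \<partial>?M)" if h: "integrable ?M h" for h
  proof -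
    note [measurable] = borel_measurable_integrable[OF h]
    show ?thesis
    proof (rule integral_dominated_convergence[where w = "\<lambda>x. \<bar>h x\<bar> * (B + 1)"])
      show "integrable ?M (\<lambda>x. \<bar>h x\<bar> * (B + 1))" using h by simp
      show "AE x in ?M. (\<lambda>k. h x * \<eta> k x) \<longlonglongrightarrow> h x * \<Psi> (u x)"
        using dominated_approxD(6)[OF E] by eventually_elim (intro tendsto_intros)
      show "AE x in ?M. norm (h x * \<eta> k x) \<le> \<bar>h x\<bar> * (B + 1)" for k
        using \<eta>B by (auto simp: abs_mult intro!: mult_left_mono)
    qed measurable
  qed
  have "(\<lambda>k. \<integral>x. G x \<bullet> grad (\<eta> k) x \<partial>?M) \<longlonglongrightarrow> (\<integral>x. G x \<bullet> (\<psi> (u x) *\<^sub>R G x) \<partial>?M)"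
  proof (rule integral_dominated_convergence[where w = "\<lambda>x. 2 * (D x)\<^sup>2"])
    show "integrable ?M (\<lambda>x. 2 * (D x)\<^sup>2)" using dominated_approxD(5)[OF A] by simp
    show "AE x in ?M. (\<lambda>k. G x \<bullet> grad (\<eta> k) x) \<longlonglongrightarrow> G x \<bullet> (\<psi> (u x) *\<^sub>R G x)"
      using dominated_approxD(7)[OF E] by eventually_elim (intro tendsto_intros)
    show "AE x in ?M. norm (G x \<bullet> grad (\<eta> k) x) \<le> 2 * (D x)\<^sup>2" for k
      using dominated_approxD(11)[OF A] dominated_approxD(9)[OF E, of k]
    proof eventually_elim
      case (elim x)
      have "norm (G x \<bullet> grad (\<eta> k) x) \<le> norm (G x) * norm (grad (\<eta> k) x)"
        by (simp add: Cauchy_Schwarz_ineq2)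
      also have "\<dots> \<le> D x * (2 * D x)"
        using elim by (intro mult_mono) (auto intro: order_trans[OF norm_ge_zero])
      finally show ?case by (simp add: power2_eq_square mult_ac)
    qed
  qed measurable
  from tendsto_add[OF this low[OF cu]]
  have "(\<lambda>k. \<integral>x. f x * \<eta> k x \<partial>?M) \<longlonglongrightarrow> (\<integral>x. G x \<bullet> (\<psi> (u x) *\<^sub>R G x) \<partial>?M) + (\<integral>x. c x * u x * \<Psi> (u x) \<partial>?M)"
    using eq[OF dominated_approxD(1)[OF E]] by simp
  from LIMSEQ_unique[OF this low[OF f]] show ?thesis
    by (simp add: power2_norm_eq_inner)
qed

section \<open>Boundedness of weak solutions\<close>

text \<open>Hoelder with exponent \<open>q / r\<close> against the indicator of \<open>A\<close>.
  Taken on level sets, the power of \<open>measure M A\<close> drives the iteration; taken on the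
  whole space, it is the inclusion of the L^q space in the L^r space for finite measures.\<close>

lemma Lp_restrict_le:
  fixes f :: "'a \<Rightarrow> real"
  assumes r: "r \<ge> 1" "r < q" and [measurable]: "f \<in> borel_measurable M" "A \<in> sets M"
    and A: "emeasure M A < \<infinity>" and f: "integrable M (\<lambda>x. \<bar>f x\<bar> powr q)"
  shows "integrable M (\<lambda>x. \<bar>f x * indicator A x\<bar> powr r)"
    and "(\<integral>x. \<bar>f x * indicator A x\<bar> powr r \<partial>M) powr (1/r)
      \<le> (\<integral>x. \<bar>f x\<bar> powr q \<partial>M) powr (1/q) * measure M A powr (1/r - 1/q)"
proof -
  define P where "P = q / r"
  define Q where "Q = q / (q - r)"
  have PQ: "P > 1" "Q > 1" "1/P + 1/Q = 1"
    using r by (auto simp: P_def Q_def field_simps)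
  have eq: "\<bar>f x * indicator A x\<bar> powr r = \<bar>f x\<bar> powr r * indicator A x" for x
    by (simp add: indicator_def)
  have e1: "(\<lambda>x. \<bar>\<bar>f x\<bar> powr r\<bar> powr P) = (\<lambda>x. \<bar>f x\<bar> powr q)"
    using r by (simp add: powr_powr P_def)
  have e2: "(\<lambda>x. \<bar>indicator A x :: real\<bar> powr Q) = indicator A"
    by (auto simp: indicator_def)
  have i1: "integrable M (\<lambda>x. \<bar>\<bar>f x\<bar> powr r\<bar> powr P)" unfolding e1 by (rule f)
  have i2: "integrable M (\<lambda>x. \<bar>indicator A x :: real\<bar> powr Q)" unfolding e2
    using A by (simp add: integrable_indicator_iff)
  have m: "(\<lambda>x. \<bar>f x\<bar> powr r) \<in> borel_measurable M" "(indicator A :: _ \<Rightarrow> real) \<in> borel_measurable M"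
    by measurable
  show "integrable M (\<lambda>x. \<bar>f x * indicator A x\<bar> powr r)"
    unfolding eq by (rule Holder_integral(1)[OF PQ m i1 i2])
  have "(\<integral>x. \<bar>f x * indicator A x\<bar> powr r \<partial>M) = (\<integral>x. \<bar>\<bar>f x\<bar> powr r * indicator A x\<bar> \<partial>M)"
    unfolding eq by simp
  also have "\<dots> \<le> (\<integral>x. \<bar>f x\<bar> powr q \<partial>M) powr (1/P) * measure M A powr (1/Q)"
    using Holder_integral(2)[OF PQ m i1 i2] unfolding e1 e2 by simp
  finally have "(\<integral>x. \<bar>f x * indicator A x\<bar> powr r \<partial>M) powr (1/r)
      \<le> ((\<integral>x. \<bar>f x\<bar> powr q \<partial>M) powr (1/P) * measure M A powr (1/Q)) powr (1/r)"
    using r by (intro powr_mono2) auto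
  also have "\<dots> = (\<integral>x. \<bar>f x\<bar> powr q \<partial>M) powr (1/P * (1/r)) * measure M A powr (1/Q * (1/r))"
    by (simp add: powr_mult powr_powr)
  also have "1/P * (1/r) = 1/q" using r by (simp add: P_def)
  also have "1/Q * (1/r) = 1/r - 1/q" using r by (simp add: Q_def field_simps)
  finally show "(\<integral>x. \<bar>f x * indicator A x\<bar> powr r \<partial>M) powr (1/r)
      \<le> (\<integral>x. \<bar>f x\<bar> powr q \<partial>M) powr (1/q) * measure M A powr (1/r - 1/q)" .
qed

section \<open>The truncation and Stampacchia's iteration\<close>

lemma has_derivative_pos_part_power2:
  "((\<lambda>t. (max t 0)\<^sup>2) has_real_derivative 2 * max t 0) (at t)"
proof -
  have "(\<lambda>t::real. (max t 0) powr 2) = (\<lambda>t. (max t 0)\<^sup>2)"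
    by (rule ext) (simp add: powr_numeral)
  then show ?thesis using has_derivative_pos_part_powr[of 2 t] by simp
qed

lemma C1_truncation:
  fixes k \<delta> :: real
  assumes k: "k \<ge> 0" and \<delta>: "\<delta> > 0"
  obtains \<Psi> \<psi> where "\<And>t. (\<Psi> has_real_derivative \<psi> t) (at t)" "\<Psi> 0 = 0" "continuous_on UNIV \<psi>"
    "\<And>t. 0 \<le> \<psi> t" "\<And>t. \<psi> t \<le> 1" "\<And>t. \<bar>\<Psi> t\<bar> \<le> \<delta>" "\<And>t. t * \<Psi> t \<ge> 0"
    "\<And>t. \<bar>t\<bar> \<le> k \<Longrightarrow> \<Psi> t = 0" "\<And>t. \<bar>t\<bar> > k + \<delta> \<Longrightarrow> \<bar>\<Psi> t\<bar> \<ge> \<delta>/2"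
proof -
  \<comment> \<open>\<open>R\<close> is a \<open>C\<^sup>1\<close> substitute for \<open>min (max t 0) \<delta>\<close>; being bounded, it can be integrated against \<open>f\<close> and \<open>c u\<close>.\<close>
  define R where "R t = \<delta> * (max t 0)\<^sup>2 / ((max t 0)\<^sup>2 + \<delta>\<^sup>2)" for t
  define R' where "R' t = 2 * max t 0 * \<delta>^3 / ((max t 0)\<^sup>2 + \<delta>\<^sup>2)\<^sup>2" for t
  have pos: "(max t 0)\<^sup>2 + \<delta>\<^sup>2 > 0" for t using \<delta> by (intro add_nonneg_pos) auto
  have dR: "(R has_real_derivative R' t) (at t)" for t
  proof -
    have "((\<lambda>t. \<delta> * (max t 0)\<^sup>2 / ((max t 0)\<^sup>2 + \<delta>\<^sup>2)) has_real_derivative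
      ((\<delta> * (2 * max t 0)) * ((max t 0)\<^sup>2 + \<delta>\<^sup>2) - (\<delta> * (max t 0)\<^sup>2) * (2 * max t 0 + 0)) / (((max t 0)\<^sup>2 + \<delta>\<^sup>2) * ((max t 0)\<^sup>2 + \<delta>\<^sup>2))) (at t)"
      using pos[of t] by (intro DERIV_divide DERIV_cmult DERIV_add DERIV_const has_derivative_pos_part_power2) auto
    moreover have "((\<delta> * (2 * max t 0)) * ((max t 0)\<^sup>2 + \<delta>\<^sup>2) - (\<delta> * (max t 0)\<^sup>2) * (2 * max t 0 + 0)) / (((max t 0)\<^sup>2 + \<delta>\<^sup>2) * ((max t 0)\<^sup>2 + \<delta>\<^sup>2)) = R' t"
      unfolding R'_def power2_eq_square[of "(max t 0)\<^sup>2 + \<delta>\<^sup>2"]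
      by (rule arg_cong[where f = "\<lambda>z. z / _"]) (simp add: algebra_simps power2_eq_square power3_eq_cube)
    ultimately show ?thesis unfolding R_def[abs_def] by simp
  qed
  have cR': "continuous_on UNIV R'"
    unfolding R'_def using pos by (intro continuous_intros) (auto simp: less_imp_neq[symmetric])
  have R'0: "R' t \<ge> 0" for t using \<delta> by (auto simp: R'_def)
  have R'1: "R' t \<le> 1" for t
  proof -
    define x where "x = max t 0"
    have "2 * x * \<delta> \<le> x\<^sup>2 + \<delta>\<^sup>2" by (rule sum_squares_bound)
    moreover have "\<delta>\<^sup>2 \<le> x\<^sup>2 + \<delta>\<^sup>2" by simp
    ultimately have "(2 * x * \<delta>) * \<delta>\<^sup>2 \<le> (x\<^sup>2 + \<delta>\<^sup>2) * (x\<^sup>2 + \<delta>\<^sup>2)"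
      by (intro mult_mono) auto
    then have "2 * x * \<delta>^3 \<le> (x\<^sup>2 + \<delta>\<^sup>2)\<^sup>2" by (simp add: power2_eq_square power3_eq_cube mult_ac)
    then show ?thesis using pos[of t] by (simp add: R'_def x_def divide_le_eq)
  qed
  have Rz: "R t = 0" "R' t = 0" if "t \<le> 0" for t using that by (auto simp: R_def R'_def)
  have R0: "R t \<ge> 0" for t using \<delta> by (auto simp: R_def)
  have R1: "R t \<le> \<delta>" for t
  proof -
    have "\<delta> * (max t 0)\<^sup>2 \<le> \<delta> * ((max t 0)\<^sup>2 + \<delta>\<^sup>2)" using \<delta> by (intro mult_left_mono) auto
    then show ?thesis using pos[of t] by (simp add: R_def divide_le_eq)
  qed
  \<comment> \<open>The profile \<open>R\<close> takes the value \<open>\<delta>/2\<close> at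
    \<open>\<delta>\<close> and increases from there; this is the loss compared with the piecewise
    linear truncation.\<close>
  have Rh: "R t \<ge> \<delta>/2" if "t \<ge> \<delta>" for t
  proof -
    define y where "y = (max t 0)\<^sup>2"
    have "\<delta>\<^sup>2 \<le> y" unfolding y_def using that \<delta> by (intro power_mono) auto
    then have "\<delta> / 2 * \<delta>\<^sup>2 \<le> \<delta> / 2 * y" using \<delta> by (intro mult_left_mono) auto
    then have "\<delta> / 2 * (y + \<delta>\<^sup>2) \<le> \<delta> * y" by (simp add: distrib_left)
    then show ?thesis using pos[of t] by (simp add: R_def y_def[symmetric] le_divide_eq)
  qed
  \<comment> \<open>The odd extension of the shifted profile. As \<open>k \<ge> 0\<close>, at every
    \<open>t\<close> at most one of the two terms is nonzero, so the bounds of \<open>R\<close> and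
    \<open>R'\<close> carry over without doubling.\<close>
  define \<Psi> where "\<Psi> t = R (t - k) - R (- t - k)" for t
  define \<psi> where "\<psi> t = R' (t - k) + R' (- t - k)" for t
  show ?thesis
  proof (rule that[of \<Psi> \<psi>])
    show "(\<Psi> has_real_derivative \<psi> t) (at t)" for t
    proof -
      have "((\<lambda>t. R (t - k)) has_real_derivative R' (t - k) * 1) (at t)"
        by (rule DERIV_chain2[OF dR]) (auto intro!: derivative_eq_intros)
      moreover have "((\<lambda>t. R (- t - k)) has_real_derivative R' (- t - k) * (-1)) (at t)"
        by (rule DERIV_chain2[OF dR]) (auto intro!: derivative_eq_intros)
      ultimately have "((\<lambda>t. R (t - k) - R (- t - k)) has_real_derivative R' (t - k) * 1 - R' (- t - k) * (-1)) (at t)"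
        by (rule DERIV_diff)
      then show ?thesis by (simp add: \<Psi>_def[abs_def] \<psi>_def)
    qed
    show "\<Psi> 0 = 0" by (simp add: \<Psi>_def)
    show "continuous_on UNIV \<psi>" unfolding \<psi>_def
      by (intro continuous_on_add continuous_on_compose2[OF cR'] continuous_intros) auto
    show "0 \<le> \<psi> t" for t using R'0 by (simp add: \<psi>_def)
    show "\<psi> t \<le> 1" for t using R'1 Rz k by (cases "t \<ge> 0") (auto simp: \<psi>_def)
    show "\<bar>\<Psi> t\<bar> \<le> \<delta>" for t using R0 R1 Rz k by (cases "t \<ge> 0") (auto simp: \<Psi>_def)
    show "t * \<Psi> t \<ge> 0" for t
      using R0 Rz k by (cases "t \<ge> 0") (auto simp: \<Psi>_def mult_nonpos_nonpos mult_nonneg_nonpos2)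
    show "\<Psi> t = 0" if "\<bar>t\<bar> \<le> k" for t using that Rz by (auto simp: \<Psi>_def)
    show "\<bar>\<Psi> t\<bar> \<ge> \<delta>/2" if "\<bar>t\<bar> > k + \<delta>" for t
      using that Rz k \<delta> Rh[of "t - k"] Rh[of "- t - k"] R0[of "t - k"] R0[of "- t - k"]
      by (cases "t \<ge> 0") (auto simp: \<Psi>_def)
  qed
qed

text \<open>The superlinear power \<open>1/s + \<tau>\<close> beats the factor \<open>2^n\<close>
  coming from the shrinking gaps. The decay \<open>m * 2 powr (- n / \<tau>)\<close> reproduces
  itself: in \<open>K\<close>, the 4 absorbs the constant part of \<open>2^(n+2)\<close>,
  \<open>m powr \<tau>\<close> absorbs the surplus power of \<open>m\<close>, and
  \<open>2 powr (1 / (s * \<tau>))\<close> supplies the shift from \<open>n\<close> to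
  \<open>n + 1\<close>.\<close>

lemma Stampacchia_iteration:
  fixes a :: "nat \<Rightarrow> real"
  assumes a0: "\<And>n. a n \<ge> 0" "a 0 \<le> m" and m: "m > 0" and s: "s > 0" and \<tau>: "\<tau> > 0" and T: "T > 0"
    and K: "K = 4 * T * m powr \<tau> * 2 powr (1 / (s * \<tau>))"
    and step: "\<And>n. K / 2^(n+2) * a (Suc n) powr (1/s) \<le> T * a n powr (1/s + \<tau>)"
  shows "a \<longlonglongrightarrow> 0"
proof -
  have Kpos: "K > 0" using T m by (simp add: K)
  have bound: "a n \<le> m * 2 powr (- real n / \<tau>)" for n
  proof (induction n)
    case 0
    then show ?case using a0 by simp
  next
    case (Suc n)
    let ?b = "m * 2 powr (- real n / \<tau>)"
    have "a (Suc n) powr (1/s) \<le> T * 2^(n+2) / K * a n powr (1/s + \<tau>)"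
      using step[of n] Kpos by (simp add: field_simps)
    also have "\<dots> \<le> T * 2^(n+2) / K * ?b powr (1/s + \<tau>)"
      using Suc a0 s \<tau> T Kpos by (intro mult_left_mono powr_mono2) auto
    also have "\<dots> = (m * 2 powr (- real (Suc n) / \<tau>)) powr (1/s)"
    proof -
      have "(2::real)^(n+2) = 4 * 2 powr real n" by (simp add: powr_realpow)
      then have "T * 2^(n+2) / K = 2 powr real n / (m powr \<tau> * 2 powr (1 / (s * \<tau>)))"
        using T by (simp add: K)
      also have "\<dots> = m powr (-\<tau>) * 2 powr (real n - 1 / (s * \<tau>))"
        by (simp add: powr_diff powr_minus_divide)
      finally have 1: "T * 2^(n+2) / K = m powr (-\<tau>) * 2 powr (real n - 1 / (s * \<tau>))" .
      have 2: "?b powr (1/s + \<tau>) = m powr (1/s + \<tau>) * 2 powr ((- real n / \<tau>) * (1/s + \<tau>))"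
        by (simp add: powr_mult powr_powr)
      have "T * 2^(n+2) / K * ?b powr (1/s + \<tau>)
        = (m powr (-\<tau>) * m powr (1/s + \<tau>)) * (2 powr (real n - 1 / (s * \<tau>)) * 2 powr ((- real n / \<tau>) * (1/s + \<tau>)))"
        unfolding 1 2 by (simp only: mult_ac)
      also have "\<dots> = m powr (1/s) * 2 powr (real n - 1 / (s * \<tau>) + (- real n / \<tau>) * (1/s + \<tau>))"
        by (simp add: powr_add[symmetric])
      also have "real n - 1 / (s * \<tau>) + (- real n / \<tau>) * (1/s + \<tau>) = (- real (Suc n) / \<tau>) * (1/s)"
        using s \<tau> by (simp add: field_simps)
      finally show ?thesis by (simp add: powr_mult powr_powr)
    qed
    finally have "a (Suc n) powr (1/s) \<le> (m * 2 powr (- real (Suc n) / \<tau>)) powr (1/s)" .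
    then have "(a (Suc n) powr (1/s)) powr s \<le> ((m * 2 powr (- real (Suc n) / \<tau>)) powr (1/s)) powr s"
      by (rule powr_mono2[OF less_imp_le[OF s] powr_ge_zero])
    then show ?case using s m a0 by (simp add: powr_powr)
  qed
  have lim: "(\<lambda>n. m * (2 powr (-1/\<tau>))^n) \<longlonglongrightarrow> m * 0"
    using \<tau> by (intro tendsto_mult tendsto_const LIMSEQ_power_zero) (simp add: powr_less_one)
  have "(2 powr (-1/\<tau>))^n = 2 powr (- real n / \<tau>)" for n
    by (simp add: powr_power)
  then have "a n \<le> m * (2 powr (-1/\<tau>))^n" for n
    using bound[of n] by simp
  then show ?thesis
    using lim a0 by (intro tendsto_sandwich[OF _ _ tendsto_const, of _ a _ "\<lambda>n. m * (2 powr (-1/\<tau>))^n"]) auto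
qed


section \<open>The level set estimate and the sup bound\<close>

text \<open>Let \<open>X\<close> be the L^s norm of the truncation \<open>\<Psi> (u x)\<close>.
  Sobolev and the tested equation bound \<open>X\<^sup>2\<close> by \<open>\<gamma>\<^sup>2\<close>
  times the integral of \<open>f * \<Psi> (u x)\<close>, the zero order term being nonnegative. As
  \<open>\<Psi>\<close> vanishes up to level \<open>k\<close>, Hoelder bounds this integral by
  \<open>X\<close> times a norm of \<open>f\<close> on \<open>{|u| > k}\<close>. One factor
  \<open>X\<close> cancels, and \<open>|\<Psi>| \<ge> \<delta>/2\<close> above level
  \<open>k + \<delta>\<close> bounds \<open>X\<close> from below.\<close>

lemma weak_solution_level_estimate:
  fixes u :: "real^'n \<Rightarrow> real"
  assumes d: "d = real CARD('n)" "CARD('n) \<ge> 3" and s: "s = 2 * d / (d - 2)" and \<gamma>: "\<gamma> = 2 * (d - 1) / (d - 2)"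
    and U: "open U" "bounded U" and A: "dominated_approx U \<phi> u G D"
    and c: "AE x in lebesgue_on U. c x \<ge> 0" and cu: "integrable (lebesgue_on U) (\<lambda>x. c x * u x)"
    and q: "q > d / 2" and f: "in_Lp q U f"
    and eq: "\<And>\<eta>. test_fun U \<eta> \<Longrightarrow>
      (\<integral>x. G x \<bullet> grad \<eta> x \<partial>lebesgue_on U) + (\<integral>x. c x * u x * \<eta> x \<partial>lebesgue_on U) = (\<integral>x. f x * \<eta> x \<partial>lebesgue_on U)"
    and k: "k \<ge> 0" and \<delta>: "\<delta> > 0"
  shows "\<delta> / 2 * measure (lebesgue_on U) {x \<in> U. \<bar>u x\<bar> > k + \<delta>} powr (1/s)
    \<le> \<gamma>\<^sup>2 * Lp_norm q U f * measure (lebesgue_on U) {x \<in> U. \<bar>u x\<bar> > k} powr (1 - 1/q - 1/s)"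
proof -
  let ?M = "lebesgue_on U"
  interpret finite_measure ?M
    using U by (intro finite_measure_lebesgue_on) (simp add: bounded_set_imp_lmeasurable)
  have d3: "d \<ge> 3" using d by simp
  have s2: "s > 2" using d3 by (simp add: s field_simps)
  have \<gamma>0: "\<gamma> > 0" using d3 by (simp add: \<gamma>)
  \<comment> \<open>The conjugate exponent of \<open>s\<close>, equal to
    \<open>2 * d / (d + 2)\<close>. It lies below \<open>q\<close>, which leaves a positive power of
    the measure of the level set.\<close>
  define r where "r = s / (s - 1)"
  have r1: "r > 1" "1/r + 1/s = 1" using s2 by (auto simp: r_def field_simps)
  have s1: "s - 1 = (d + 2) / (d - 2)" using d3 by (simp add: s field_simps)
  have "r = 2 * d / (d + 2)" unfolding r_def s1 using d3 by (simp add: s)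
  also have "\<dots> \<le> d / 2" using d3 by (simp add: field_simps)
  finally have rq: "r < q" using q by simp
  have sp: "space ?M = U" by simp
  have [measurable]: "f \<in> borel_measurable ?M" and fq: "integrable ?M (\<lambda>x. \<bar>f x\<bar> powr q)"
    using f by (auto simp: in_Lp_def)
  have f1: "integrable ?M f"
  proof -
    have "integrable ?M (\<lambda>x. \<bar>f x * indicator (space ?M) x\<bar> powr 1)"
      using rq r1 fq by (intro Lp_restrict_le(1)[where q = q]) (auto simp: less_top[symmetric])
    then have "integrable ?M (\<lambda>x. \<bar>f x * indicator (space ?M) x\<bar>)" by simp
    then have "integrable ?M (\<lambda>x. \<bar>f x\<bar>)"
      by (rule Bochner_Integration.integrable_cong[THEN iffD1, rotated 2]) (auto simp: indicator_def)
    then show ?thesis by (simp add: integrable_abs_iff)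
  qed
  obtain \<Psi> \<psi> where \<Psi>: "\<And>t. (\<Psi> has_real_derivative \<psi> t) (at t)" "\<Psi> 0 = 0" "continuous_on UNIV \<psi>"
    and \<psi>0: "\<And>t. 0 \<le> \<psi> t" and \<psi>1: "\<And>t. \<psi> t \<le> 1" and \<Psi>\<delta>: "\<And>t. \<bar>\<Psi> t\<bar> \<le> \<delta>" and \<Psi>t: "\<And>t. t * \<Psi> t \<ge> 0"
    and \<Psi>k: "\<And>t. \<bar>t\<bar> \<le> k \<Longrightarrow> \<Psi> t = 0" and \<Psi>h: "\<And>t. \<bar>t\<bar> > k + \<delta> \<Longrightarrow> \<bar>\<Psi> t\<bar> \<ge> \<delta>/2"
    by (rule C1_truncation[OF k \<delta>]) blast
  have \<psi>a: "\<bar>\<psi> t\<bar> \<le> 1" for t using \<psi>0 \<psi>1 by (simp add: abs_le_iff order_trans[OF _ zero_le_one])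
  obtain \<eta> where E: "dominated_approx U \<eta> (\<lambda>x. \<Psi> (u x)) (\<lambda>x. \<psi> (u x) *\<^sub>R G x) (\<lambda>x. 2 * D x)"
    by (rule dominated_approx_compose[OF A \<Psi> \<psi>a \<Psi>\<delta>]) blast
  note [measurable] = dominated_approxD(2-4)[OF A] dominated_approxD(2-3)[OF E]
  define Ak where "Ak = {x \<in> space ?M. \<bar>u x\<bar> > k}"
  define Ah where "Ah = {x \<in> space ?M. \<bar>u x\<bar> > k + \<delta>}"
  have [measurable]: "Ak \<in> sets ?M" "Ah \<in> sets ?M" unfolding Ak_def Ah_def by measurable
  define X where "X = (\<integral>x. \<bar>\<Psi> (u x)\<bar> powr s \<partial>?M) powr (1/s)"
  have X0: "X \<ge> 0" by (simp add: X_def)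
  have iS: "integrable ?M (\<lambda>x. \<bar>\<Psi> (u x)\<bar> powr s)"
    by (rule Sobolev_dominated_approx(1)[OF d s \<gamma> U E])
  have i\<psi>: "integrable ?M (\<lambda>x. \<psi> (u x) * (norm (G x))\<^sup>2)"
  proof (rule Bochner_Integration.integrable_bound[OF dominated_approx_integral_grad(1)[OF A]])
    have "\<psi> \<in> borel_measurable borel" using \<Psi>(3) by (rule borel_measurable_continuous_onI)
    from measurable_compose[OF dominated_approxD(2)[OF A] this]
    show "(\<lambda>x. \<psi> (u x) * (norm (G x))\<^sup>2) \<in> borel_measurable ?M" by measurable
    show "AE x in ?M. norm (\<psi> (u x) * (norm (G x))\<^sup>2) \<le> norm ((norm (G x))\<^sup>2)"
      using \<psi>a by (auto simp: abs_mult intro!: mult_left_le_one_le)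
  qed
  have "(\<integral>x. (norm (\<psi> (u x) *\<^sub>R G x))\<^sup>2 \<partial>?M) \<le> (\<integral>x. \<psi> (u x) * (norm (G x))\<^sup>2 \<partial>?M)"
  proof (rule integral_mono[OF dominated_approx_integral_grad(1)[OF E] i\<psi>])
    fix x
    \<comment> \<open>Sobolev needs the square of the derivative, while testing produces its first
      power; \<open>0 \<le> \<psi> \<le> 1\<close> compares the two.\<close>
    have "(\<psi> (u x))\<^sup>2 \<le> \<psi> (u x)" using \<psi>0 \<psi>1 by (simp add: power2_eq_square mult_left_le_one_le)
    then show "(norm (\<psi> (u x) *\<^sub>R G x))\<^sup>2 \<le> \<psi> (u x) * (norm (G x))\<^sup>2"
      by (simp add: power_mult_distrib mult_right_mono)
  qed
  also have "\<dots> \<le> (\<integral>x. f x * \<Psi> (u x) \<partial>?M)"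
  proof -
    have "(\<integral>x. c x * u x * \<Psi> (u x) \<partial>?M) \<ge> 0"
    proof (rule integral_nonneg_AE)
      show "AE x in ?M. 0 \<le> c x * u x * \<Psi> (u x)" using c
        by eventually_elim (use \<Psi>t in \<open>simp add: mult.assoc\<close>)
    qed
    then show ?thesis
      using weak_equation_compose[OF A \<Psi> \<psi>a \<Psi>\<delta> cu f1 eq] by linarith
  qed
  also have "\<dots> \<le> (\<integral>x. \<bar>(f x * indicator Ak x) * \<Psi> (u x)\<bar> \<partial>?M)"
  proof (rule integral_mono)
    have b: "integrable ?M (\<lambda>x. f x * \<Psi> (u x))"
    proof (rule Bochner_Integration.integrable_bound)
      show "integrable ?M (\<lambda>x. f x * \<delta>)" using f1 by simp
      show "AE x in ?M. norm (f x * \<Psi> (u x)) \<le> norm (f x * \<delta>)"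
        using \<Psi>\<delta> \<delta> by (auto simp: abs_mult intro!: mult_left_mono)
    qed measurable
    then show "integrable ?M (\<lambda>x. f x * \<Psi> (u x))" .
    have e: "f x * \<Psi> (u x) = f x * indicator Ak x * \<Psi> (u x)" if "x \<in> space ?M" for x
      using that \<Psi>k[of "u x"] by (auto simp: Ak_def indicator_def)
    show "integrable ?M (\<lambda>x. \<bar>f x * indicator Ak x * \<Psi> (u x)\<bar>)"
      by (rule integrable_abs[OF iffD1[OF Bochner_Integration.integrable_cong[OF refl e] b]])
    show "f x * \<Psi> (u x) \<le> \<bar>f x * indicator Ak x * \<Psi> (u x)\<bar>" if "x \<in> space ?M" for x
      unfolding e[OF that] by (rule abs_ge_self)
  qed
  also have "\<dots> \<le> (\<integral>x. \<bar>f x * indicator Ak x\<bar> powr r \<partial>?M) powr (1/r) * X"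
    unfolding X_def
    by (rule Holder_integral(2)) (use r1 s2 rq fq iS in \<open>auto intro!: Lp_restrict_le(1)[where q = q] simp: less_top[symmetric]\<close>)
  also have "\<dots> \<le> (Lp_norm q U f * measure ?M Ak powr (1/r - 1/q)) * X"
    unfolding Lp_norm_def
    by (intro mult_right_mono X0 Lp_restrict_le(2)) (use r1 rq fq in \<open>auto simp: less_top[symmetric]\<close>)
  finally have main: "(\<integral>x. (norm (\<psi> (u x) *\<^sub>R G x))\<^sup>2 \<partial>?M) \<le> (Lp_norm q U f * measure ?M Ak powr (1/r - 1/q)) * X" .
  have "X \<le> \<gamma> * sqrt (\<integral>x. (norm (\<psi> (u x) *\<^sub>R G x))\<^sup>2 \<partial>?M)"
    unfolding X_def by (rule Sobolev_dominated_approx(2)[OF d s \<gamma> U E])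
  then have "X\<^sup>2 \<le> (\<gamma> * sqrt (\<integral>x. (norm (\<psi> (u x) *\<^sub>R G x))\<^sup>2 \<partial>?M))\<^sup>2"
    using X0 by (intro power_mono)
  also have "\<dots> = \<gamma>\<^sup>2 * (\<integral>x. (norm (\<psi> (u x) *\<^sub>R G x))\<^sup>2 \<partial>?M)"
    by (simp add: power_mult_distrib)
  also have "\<dots> \<le> \<gamma>\<^sup>2 * ((Lp_norm q U f * measure ?M Ak powr (1/r - 1/q)) * X)"
    using main by (intro mult_left_mono) auto
  finally have "X * X \<le> (\<gamma>\<^sup>2 * Lp_norm q U f * measure ?M Ak powr (1/r - 1/q)) * X"
    by (simp add: power2_eq_square mult_ac)
  then have X_le: "X \<le> \<gamma>\<^sup>2 * Lp_norm q U f * measure ?M Ak powr (1/r - 1/q)"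
    using X0 by (cases "X = 0") (auto simp: Lp_norm_def mult_le_cancel_right)
  have "Ah \<inter> U = Ah" by (auto simp: Ah_def)
  then have "(\<delta>/2) powr s * measure ?M Ah = (\<integral>x. (\<delta>/2) powr s * indicator Ah x \<partial>?M)"
    by simp
  also have "\<dots> \<le> (\<integral>x. \<bar>\<Psi> (u x)\<bar> powr s \<partial>?M)"
  proof (rule integral_mono[OF _ iS])
    show "integrable ?M (\<lambda>x. (\<delta>/2) powr s * indicator Ah x)" by (simp add: less_top[symmetric])
    show "(\<delta>/2) powr s * indicator Ah x \<le> \<bar>\<Psi> (u x)\<bar> powr s" for x
      using \<Psi>h[of "u x"] s2 \<delta> by (auto simp: Ah_def indicator_def intro!: powr_mono2)
  qed
  finally have L1: "((\<delta>/2) powr s * measure ?M Ah) powr (1/s) \<le> X"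
    unfolding X_def using s2 by (intro powr_mono2) auto
  have L2: "((\<delta>/2) powr s * measure ?M Ah) powr (1/s) = \<delta>/2 * measure ?M Ah powr (1/s)"
    using \<delta> s2 by (simp add: powr_mult powr_powr)
  have ex: "1/r - 1/q = 1 - 1/q - 1/s" using r1 by simp
  have "\<delta>/2 * measure ?M Ah powr (1/s) \<le> \<gamma>\<^sup>2 * Lp_norm q U f * measure ?M Ak powr (1 - 1/q - 1/s)"
    by (rule order_trans[OF L1[unfolded L2] X_le[unfolded ex]])
  then show ?thesis by (simp add: Ak_def Ah_def)
qed


text \<open>The level estimate is iterated on levels increasing to \<open>K\<close>. Since
  \<open>1/q = 1/d + 1/p\<close> and \<open>1/s = 1/2 - 1/d\<close>, its exponent
  \<open>1 - 1/q - 1/s\<close> equals \<open>1/s + \<tau>\<close>, which is the superlinear form the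
  iteration needs.\<close>

lemma weak_solution_bounded:
  fixes u :: "real^'n \<Rightarrow> real"
  assumes d: "d = real CARD('n)" "CARD('n) \<ge> 3" and s: "s = 2 * d / (d - 2)" and \<gamma>: "\<gamma> = 2 * (d - 1) / (d - 2)"
    and U: "open U" "bounded U" and H: "H0 U u G"
    and c: "AE x in lebesgue_on U. c x \<ge> 0" and cu: "integrable (lebesgue_on U) (\<lambda>x. c x * u x)"
    and p: "p > d" and f: "in_Lp (p * d / (d + p)) U f"
    and eq: "\<And>\<eta>. test_fun U \<eta> \<Longrightarrow>
      (\<integral>x. G x \<bullet> grad \<eta> x \<partial>lebesgue_on U) + (\<integral>x. c x * u x * \<eta> x \<partial>lebesgue_on U) = (\<integral>x. f x * \<eta> x \<partial>lebesgue_on U)"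
    and e: "e > 0" and \<tau>: "\<tau> = 1/d - 1/p"
    and K: "K = 4 * \<gamma>\<^sup>2 * (\<bar>measure lebesgue U\<bar> + 1) powr \<tau> * 2 powr (1 / (s * \<tau>)) * (Lp_norm (p * d / (d + p)) U f + e)"
  shows "AE x in lebesgue_on U. \<bar>u x\<bar> \<le> K"
proof -
  let ?M = "lebesgue_on U"
  interpret finite_measure ?M
    using U by (intro finite_measure_lebesgue_on) (simp add: bounded_set_imp_lmeasurable)
  obtain \<phi> D where A: "dominated_approx U \<phi> u G D"
    using H0_imp_dominated_approx[OF U H] by blast
  note [measurable] = dominated_approxD(2-4)[OF A]
  define q where "q = p * d / (d + p)"
  \<comment> \<open>A positive upper bound for the measure of the first level set; the added 1 keeps
    it positive when \<open>U\<close> has measure zero.\<close>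
  define m where "m = \<bar>measure lebesgue U\<bar> + 1"
  define N where "N = Lp_norm q U f"
  have N0: "N \<ge> 0" by (simp add: N_def Lp_norm_def)
  have d3: "d \<ge> 3" using d by simp
  have s2: "s > 2" using d3 by (simp add: s field_simps)
  have \<gamma>0: "\<gamma> > 0" using d3 by (simp add: \<gamma>)
  have \<tau>0: "\<tau> > 0" using d3 p by (simp add: \<tau> field_simps)
  have iq: "1/q = 1/d + 1/p" using d3 p by (simp add: q_def field_simps)
  have q0: "q > 0" using d3 p by (simp add: q_def)
  have "1/p < 1/d" using d3 p by (simp add: field_simps)
  then have "1/q < 1/d + 1/d" using iq by simp
  then have q2: "q > d/2" using q0 d3 by (simp add: field_simps)
  have inv_s: "1/s = 1/2 - 1/d" using d3 by (simp add: s field_simps)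
  have ex: "1 - 1/q - 1/s = 1/s + \<tau>" by (simp add: iq inv_s \<tau>)
  have m0: "m > 0" by (simp add: m_def add_nonneg_pos)
  \<comment> \<open>The slack \<open>e\<close> makes \<open>T\<close>, and with it the final level
    \<open>K\<close>, positive even if \<open>f\<close> vanishes.\<close>
  define T where "T = \<gamma>\<^sup>2 * (N + e)"
  have T0: "T > 0" using \<gamma>0 N0 e by (simp add: T_def)
  have K': "K = 4 * T * m powr \<tau> * 2 powr (1 / (s * \<tau>))"
    by (simp add: K T_def m_def N_def q_def mult_ac)
  have K0: "K > 0" using T0 m0 by (simp add: K')
  \<comment> \<open>The gap between consecutive levels is \<open>K / 2^(n+1)\<close>; the factor 1/2
    of the level estimate turns it into the \<open>K / 2^(n+2)\<close> of the iteration.\<close>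
  define lev where "lev n = K * (1 - 1/2^n)" for n :: nat
  define a where "a n = measure ?M {x \<in> U. \<bar>u x\<bar> > lev n}" for n
  have sets: "{x \<in> U. \<bar>u x\<bar> > t} \<in> sets ?M" for t
  proof -
    have "{x \<in> space ?M. \<bar>u x\<bar> > t} \<in> sets ?M" by measurable
    then show ?thesis by simp
  qed
  have "a \<longlonglongrightarrow> 0"
  proof (rule Stampacchia_iteration[OF _ _ m0 _ \<tau>0 T0 K'])
    show "a n \<ge> 0" for n by (simp add: a_def)
    have "a 0 \<le> measure ?M (space ?M)" unfolding a_def by (rule bounded_measure)
    also have "\<dots> = measure lebesgue U" using U by (simp add: measure_restrict_space)
    finally show "a 0 \<le> m" by (simp add: m_def)
    show "s > 0" using s2 by simp
    show "K / 2^(n+2) * a (Suc n) powr (1/s) \<le> T * a n powr (1/s + \<tau>)" for n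
    proof -
      have l0: "lev n \<ge> 0" using K0 by (simp add: lev_def)
      have h0: "K / 2^(n+1) > 0" using K0 by simp
      have "lev n + K / 2^(n+1) = lev (Suc n)" by (simp add: lev_def field_simps)
      then have "K / 2^(n+1) / 2 * a (Suc n) powr (1/s) \<le> \<gamma>\<^sup>2 * N * a n powr (1 - 1/q - 1/s)"
        using weak_solution_level_estimate[OF d s \<gamma> U A c cu q2 f[folded q_def] eq l0 h0]
        by (simp add: a_def N_def)
      also have "\<dots> \<le> T * a n powr (1/s + \<tau>)"
        unfolding ex T_def using \<gamma>0 e by (intro mult_right_mono mult_left_mono) auto
      finally show ?thesis by simp
    qed
  qed
  moreover have "measure ?M {x \<in> U. \<bar>u x\<bar> > K} \<le> a n" for n
  proof -
    have "lev n \<le> K" using K0 by (simp add: lev_def field_simps)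
    then show ?thesis unfolding a_def using sets by (intro finite_measure_mono) auto
  qed
  ultimately have "measure ?M {x \<in> U. \<bar>u x\<bar> > K} \<le> 0"
    by (intro LIMSEQ_le_const) auto
  then have "emeasure ?M {x \<in> U. \<bar>u x\<bar> > K} = 0"
    by (simp add: emeasure_eq_measure measure_le_0_iff)
  then show ?thesis
    using sets[of K] by (intro AE_I[where N = "{x \<in> U. \<bar>u x\<bar> > K}"]) auto
qed

section \<open>Existence of weak solutions\<close>

text \<open>A minimizing sequence of \<open>B a a / 2 - F a\<close> is Cauchy by the parallelogram identity, and its \<open>B\<close>-limit represents \<open>F\<close>.\<close>

lemma Riesz_minimizing_sequence:
  fixes B :: "('a \<Rightarrow> real) \<Rightarrow> ('a \<Rightarrow> real) \<Rightarrow> real" and F :: "('a \<Rightarrow> real) \<Rightarrow> real"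
  assumes V0: "V \<noteq> {}" and V: "\<And>a b t. a \<in> V \<Longrightarrow> b \<in> V \<Longrightarrow> (\<lambda>x. a x + t * b x) \<in> V"
    and B: "\<And>a b c t. a \<in> V \<Longrightarrow> b \<in> V \<Longrightarrow> c \<in> V \<Longrightarrow> B (\<lambda>x. a x + t * b x) c = B a c + t * B b c"
    and Bsym: "\<And>a b. a \<in> V \<Longrightarrow> b \<in> V \<Longrightarrow> B a b = B b a" and B0: "\<And>a. a \<in> V \<Longrightarrow> B a a \<ge> 0"
    and F: "\<And>a b t. a \<in> V \<Longrightarrow> b \<in> V \<Longrightarrow> F (\<lambda>x. a x + t * b x) = F a + t * F b"
    and FK: "\<And>a. a \<in> V \<Longrightarrow> \<bar>F a\<bar> \<le> K * sqrt (B a a)"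
  obtains \<phi> :: "nat \<Rightarrow> 'a \<Rightarrow> real" where "\<And>k. \<phi> k \<in> V"
    "\<And>e. e > 0 \<Longrightarrow> \<exists>N. \<forall>m\<ge>N. \<forall>n\<ge>N. B (\<lambda>x. \<phi> m x + (-1) * \<phi> n x) (\<lambda>x. \<phi> m x + (-1) * \<phi> n x) < e"
    "\<And>\<eta>. \<eta> \<in> V \<Longrightarrow> (\<lambda>k. B (\<phi> k) \<eta>) \<longlonglongrightarrow> F \<eta>"
proof -
  define J where "J a = B a a / 2 - F a" for a
  have J_expand: "J (\<lambda>x. a x + t * b x) = J a + t * (B a b - F b) + t\<^sup>2 / 2 * B b b" if ab: "a \<in> V" "b \<in> V" for a b t
  proof -
    let ?c = "\<lambda>x. a x + t * b x"
    have c: "?c \<in> V" using V ab by blast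
    have "B ?c ?c = B a ?c + t * B b ?c" using B ab c by blast
    also have "B a ?c = B a a + t * B b a" using Bsym[OF ab(1) c] B ab by simp
    also have "B b ?c = B a b + t * B b b" using Bsym[OF ab(2) c] B ab by simp
    also have "B b a = B a b" using Bsym ab by blast
    finally show ?thesis using F[OF ab, of t] unfolding J_def by (simp add: algebra_simps power2_eq_square add_divide_distrib)
  qed
  have J_ge: "J a \<ge> - (K\<^sup>2 / 2)" if a: "a \<in> V" for a
  proof -
    define z where "z = sqrt (B a a)"
    have "B a a = z\<^sup>2" using B0[OF a] by (simp add: z_def)
    moreover have "F a \<le> K * z" using FK[OF a] by (simp add: z_def)
    moreover have "2 * K * z \<le> K\<^sup>2 + z\<^sup>2" by (rule sum_squares_bound)
    ultimately show ?thesis by (simp add: J_def)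
  qed
  define m where "m = Inf (J ` V)"
  have bdd: "bdd_below (J ` V)" using J_ge by (auto intro!: bdd_belowI[of _ "- (K\<^sup>2 / 2)"])
  have m_le: "m \<le> J a" if "a \<in> V" for a unfolding m_def using that bdd by (intro cInf_lower) auto
  let ?e = "\<lambda>k. 1 / real (Suc k)"
  have "\<exists>a\<in>V. J a < m + ?e k" for k
  proof -
    have "\<exists>y\<in>J ` V. y < m + ?e k"
      unfolding m_def using V0 bdd by (intro cInf_lessD) auto
    then show ?thesis by auto
  qed
  then obtain \<phi> where \<phi>V: "\<And>k. \<phi> k \<in> V" and \<phi>J: "\<And>k. J (\<phi> k) < m + ?e k" by metis
  have e0: "(\<lambda>k. ?e k) \<longlonglongrightarrow> 0" using LIMSEQ_Suc[OF lim_1_over_n, where 'a1 = real] by simp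
  show ?thesis
  proof
    show "\<phi> k \<in> V" for k by (rule \<phi>V)
    fix e :: real assume e: "e > 0"
    have "\<exists>N. \<forall>k\<ge>N. norm (?e k - 0) < e/8" by (rule LIMSEQ_D[OF e0]) (use e in auto)
    then obtain N where N: "\<And>k. k \<ge> N \<Longrightarrow> ?e k < e/8" by auto
    have "B (\<lambda>x. \<phi> i x + (-1) * \<phi> j x) (\<lambda>x. \<phi> i x + (-1) * \<phi> j x) < e" if ij: "i \<ge> N" "j \<ge> N" for i j
    proof -
      define w where "w = (\<lambda>x. \<phi> i x + (-1) * \<phi> j x)"
      have w: "w \<in> V" unfolding w_def by (intro V \<phi>V)
      have "(\<lambda>x. \<phi> j x + 1 * w x) = \<phi> i" by (simp add: w_def)
      then have "J (\<phi> i) = J (\<phi> j) + (B (\<phi> j) w - F w) + B w w / 2"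
        using J_expand[OF \<phi>V[of j] w, of 1] by simp
      \<comment> \<open>Step 1/2 along \<open>w\<close> is the midpoint of \<open>\<phi> i\<close>
        and \<open>\<phi> j\<close>. Eliminating the linear term between this and the expansion at
        step 1 leaves only \<open>B w w\<close>.\<close>
      moreover have "m \<le> J (\<phi> j) + 1/2 * (B (\<phi> j) w - F w) + B w w / 8"
        using m_le[OF V[OF \<phi>V[of j] w, of "1/2"]] J_expand[OF \<phi>V[of j] w, of "1/2"] by (simp add: power2_eq_square)
      ultimately have "B w w \<le> 4 * (J (\<phi> i) + J (\<phi> j) - 2 * m)" by (simp add: algebra_simps)
      also have "\<dots> < e" using \<phi>J[of i] \<phi>J[of j] N[OF ij(1)] N[OF ij(2)] by simp
      finally show ?thesis by (simp add: w_def)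
    qed
    then show "\<exists>N. \<forall>m\<ge>N. \<forall>n\<ge>N. B (\<lambda>x. \<phi> m x + (-1) * \<phi> n x) (\<lambda>x. \<phi> m x + (-1) * \<phi> n x) < e" by blast
  next
    fix \<eta> assume \<eta>: "\<eta> \<in> V"
    define b where "b = 1 + B \<eta> \<eta> / 2"
    have le: "norm (B (\<phi> k) \<eta> - F \<eta>) \<le> sqrt (?e k) * b" for k
    proof -
      \<comment> \<open>The step is matched to the gap \<open>1 / Suc k\<close> to the infimum: a
        variation by \<open>t\<close> in either direction cannot gain more than
        \<open>t\<^sup>2\<close>, so the first variation is of order \<open>t\<close>.\<close>
      define t where "t = sqrt (?e k)"
      have t: "t > 0" "t\<^sup>2 = ?e k" by (auto simp: t_def)
      have "- (\<sigma> * t * (B (\<phi> k) \<eta> - F \<eta>)) \<le> t\<^sup>2 + t\<^sup>2 / 2 * B \<eta> \<eta>" if "\<sigma> = 1 \<or> \<sigma> = -1" for \<sigma>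
      proof -
        have "m \<le> J (\<phi> k) + (\<sigma> * t) * (B (\<phi> k) \<eta> - F \<eta>) + (\<sigma> * t)\<^sup>2 / 2 * B \<eta> \<eta>"
          using m_le[OF V[OF \<phi>V[of k] \<eta>, of "\<sigma> * t"]] J_expand[OF \<phi>V[of k] \<eta>, of "\<sigma> * t"] by simp
        moreover have "(\<sigma> * t)\<^sup>2 = t\<^sup>2" using that by auto
        ultimately show ?thesis using \<phi>J[of k] t(2) by simp
      qed
      from this[of 1] this[of "-1"]
      have "t * \<bar>B (\<phi> k) \<eta> - F \<eta>\<bar> \<le> t * (t * b)"
        by (auto simp: abs_if b_def power2_eq_square algebra_simps)
      then show ?thesis using t(1) by (simp add: t_def)
    qed
    have "(\<lambda>k. sqrt (?e k) * b) \<longlonglongrightarrow> sqrt 0 * b"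
      by (intro tendsto_mult tendsto_real_sqrt e0 tendsto_const)
    then have "(\<lambda>k. B (\<phi> k) \<eta> - F \<eta>) \<longlonglongrightarrow> 0"
      by (intro Lim_null_comparison[OF always_eventually[OF allI[OF le]]]) simp
    then show "(\<lambda>k. B (\<phi> k) \<eta>) \<longlonglongrightarrow> F \<eta>" by (simp add: LIM_zero_iff)
  qed
qed

lemma mult_le_sum_squares: "x * y \<le> x\<^sup>2 + y\<^sup>2" for x y :: real
  using sum_squares_bound[of x y] zero_le_power2[of x] zero_le_power2[of y] by linarith

section \<open>The energy form on test functions and its limits\<close>

lemma integrable_test_fun:
  assumes U: "open U" "bounded U" and a: "test_fun U a" and b: "test_fun U b"
  shows "integrable (lebesgue_on U) (\<lambda>x. grad a x \<bullet> grad b x)"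
    and "integrable (lebesgue_on U) h \<Longrightarrow> integrable (lebesgue_on U) (\<lambda>x. h x * a x)"
    and "integrable (lebesgue_on U) h \<Longrightarrow> integrable (lebesgue_on U) (\<lambda>x. h x * a x * b x)"
proof -
  note [measurable] = borel_measurable_test_fun[OF a] borel_measurable_test_fun[OF b]
  obtain A where A: "A > 0" "\<And>x. \<bar>a x\<bar> \<le> A" using test_fun_bounded[OF a] by metis
  obtain B where B: "B > 0" "\<And>x. \<bar>b x\<bar> \<le> B" using test_fun_bounded[OF b] by metis
  show "integrable (lebesgue_on U) (\<lambda>x. grad a x \<bullet> grad b x)"
  proof (rule Bochner_Integration.integrable_bound)
    show "integrable (lebesgue_on U) (\<lambda>x. (norm (grad a x))\<^sup>2 + (norm (grad b x))\<^sup>2)"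
      using integrable_test_fun_power2(2)[OF U a] integrable_test_fun_power2(2)[OF U b] by simp
    have "\<bar>grad a x \<bullet> grad b x\<bar> \<le> (norm (grad a x))\<^sup>2 + (norm (grad b x))\<^sup>2" for x
      by (rule order_trans[OF Cauchy_Schwarz_ineq2 mult_le_sum_squares])
    then show "AE x in lebesgue_on U. norm (grad a x \<bullet> grad b x) \<le> norm ((norm (grad a x))\<^sup>2 + (norm (grad b x))\<^sup>2)"
      by simp
  qed measurable
  assume h: "integrable (lebesgue_on U) h"
  note [measurable] = borel_measurable_integrable[OF h]
  show ha: "integrable (lebesgue_on U) (\<lambda>x. h x * a x)"
  proof (rule Bochner_Integration.integrable_bound)
    show "integrable (lebesgue_on U) (\<lambda>x. h x * A)" using h by simp
    show "AE x in lebesgue_on U. norm (h x * a x) \<le> norm (h x * A)"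
      using A by (auto simp: abs_mult intro!: mult_left_mono)
  qed measurable
  show "integrable (lebesgue_on U) (\<lambda>x. h x * a x * b x)"
  proof (rule Bochner_Integration.integrable_bound)
    show "integrable (lebesgue_on U) (\<lambda>x. h x * a x * B)" using ha by simp
    show "AE x in lebesgue_on U. norm (h x * a x * b x) \<le> norm (h x * a x * B)"
      using B by (auto simp: abs_mult intro!: mult_left_mono)
  qed measurable
qed

text \<open>Hoelder on the finite measure space \<open>U\<close> lowers the Sobolev exponent
  \<open>s\<close> to 2. This supplies the L^2 part of the Cauchy property, since the energy form
  contains only gradients and values weighted by \<open>c\<close>.\<close>

lemma Poincare_test_fun:
  fixes \<phi> :: "real^'n \<Rightarrow> real"
  assumes d: "d = real CARD('n)" "CARD('n) \<ge> 3" and s: "s = 2 * d / (d - 2)" and \<gamma>: "\<gamma> = 2 * (d - 1) / (d - 2)"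
    and U: "open U" "bounded U" and \<phi>: "test_fun U \<phi>"
  shows "(\<integral>x. (\<phi> x)\<^sup>2 \<partial>lebesgue_on U)
    \<le> (\<gamma> * measure (lebesgue_on U) U powr (1/2 - 1/s))\<^sup>2 * (\<integral>x. (norm (grad \<phi> x))\<^sup>2 \<partial>lebesgue_on U)"
proof -
  let ?M = "lebesgue_on U"
  interpret finite_measure ?M
    using U by (intro finite_measure_lebesgue_on) (simp add: bounded_set_imp_lmeasurable)
  note [measurable] = borel_measurable_test_fun[OF \<phi>]
  have d3: "d \<ge> 3" using d by simp
  have s2: "s > 2" using d3 by (simp add: s field_simps)
  obtain M where M: "M > 0" "\<And>x. \<bar>\<phi> x\<bar> \<le> M" using test_fun_bounded[OF \<phi>] by metis
  have i: "integrable ?M (\<lambda>x. \<bar>\<phi> x\<bar> powr s)"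
    by (rule integrable_const_bound[where B = "M powr s"]) (use M s2 in \<open>auto intro!: powr_mono2\<close>)
  have "(\<lambda>x. \<bar>\<phi> x * indicator U x\<bar> powr 2) = (\<lambda>x. (\<phi> x)\<^sup>2)"
    using test_fun_eq_0[OF \<phi>] by (auto simp: fun_eq_iff indicator_def powr_numeral)
  then have "sqrt (\<integral>x. (\<phi> x)\<^sup>2 \<partial>?M) = (\<integral>x. \<bar>\<phi> x * indicator U x\<bar> powr 2 \<partial>?M) powr (1/2)"
    by (simp add: powr_half_sqrt)
  also have "\<dots> \<le> (\<integral>x. \<bar>\<phi> x\<bar> powr s \<partial>?M) powr (1/s) * measure ?M U powr (1/2 - 1/s)"
  proof (rule Lp_restrict_le(2))
    show "U \<in> sets ?M" using sets.top[of ?M] by simp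
  qed (use s2 i in \<open>auto simp: less_top[symmetric]\<close>)
  also have "\<dots> \<le> (\<gamma> * sqrt (\<integral>x. (norm (grad \<phi> x))\<^sup>2 \<partial>?M)) * measure ?M U powr (1/2 - 1/s)"
    by (intro mult_right_mono Sobolev_test_fun[OF d s \<gamma> U(1) \<phi>]) auto
  finally have "(sqrt (\<integral>x. (\<phi> x)\<^sup>2 \<partial>?M))\<^sup>2 \<le> ((\<gamma> * sqrt (\<integral>x. (norm (grad \<phi> x))\<^sup>2 \<partial>?M)) * measure ?M U powr (1/2 - 1/s))\<^sup>2"
    by (intro power_mono) auto
  then show ?thesis by (simp add: power_mult_distrib mult_ac)
qed

text \<open>The minimizing sequence is Cauchy for the energy, hence by Poincare also in L^2, and a
  dominated subsequence has a limit in \<open>H0\<close>. For the gradient estimate the limit itself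
  is not admissible, so the equation is tested with the approximating test functions and the limit
  is taken afterwards.\<close>

lemma weak_solution_exists:
  fixes f :: "real^'n \<Rightarrow> real"
  assumes d: "d = real CARD('n)" "CARD('n) \<ge> 3" and \<gamma>: "\<gamma> = 2 * (d - 1) / (d - 2)"
    and U: "open U" "bounded U" and ci: "integrable (lebesgue_on U) c" and c0: "AE x in lebesgue_on U. c x \<ge> 0"
    and f1: "integrable (lebesgue_on U) f" and fr: "in_Lp (2 * d / (d + 2)) U f"
  obtains u G where "H0 U u G" "integrable (lebesgue_on U) (\<lambda>x. c x * u x)"
    "\<And>\<eta>. test_fun U \<eta> \<Longrightarrow>
      (\<integral>x. G x \<bullet> grad \<eta> x \<partial>lebesgue_on U) + (\<integral>x. c x * u x * \<eta> x \<partial>lebesgue_on U) = (\<integral>x. f x * \<eta> x \<partial>lebesgue_on U)"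
    "sqrt (\<integral>x. (norm (G x))\<^sup>2 \<partial>lebesgue_on U) \<le> \<gamma> * Lp_norm (2 * d / (d + 2)) U f"
proof -
  let ?M = "lebesgue_on U"
  interpret finite_measure ?M
    using U by (intro finite_measure_lebesgue_on) (simp add: bounded_set_imp_lmeasurable)
  define s where "s = 2 * d / (d - 2)"
  define r where "r = 2 * d / (d + 2)"
  have d3: "d \<ge> 3" using d by simp
  have s2: "s > 2" using d3 by (simp add: s_def field_simps)
  have \<gamma>0: "\<gamma> > 0" using d3 by (simp add: \<gamma>)
  have r1: "r > 1" "1/r + 1/s = 1" using d3 by (simp_all add: r_def s_def field_simps)
  define K where "K = \<gamma> * Lp_norm r U f"
  have K0: "K \<ge> 0" using \<gamma>0 by (simp add: K_def Lp_norm_def)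
  note [measurable] = borel_measurable_integrable[OF ci] borel_measurable_integrable[OF f1]
  have frr: "integrable ?M (\<lambda>x. \<bar>f x\<bar> powr r)" using fr by (simp add: in_Lp_def r_def)
  define B where "B a b = (\<integral>x. grad a x \<bullet> grad b x \<partial>?M) + (\<integral>x. c x * a x * b x \<partial>?M)" for a b
  define F where "F a = (\<integral>x. f x * a x \<partial>?M)" for a
  \<comment> \<open>Estimating by the gradient alone, not by the full energy, is what later gives
    the constant \<open>\<gamma>\<close> in the gradient bound.\<close>
  have F_grad: "\<bar>F a\<bar> \<le> K * sqrt (\<integral>x. (norm (grad a x))\<^sup>2 \<partial>?M)" if a: "test_fun U a" for a
  proof -
    note [measurable] = borel_measurable_test_fun[OF a]
    obtain M where M: "M > 0" "\<And>x. \<bar>a x\<bar> \<le> M" using test_fun_bounded[OF a] by metis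
    have i: "integrable ?M (\<lambda>x. \<bar>a x\<bar> powr s)"
      by (rule integrable_const_bound[where B = "M powr s"]) (use M s2 in \<open>auto intro!: powr_mono2\<close>)
    have "\<bar>F a\<bar> \<le> (\<integral>x. \<bar>f x * a x\<bar> \<partial>?M)" unfolding F_def by (rule integral_abs_bound)
    also have "\<dots> \<le> (\<integral>x. \<bar>f x\<bar> powr r \<partial>?M) powr (1/r) * (\<integral>x. \<bar>a x\<bar> powr s \<partial>?M) powr (1/s)"
      by (rule Holder_integral(2)) (use r1 s2 frr i in auto)
    also have "\<dots> \<le> Lp_norm r U f * (\<gamma> * sqrt (\<integral>x. (norm (grad a x))\<^sup>2 \<partial>?M))"
      unfolding Lp_norm_def by (intro mult_left_mono Sobolev_test_fun[OF d s_def \<gamma> U(1) a]) auto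
    finally show ?thesis by (simp add: K_def mult_ac)
  qed
  have Bgrad: "(\<integral>x. (norm (grad a x))\<^sup>2 \<partial>?M) + (\<integral>x. c x * (a x)\<^sup>2 \<partial>?M) = B a a" for a
    by (simp only: B_def power2_norm_eq_inner) (simp add: power2_eq_square mult.assoc)
  have c2: "(\<integral>x. c x * (a x)\<^sup>2 \<partial>?M) \<ge> 0" for a :: "real^'n \<Rightarrow> real"
    by (rule integral_nonneg_AE) (use c0 in eventually_elim, simp)
  have gB: "(\<integral>x. (norm (grad a x))\<^sup>2 \<partial>?M) \<le> B a a" for a using Bgrad[of a] c2[of a] by linarith
  have gg: "(\<integral>x. (norm (grad a x))\<^sup>2 \<partial>?M) \<ge> 0" for a by simp
  obtain \<phi> where \<phi>: "\<And>k. \<phi> k \<in> {a. test_fun U a}"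
    and Cau: "\<And>e. e > 0 \<Longrightarrow> \<exists>N. \<forall>m\<ge>N. \<forall>n\<ge>N. B (\<lambda>x. \<phi> m x + (-1) * \<phi> n x) (\<lambda>x. \<phi> m x + (-1) * \<phi> n x) < e"
    and wlim: "\<And>\<eta>. \<eta> \<in> {a. test_fun U a} \<Longrightarrow> (\<lambda>k. B (\<phi> k) \<eta>) \<longlonglongrightarrow> F \<eta>"
  proof (rule Riesz_minimizing_sequence[of "{a. test_fun U a}" B F K])
    show "{a. test_fun U a} \<noteq> {}" using test_fun_const_0 by blast
    show "(\<lambda>x. a x + t * b x) \<in> {a. test_fun U a}" if "a \<in> {a. test_fun U a}" "b \<in> {a. test_fun U a}" for a b t
      using that by (simp add: test_fun_lincomb)
    show "B a b = B b a" for a b by (simp add: B_def inner_commute mult_ac)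
    show "B a a \<ge> 0" for a using gB[of a] gg[of a] by linarith
    show "B (\<lambda>x. a x + t * b x) e = B a e + t * B b e"
      if "a \<in> {a. test_fun U a}" "b \<in> {a. test_fun U a}" "e \<in> {a. test_fun U a}" for a b e t
    proof -
      have a: "test_fun U a" and b: "test_fun U b" and e: "test_fun U e" using that by auto
      have 1: "(\<integral>x. grad (\<lambda>x. a x + t * b x) x \<bullet> grad e x \<partial>?M) = (\<integral>x. grad a x \<bullet> grad e x \<partial>?M) + t * (\<integral>x. grad b x \<bullet> grad e x \<partial>?M)"
        using integrable_test_fun(1)[OF U a e] integrable_test_fun(1)[OF U b e]
        by (simp add: grad_lincomb[OF test_fun_smooth[OF a] test_fun_smooth[OF b]] inner_add_left)
      have "(\<integral>x. c x * (a x + t * b x) * e x \<partial>?M) = (\<integral>x. c x * a x * e x + t * (c x * b x * e x) \<partial>?M)"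
        by (simp add: algebra_simps)
      also have "\<dots> = (\<integral>x. c x * a x * e x \<partial>?M) + t * (\<integral>x. c x * b x * e x \<partial>?M)"
        using integrable_test_fun(3)[OF U a e ci] integrable_test_fun(3)[OF U b e ci] by simp
      finally show ?thesis unfolding B_def 1 by (simp add: algebra_simps)
    qed
    show "F (\<lambda>x. a x + t * b x) = F a + t * F b"
      if "a \<in> {a. test_fun U a}" "b \<in> {a. test_fun U a}" for a b t
    proof -
      have a: "test_fun U a" and b: "test_fun U b" using that by auto
      have "F (\<lambda>x. a x + t * b x) = (\<integral>x. f x * a x + t * (f x * b x) \<partial>?M)"
        by (simp add: F_def algebra_simps)
      also have "\<dots> = F a + t * F b"
        using integrable_test_fun(2)[OF U a a f1] integrable_test_fun(2)[OF U b b f1] by (simp add: F_def)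
      finally show ?thesis .
    qed
    show "\<bar>F a\<bar> \<le> K * sqrt (B a a)" if "a \<in> {a. test_fun U a}" for a
    proof -
      have "K * sqrt (\<integral>x. (norm (grad a x))\<^sup>2 \<partial>?M) \<le> K * sqrt (B a a)"
        using gB K0 by (intro mult_left_mono) auto
      then show ?thesis using F_grad[of a] that by simp
    qed
  qed blast
  have T: "test_fun U (\<phi> k)" for k using \<phi> by simp
  note [measurable] = borel_measurable_test_fun[OF T]
  \<comment> \<open>The weighted middle component gives convergence and domination in \<open>L\<^sup>2(c dx)\<close> along the same subsequence.\<close>
  define h where "h k x = (\<phi> k x, sqrt \<bar>c x\<bar> * \<phi> k x, grad (\<phi> k) x)" for k x
  have hm [measurable]: "h k \<in> borel_measurable ?M" for k unfolding h_def by measurable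
  have hn: "(norm (h k x))\<^sup>2 = (\<phi> k x)\<^sup>2 + (\<bar>c x\<bar> * (\<phi> k x)\<^sup>2 + (norm (grad (\<phi> k) x))\<^sup>2)" for k x
    by (simp add: h_def norm_Pair power_mult_distrib)
  have ca: "integrable ?M (\<lambda>x. \<bar>c x\<bar>)" using ci by simp
  have i2: "integrable ?M (\<lambda>x. \<bar>c x\<bar> * (a x)\<^sup>2)" if a: "test_fun U a" for a
    using integrable_test_fun(3)[OF U a a ca] by (simp add: power2_eq_square mult.assoc)
  have hi: "integrable ?M (\<lambda>x. (norm (h k x))\<^sup>2)" for k
    unfolding hn using integrable_test_fun_power2[OF U T] i2[OF T] by simp
  define P where "P = (\<gamma> * measure ?M U powr (1/2 - 1/s))\<^sup>2"
  have hC: "\<exists>N. \<forall>m\<ge>N. \<forall>n\<ge>N. (\<integral>x. (norm (h m x - h n x))\<^sup>2 \<partial>?M) < e" if e: "e > 0" for e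
  proof -
    \<comment> \<open>The Poincare constant \<open>P\<close> accounts for the plain L^2 part, the 1
      for gradient and weighted part together, so the full norm is at most \<open>P + 1\<close>
      times the energy.\<close>
    have P0: "P + 1 > 0" by (simp add: P_def add_nonneg_pos)
    obtain N where N: "\<And>m n. m \<ge> N \<Longrightarrow> n \<ge> N \<Longrightarrow> B (\<lambda>x. \<phi> m x + (-1) * \<phi> n x) (\<lambda>x. \<phi> m x + (-1) * \<phi> n x) < e / (P + 1)"
      using Cau[of "e / (P + 1)"] e P0 by auto
    have "(\<integral>x. (norm (h m x - h n x))\<^sup>2 \<partial>?M) < e" if mn: "m \<ge> N" "n \<ge> N" for m n
    proof -
      define w where "w = (\<lambda>x. \<phi> m x + (-1) * \<phi> n x)"
      have w: "test_fun U w" unfolding w_def by (intro test_fun_lincomb T)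
      have gw: "grad w x = grad (\<phi> m) x - grad (\<phi> n) x" for x
        unfolding w_def using grad_lincomb[OF test_fun_smooth[OF T] test_fun_smooth[OF T], of m "-1" n x] by simp
      have "(norm (h m x - h n x))\<^sup>2 = (w x)\<^sup>2 + (\<bar>c x\<bar> * (w x)\<^sup>2 + (norm (grad w x))\<^sup>2)" for x
      proof -
        have "w x = \<phi> m x - \<phi> n x" by (simp add: w_def)
        then show ?thesis
          by (simp add: h_def norm_Pair power_mult_distrib gw flip: right_diff_distrib)
      qed
      then have "(\<integral>x. (norm (h m x - h n x))\<^sup>2 \<partial>?M)
          = (\<integral>x. (w x)\<^sup>2 \<partial>?M) + ((\<integral>x. \<bar>c x\<bar> * (w x)\<^sup>2 \<partial>?M) + (\<integral>x. (norm (grad w x))\<^sup>2 \<partial>?M))"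
        using integrable_test_fun_power2[OF U w] i2[OF w] by simp
      also have "(\<integral>x. \<bar>c x\<bar> * (w x)\<^sup>2 \<partial>?M) = (\<integral>x. c x * (w x)\<^sup>2 \<partial>?M)"
        by (rule integral_cong_AE) (use c0 borel_measurable_test_fun[OF w] in auto)
      also have "(\<integral>x. (w x)\<^sup>2 \<partial>?M) + ((\<integral>x. c x * (w x)\<^sup>2 \<partial>?M) + (\<integral>x. (norm (grad w x))\<^sup>2 \<partial>?M)) \<le> P * B w w + B w w"
      proof -
        have "(\<integral>x. (w x)\<^sup>2 \<partial>?M) \<le> P * (\<integral>x. (norm (grad w x))\<^sup>2 \<partial>?M)"
          unfolding P_def by (rule Poincare_test_fun[OF d s_def \<gamma> U w])
        also have "\<dots> \<le> P * B w w" using gB by (intro mult_left_mono) (auto simp: P_def)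
        finally show ?thesis using Bgrad[of w] by simp
      qed
      also have "\<dots> = (P + 1) * B w w" by (simp add: algebra_simps)
      also have "\<dots> < e" using N[OF mn] P0 unfolding w_def by (simp add: field_simps)
      finally show ?thesis .
    qed
    then show ?thesis by blast
  qed
  obtain \<rho> g D where \<rho>: "strict_mono \<rho>" and gm [measurable]: "g \<in> borel_measurable ?M" and Dm [measurable]: "D \<in> borel_measurable ?M"
    and Di: "integrable ?M (\<lambda>x. (D x)\<^sup>2)" and glim: "AE x in ?M. (\<lambda>k. h (\<rho> k) x) \<longlonglongrightarrow> g x"
    and D: "AE x in ?M. \<forall>k. norm (h (\<rho> k) x) \<le> D x"
    by (rule L2_Cauchy_dominated_subseq[OF hm hi hC]) auto
  define u where "u x = fst (g x)" for x
  define G where "G x = snd (snd (g x))" for x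
  have um [measurable]: "u \<in> borel_measurable ?M" unfolding u_def
    by (rule measurable_compose[OF gm borel_measurable_continuous_onI]) (intro continuous_intros)
  have Gm [measurable]: "G \<in> borel_measurable ?M" unfolding G_def
    by (rule measurable_compose[OF gm borel_measurable_continuous_onI]) (intro continuous_intros)
  have conv: "AE x in ?M. (\<lambda>k. \<phi> (\<rho> k) x) \<longlonglongrightarrow> u x \<and> (\<lambda>k. grad (\<phi> (\<rho> k)) x) \<longlonglongrightarrow> G x"
    using glim
  proof eventually_elim
    case (elim x)
    show ?case using tendsto_fst[OF elim] tendsto_snd[OF tendsto_snd[OF elim]] by (simp add: h_def u_def G_def)
  qed
  have dom: "AE x in ?M. \<forall>k. \<bar>\<phi> (\<rho> k) x\<bar> \<le> D x \<and> sqrt \<bar>c x\<bar> * \<bar>\<phi> (\<rho> k) x\<bar> \<le> D x \<and> norm (grad (\<phi> (\<rho> k)) x) \<le> D x"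
    using D
  proof eventually_elim
    case (elim x)
    show ?case
    proof
      fix k
      let ?y = "(sqrt \<bar>c x\<bar> * \<phi> (\<rho> k) x, grad (\<phi> (\<rho> k)) x)"
      have "norm (h (\<rho> k) x) \<le> D x" using elim by blast
      moreover have "norm (\<phi> (\<rho> k) x) \<le> norm (h (\<rho> k) x)" "norm ?y \<le> norm (h (\<rho> k) x)"
        unfolding h_def by (rule norm_fst_le norm_snd_le)+
      moreover have "norm (sqrt \<bar>c x\<bar> * \<phi> (\<rho> k) x) \<le> norm ?y" "norm (grad (\<phi> (\<rho> k)) x) \<le> norm ?y"
        by (rule norm_fst_le norm_snd_le)+
      ultimately show "\<bar>\<phi> (\<rho> k) x\<bar> \<le> D x \<and> sqrt \<bar>c x\<bar> * \<bar>\<phi> (\<rho> k) x\<bar> \<le> D x \<and> norm (grad (\<phi> (\<rho> k)) x) \<le> D x"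
        by (simp add: abs_mult)
    qed
  qed
  have A: "dominated_approx U (\<lambda>k. \<phi> (\<rho> k)) u G D"
    unfolding dominated_approx_def using T um Gm Dm Di conv dom by auto
  have domu: "AE x in ?M. sqrt \<bar>c x\<bar> * \<bar>u x\<bar> \<le> D x"
    using conv dom
  proof eventually_elim
    case (elim x)
    then have "(\<lambda>k. sqrt \<bar>c x\<bar> * \<bar>\<phi> (\<rho> k) x\<bar>) \<longlonglongrightarrow> sqrt \<bar>c x\<bar> * \<bar>u x\<bar>" by (intro tendsto_intros) auto
    then show ?case by (rule LIMSEQ_le_const2) (use elim in auto)
  qed
  \<comment> \<open>Splitting \<open>|c|\<close> into two square roots, one is square integrable
    because \<open>c\<close> is integrable, and the other is absorbed by the majorant of the
    weighted component. This gives the integrability of \<open>c u\<close>.\<close>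
  have c_sqrt: "\<bar>c x * y\<bar> \<le> \<bar>c x\<bar> + (D x)\<^sup>2" if "sqrt \<bar>c x\<bar> * \<bar>y\<bar> \<le> D x" for x y
  proof -
    have "\<bar>c x * y\<bar> = sqrt \<bar>c x\<bar> * (sqrt \<bar>c x\<bar> * \<bar>y\<bar>)" by (simp add: abs_mult flip: mult.assoc)
    also have "\<dots> \<le> sqrt \<bar>c x\<bar> * D x" using that by (intro mult_left_mono) auto
    also have "\<dots> \<le> \<bar>c x\<bar> + (D x)\<^sup>2"
      using mult_le_sum_squares[of "sqrt \<bar>c x\<bar>" "D x"] by simp
    finally show ?thesis .
  qed
  have cD: "integrable ?M (\<lambda>x. \<bar>c x\<bar> + (D x)\<^sup>2)" using ca Di by simp
  have cu: "integrable ?M (\<lambda>x. c x * u x)"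
  proof (rule Bochner_Integration.integrable_bound[OF cD])
    show "AE x in ?M. norm (c x * u x) \<le> norm (\<bar>c x\<bar> + (D x)\<^sup>2)"
      using domu by eventually_elim (use c_sqrt in force)
  qed measurable
  have weak: "(\<integral>x. G x \<bullet> grad \<eta> x \<partial>?M) + (\<integral>x. c x * u x * \<eta> x \<partial>?M) = (\<integral>x. f x * \<eta> x \<partial>?M)" if \<eta>: "test_fun U \<eta>" for \<eta>
  proof -
    note [measurable] = borel_measurable_test_fun[OF \<eta>]
    obtain M where M: "M > 0" "\<And>x. \<bar>\<eta> x\<bar> \<le> M" "\<And>x. norm (grad \<eta> x) \<le> M" using test_fun_bounded[OF \<eta>] by metis
    have "(\<lambda>k. \<integral>x. grad (\<phi> (\<rho> k)) x \<bullet> grad \<eta> x \<partial>?M) \<longlonglongrightarrow> (\<integral>x. G x \<bullet> grad \<eta> x \<partial>?M)"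
    proof (rule integral_dominated_convergence[where w = "\<lambda>x. (D x)\<^sup>2 + M\<^sup>2"])
      show "integrable ?M (\<lambda>x. (D x)\<^sup>2 + M\<^sup>2)" using Di by simp
      show "AE x in ?M. (\<lambda>k. grad (\<phi> (\<rho> k)) x \<bullet> grad \<eta> x) \<longlonglongrightarrow> G x \<bullet> grad \<eta> x"
        using conv by eventually_elim (intro tendsto_intros, auto)
      show "AE x in ?M. norm (grad (\<phi> (\<rho> k)) x \<bullet> grad \<eta> x) \<le> (D x)\<^sup>2 + M\<^sup>2" for k
        using dom
      proof eventually_elim
        case (elim x)
        have D0: "0 \<le> D x" using elim by (meson abs_ge_zero order_trans)
        have "norm (grad (\<phi> (\<rho> k)) x \<bullet> grad \<eta> x) \<le> norm (grad (\<phi> (\<rho> k)) x) * norm (grad \<eta> x)"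
          by (simp add: Cauchy_Schwarz_ineq2)
        also have "\<dots> \<le> D x * M" using elim M D0 by (intro mult_mono) auto
        also have "\<dots> \<le> (D x)\<^sup>2 + M\<^sup>2"
          by (rule mult_le_sum_squares)
        finally show ?case .
      qed
    qed measurable
    moreover have "(\<lambda>k. \<integral>x. c x * \<phi> (\<rho> k) x * \<eta> x \<partial>?M) \<longlonglongrightarrow> (\<integral>x. c x * u x * \<eta> x \<partial>?M)"
    proof (rule integral_dominated_convergence[where w = "\<lambda>x. (\<bar>c x\<bar> + (D x)\<^sup>2) * M"])
      show "integrable ?M (\<lambda>x. (\<bar>c x\<bar> + (D x)\<^sup>2) * M)" using cD by simp
      show "AE x in ?M. (\<lambda>k. c x * \<phi> (\<rho> k) x * \<eta> x) \<longlonglongrightarrow> c x * u x * \<eta> x"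
        using conv by eventually_elim (intro tendsto_intros, auto)
      show "AE x in ?M. norm (c x * \<phi> (\<rho> k) x * \<eta> x) \<le> (\<bar>c x\<bar> + (D x)\<^sup>2) * M" for k
        using dom
      proof eventually_elim
        case (elim x)
        then have "\<bar>c x * \<phi> (\<rho> k) x\<bar> \<le> \<bar>c x\<bar> + (D x)\<^sup>2" by (intro c_sqrt) auto
        then show ?case unfolding real_norm_def abs_mult[of "c x * \<phi> (\<rho> k) x"] using M by (intro mult_mono) auto
      qed
    qed measurable
    ultimately have "(\<lambda>k. B (\<phi> (\<rho> k)) \<eta>) \<longlonglongrightarrow> (\<integral>x. G x \<bullet> grad \<eta> x \<partial>?M) + (\<integral>x. c x * u x * \<eta> x \<partial>?M)"
      unfolding B_def by (rule tendsto_add)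
    moreover have "(\<lambda>k. B (\<phi> (\<rho> k)) \<eta>) \<longlonglongrightarrow> F \<eta>"
      using LIMSEQ_subseq_LIMSEQ[OF wlim \<rho>, of \<eta>] \<eta> by (simp add: o_def)
    ultimately show ?thesis unfolding F_def by (rule LIMSEQ_unique)
  qed
  define E where "E = (\<integral>x. (norm (G x))\<^sup>2 \<partial>?M)"
  \<comment> \<open>The weak equation with the approximant as test function reads
    \<open>F (\<phi> (\<rho> k))\<close> on the right, bounded by \<open>F_grad\<close>. In the zero
    order term, both \<open>u\<close> and the approximant carry a factor \<open>sqrt |c|\<close>
    dominated by \<open>D\<close>, so \<open>D\<^sup>2\<close> is a majorant.\<close>
  have "E + (\<integral>x. c x * u x * u x \<partial>?M) \<le> K * sqrt E"
  proof (rule LIMSEQ_le)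
    have "(\<lambda>k. \<integral>x. G x \<bullet> grad (\<phi> (\<rho> k)) x \<partial>?M) \<longlonglongrightarrow> (\<integral>x. G x \<bullet> G x \<partial>?M)"
    proof (rule integral_dominated_convergence[OF _ _ Di])
      show "AE x in ?M. (\<lambda>k. G x \<bullet> grad (\<phi> (\<rho> k)) x) \<longlonglongrightarrow> G x \<bullet> G x"
        using conv by eventually_elim (intro tendsto_intros, auto)
      show "AE x in ?M. norm (G x \<bullet> grad (\<phi> (\<rho> k)) x) \<le> (D x)\<^sup>2" for k
        using dominated_approxD(11)[OF A] dominated_approxD(9)[OF A, of k]
      proof eventually_elim
        case (elim x)
        have "norm (G x \<bullet> grad (\<phi> (\<rho> k)) x) \<le> norm (G x) * norm (grad (\<phi> (\<rho> k)) x)"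
          by (simp add: Cauchy_Schwarz_ineq2)
        also have "\<dots> \<le> D x * D x"
          using elim by (intro mult_mono) (auto intro: order_trans[OF norm_ge_zero])
        finally show ?case by (simp add: power2_eq_square)
      qed
    qed measurable
    moreover have "(\<lambda>k. \<integral>x. c x * u x * \<phi> (\<rho> k) x \<partial>?M) \<longlonglongrightarrow> (\<integral>x. c x * u x * u x \<partial>?M)"
    proof (rule integral_dominated_convergence[OF _ _ Di])
      show "AE x in ?M. (\<lambda>k. c x * u x * \<phi> (\<rho> k) x) \<longlonglongrightarrow> c x * u x * u x"
        using conv by eventually_elim (intro tendsto_intros, auto)
      show "AE x in ?M. norm (c x * u x * \<phi> (\<rho> k) x) \<le> (D x)\<^sup>2" for k
        using dom domu
      proof eventually_elim
        case (elim x)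
        have D0: "0 \<le> D x" using elim(1) by (meson abs_ge_zero order_trans)
        have "norm (c x * u x * \<phi> (\<rho> k) x) = (sqrt \<bar>c x\<bar> * \<bar>u x\<bar>) * (sqrt \<bar>c x\<bar> * \<bar>\<phi> (\<rho> k) x\<bar>)"
          by (simp add: abs_mult mult_ac flip: real_sqrt_mult)
        also have "\<dots> \<le> D x * D x" using elim D0 by (intro mult_mono) auto
        finally show ?case by (simp add: power2_eq_square)
      qed
    qed measurable
    ultimately show "(\<lambda>k. (\<integral>x. G x \<bullet> grad (\<phi> (\<rho> k)) x \<partial>?M) + (\<integral>x. c x * u x * \<phi> (\<rho> k) x \<partial>?M)) \<longlonglongrightarrow> E + (\<integral>x. c x * u x * u x \<partial>?M)"
      unfolding E_def power2_norm_eq_inner by (rule tendsto_add)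
    show "(\<lambda>k. K * sqrt (\<integral>x. (norm (grad (\<phi> (\<rho> k)) x))\<^sup>2 \<partial>?M)) \<longlonglongrightarrow> K * sqrt E"
      unfolding E_def by (intro tendsto_mult tendsto_const tendsto_real_sqrt dominated_approx_integral_grad(2)[OF A])
    have "(\<integral>x. G x \<bullet> grad (\<phi> (\<rho> k)) x \<partial>?M) + (\<integral>x. c x * u x * \<phi> (\<rho> k) x \<partial>?M) \<le> K * sqrt (\<integral>x. (norm (grad (\<phi> (\<rho> k)) x))\<^sup>2 \<partial>?M)" for k
      using weak[OF T] F_grad[OF T, of "\<rho> k"] by (simp add: F_def)
    then show "\<exists>N. \<forall>k\<ge>N. (\<integral>x. G x \<bullet> grad (\<phi> (\<rho> k)) x \<partial>?M) + (\<integral>x. c x * u x * \<phi> (\<rho> k) x \<partial>?M) \<le> K * sqrt (\<integral>x. (norm (grad (\<phi> (\<rho> k)) x))\<^sup>2 \<partial>?M)"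
      by blast
  qed
  moreover have "(\<integral>x. c x * u x * u x \<partial>?M) \<ge> 0"
    using c2[of u] by (simp add: power2_eq_square mult.assoc)
  ultimately have EK: "E \<le> K * sqrt E" by simp
  have E0: "E \<ge> 0" by (simp add: E_def)
  have "sqrt E \<le> K"
  proof (cases "E = 0")
    case False
    then have pos: "sqrt E > 0" using E0 by simp
    have "sqrt E * sqrt E \<le> K * sqrt E" using EK E0 by simp
    then show ?thesis using pos by (rule mult_right_le_imp_le)
  qed (use K0 in simp)
  then show ?thesis
    using that[OF dominated_approx_imp_H0[OF A] cu weak] by (simp add: E_def K_def r_def)
qed

section \<open>Uniqueness and existence with a uniform constant\<close>

theorem mainTheorem6:
  assumes "CARD('n) \<ge> 3"
  shows
  "(\<forall>(U :: (real^'n) set) c v G.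
      bounded U \<and> open U \<and> integrable (lebesgue_on U) c \<and>
      (AE x in lebesgue_on U. c x \<ge> 0) \<and>
      H0 U v G \<and> integrable (lebesgue_on U) (\<lambda>x. c x * v x) \<and>
      (\<forall>\<phi>. test_fun U \<phi> \<longrightarrow>
         (\<integral>x. G x \<bullet> grad \<phi> x \<partial>lebesgue_on U) + (\<integral>x. c x * v x * \<phi> x \<partial>lebesgue_on U) = 0)
      \<longrightarrow> (AE x in lebesgue_on U. v x = 0))
   \<and>
   (\<exists>C :: real \<Rightarrow> real \<Rightarrow> real. (\<forall>p m. C p m > 0) \<and>
     (\<forall>(U :: (real^'n) set) c f p.
        bounded U \<and> open U \<and> integrable (lebesgue_on U) c \<and>
        (AE x in lebesgue_on U. c x \<ge> 0) \<and>
        real CARD('n) < p \<and> in_Lp (p * real CARD('n) / (real CARD('n) + p)) U f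
        \<longrightarrow> (\<exists>u Gu. H0 U u Gu \<and> in_Linf U u \<and>
              (\<forall>\<phi>. test_fun U \<phi> \<longrightarrow>
                 (\<integral>x. Gu x \<bullet> grad \<phi> x \<partial>lebesgue_on U) + (\<integral>x. c x * u x * \<phi> x \<partial>lebesgue_on U)
                 = (\<integral>x. f x * \<phi> x \<partial>lebesgue_on U)) \<and>
              sqrt (\<integral>x. (norm (Gu x))^2 \<partial>lebesgue_on U)
                \<le> 2 * (real CARD('n) - 1) / (real CARD('n) - 2)
                   * Lp_norm (2 * real CARD('n) / (real CARD('n) + 2)) U f \<and>
              Linf_norm U u \<le> C p (measure lebesgue U)
                   * Lp_norm (p * real CARD('n) / (real CARD('n) + p)) U f)))"
proof -
  define d where "d = real CARD('n)"
  define s where "s = 2 * d / (d - 2)"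
  define \<gamma> where "\<gamma> = 2 * (d - 1) / (d - 2)"
  have d3: "d \<ge> 3" using assms by (simp add: d_def)
  have \<gamma>0: "\<gamma> > 0" using d3 by (simp add: \<gamma>_def)
  note par = d_def assms s_def \<gamma>_def
  \<comment> \<open>The level \<open>K\<close> of \<open>weak_solution_bounded\<close> without its
    factor containing \<open>f\<close>. The absolute value keeps \<open>C\<close> positive for every
    real argument \<open>m\<close>.\<close>
  define C where "C p m = 4 * \<gamma>\<^sup>2 * (\<bar>m\<bar> + 1) powr (1/d - 1/p) * 2 powr (1 / (s * (1/d - 1/p)))" for p m
  have C0: "C p m > 0" for p m
  proof -
    have "\<bar>m\<bar> + 1 > 0" by (rule add_nonneg_pos) auto
    then show ?thesis using \<gamma>0 by (simp add: C_def)
  qed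
  have unique: "AE x in lebesgue_on U. v x = 0"
    if U: "bounded U" "open U" and c: "AE x in lebesgue_on U. c x \<ge> 0" and v: "H0 U v G"
      and cv: "integrable (lebesgue_on U) (\<lambda>x. c x * v x)"
      and eq: "\<forall>\<phi>. test_fun U \<phi> \<longrightarrow>
         (\<integral>x. G x \<bullet> grad \<phi> x \<partial>lebesgue_on U) + (\<integral>x. c x * v x * \<phi> x \<partial>lebesgue_on U) = 0"
    for U :: "(real^'n) set" and c v G
  proof -
    \<comment> \<open>Any exponent above \<open>d\<close> would do, as \<open>f = 0\<close> lies in
      every L^q space.\<close>
    define p where "p = d + 1"
    define q where "q = p * d / (d + p)"
    have f: "in_Lp q U (\<lambda>x. 0)" by (simp add: in_Lp_def)
    have N: "Lp_norm q U (\<lambda>x. 0) = 0" by (simp add: Lp_norm_def)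
    define A where "A = C p (measure lebesgue U)"
    have A0: "A > 0" unfolding A_def by (rule C0)
    have bd: "AE x in lebesgue_on U. \<bar>v x\<bar> \<le> A * e" if "e > 0" for e
      by (rule weak_solution_bounded[OF par U(2,1) v c cv _ f[unfolded q_def] _ that refl])
         (use eq N in \<open>auto simp: p_def A_def C_def q_def\<close>)
    have "AE x in lebesgue_on U. \<bar>v x\<bar> \<le> A * (1 / real (Suc n))" for n
      by (rule bd) simp
    then have "AE x in lebesgue_on U. \<forall>n. \<bar>v x\<bar> \<le> A * (1 / real (Suc n))"
      by (simp add: AE_all_countable)
    then show ?thesis
    proof eventually_elim
      case (elim x)
      have "(\<lambda>n. A * (1 / real (Suc n))) \<longlonglongrightarrow> A * 0"
        using LIMSEQ_Suc[OF lim_1_over_n, where 'a1 = real] by (intro tendsto_mult tendsto_const) simp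
      then have "\<bar>v x\<bar> \<le> A * 0"
        by (rule LIMSEQ_le_const) (use elim in auto)
      then show ?case by simp
    qed
  qed
  have ex: "\<exists>u Gu. H0 U u Gu \<and> in_Linf U u \<and>
        (\<forall>\<phi>. test_fun U \<phi> \<longrightarrow>
           (\<integral>x. Gu x \<bullet> grad \<phi> x \<partial>lebesgue_on U) + (\<integral>x. c x * u x * \<phi> x \<partial>lebesgue_on U)
           = (\<integral>x. f x * \<phi> x \<partial>lebesgue_on U)) \<and>
        sqrt (\<integral>x. (norm (Gu x))^2 \<partial>lebesgue_on U) \<le> \<gamma> * Lp_norm (2 * d / (d + 2)) U f \<and>
        Linf_norm U u \<le> C p (measure lebesgue U) * Lp_norm (p * d / (d + p)) U f"
    if U: "bounded U" "open U" and ci: "integrable (lebesgue_on U) c" and c: "AE x in lebesgue_on U. c x \<ge> 0"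
      and p: "d < p" and f: "in_Lp (p * d / (d + p)) U f"
    for U :: "(real^'n) set" and c f p
  proof -
    let ?M = "lebesgue_on U"
    interpret finite_measure ?M
      using U by (intro finite_measure_lebesgue_on) (simp add: bounded_set_imp_lmeasurable)
    define q where "q = p * d / (d + p)"
    have "d * d < d * p" using p d3 by simp
    then have q2: "q > d / 2" using d3 p by (simp add: q_def field_simps)
    have [measurable]: "f \<in> borel_measurable ?M" and fq: "integrable ?M (\<lambda>x. \<bar>f x\<bar> powr q)"
      using f by (auto simp: in_Lp_def q_def)
    \<comment> \<open>For \<open>d \<ge> 3\<close> one has
      \<open>1 \<le> 2 * d / (d + 2) \<le> d / 2 < q\<close>, so on the finite measure space both
      remaining integrability conditions on \<open>f\<close> follow from the one at
      \<open>q\<close>.\<close>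
    have fr: "integrable ?M (\<lambda>x. \<bar>f x\<bar> powr r)" if "1 \<le> r" "r < q" for r
    proof -
      have "integrable ?M (\<lambda>x. \<bar>f x * indicator (space ?M) x\<bar> powr r)"
        using that fq by (intro Lp_restrict_le(1)[where q = q]) (auto simp: less_top[symmetric])
      then show ?thesis
        by (rule Bochner_Integration.integrable_cong[THEN iffD1, rotated 2]) (auto simp: indicator_def)
    qed
    have f1: "integrable ?M f"
      using fr[of 1] q2 d3 by (simp add: integrable_abs_iff)
    have "2 * d / (d + 2) \<ge> 1" "2 * d / (d + 2) \<le> d / 2" using d3 by (simp_all add: field_simps)
    then have f2: "in_Lp (2 * d / (d + 2)) U f"
      using fr[of "2 * d / (d + 2)"] q2 by (simp add: in_Lp_def)
    obtain u G where H: "H0 U u G" and cu: "integrable ?M (\<lambda>x. c x * u x)"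
      and eq: "\<And>\<eta>. test_fun U \<eta> \<Longrightarrow>
        (\<integral>x. G x \<bullet> grad \<eta> x \<partial>?M) + (\<integral>x. c x * u x * \<eta> x \<partial>?M) = (\<integral>x. f x * \<eta> x \<partial>?M)"
      and grad_le: "sqrt (\<integral>x. (norm (G x))\<^sup>2 \<partial>?M) \<le> \<gamma> * Lp_norm (2 * d / (d + 2)) U f"
      by (rule weak_solution_exists[OF d_def assms \<gamma>_def U(2,1) ci c f1 f2]) blast
    define A where "A = C p (measure lebesgue U)"
    have A0: "A > 0" unfolding A_def by (rule C0)
    have N0: "Lp_norm q U f \<ge> 0" by (simp add: Lp_norm_def)
    have bd: "AE x in ?M. \<bar>u x\<bar> \<le> A * (Lp_norm q U f + e)" if "e > 0" for e
      unfolding A_def C_def q_def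
      by (rule weak_solution_bounded[OF par U(2,1) H c cu p f eq that refl refl])
    have "Linf_norm U u \<le> A * (Lp_norm q U f + e)" if "e > 0" for e
      unfolding Linf_norm_def
    proof (rule cInf_lower)
      show "A * (Lp_norm q U f + e) \<in> {M. 0 \<le> M \<and> (AE x in ?M. \<bar>u x\<bar> \<le> M)}"
        using bd[OF that] A0 N0 that by simp
      show "bdd_below {M. 0 \<le> M \<and> (AE x in ?M. \<bar>u x\<bar> \<le> M)}"
        by (rule bdd_belowI[of _ 0]) simp
    qed
    \<comment> \<open>The preceding bound at \<open>e / A\<close>, so that the error is exactly
      \<open>e\<close>.\<close>
    then have "Linf_norm U u \<le> A * Lp_norm q U f + e" if "e > 0" for e
      using A0 that by (force simp: distrib_left dest: spec[of _ "e / A"])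
    then have "Linf_norm U u \<le> A * Lp_norm q U f" by (rule field_le_epsilon)
    moreover have "in_Linf U u" using bd[of 1] H by (auto simp: in_Linf_def H0_def)
    ultimately show ?thesis
      using H eq grad_le by (auto simp: A_def q_def intro!: exI[of _ u] exI[of _ G])
  qed
  show ?thesis
    unfolding d_def[symmetric] \<gamma>_def[symmetric]
    by (intro conjI exI[of _ C] allI impI; (elim conjE)?; (rule unique | rule C0 | rule ex); assumption)
qed

end
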